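(* Let $K$ be a field, and let $m_0<m_1<m_2<m_3$ be positive integers with $\gcd=1$, $m_i=m_0+id$ ($d>0$), minimally generating the numerical semigroup they generate. Write $m_0=3a+b$ with integers $a\ge 1$ and $b\in\{1,2,3\}$. Let $S=R_b[t]$ and let $\mathfrak{a}_b\subseteq S$ be the ideal generated by the polynomials $P(i,j)$ ($i,j\in\{1,2\}$) and $P(\Psi(b,l))$ ($l\in[0,3-b]$). Then, with respect to the monomial order $>_{\mathcal E}$ on $S$, a Gröbner basis of $\mathfrak{a}_b$ is the set consisting of: all $P(i,j)$ ($i,j\in\{1,2\}$); all $P(\Psi(b,l))$ ($l\in[0,3-b]$); all $M(b,j)$ ($j\in[0,2-b]$, only when $b\ne 3$); $L(0),L(1)$; all $B(i,j)$ ($i,j\in\{1,2\}$); all $A(i;b,j)$ ($i\in\{1,2,3\}$, $j\in[0,2-b]$, only when $b\neq 3$); $D$; and the $Q(b,i)$, namely $Q(1,1),Q(1,2)$ if $b=1$, $Q(2,1)$ if $b=2$, and none if $b=3$.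
   Context: Notation: $[u,v]=\{n\in\mathbb{Z}: u\le n\le v\}$. $R=K[X_0,X_1,X_2,X_3]$. For $i,j\in\{1,2\}$ let $\epsilon(i,j)=i+j$ if $i+j<3$ and $\epsilon(i,j)=3$ if $i+j\ge 3$, and $\phi(i,j)=X_iX_j-X_{\epsilon(i,j)}X_{i+j-\epsilon(i,j)}$; explicitly $\phi(1,1)=X_1^2-X_2X_0$, $\phi(1,2)=\phi(2,1)=X_1X_2-X_3X_0$, $\phi(2,2)=X_2^2-X_1X_3$. For $j\in[0,3-b]$ let $\psi(b,j)=X_{b+j}X_3^a-X_jX_0^{a+d}$. $R_b=K[X_1,X_2,X_3,X_0,\Psi(b,0),\dots,\Psi(b,3-b),\Phi(2,2),\Phi(1,2),\Phi(1,1)]$ is a polynomial ring in these indeterminates, and $S=R_b[t]$ with $t$ a further indeterminate. Conventions: $\Phi(i,j)=\Phi(j,i)$; $\Phi(i,j)=0$ if $i\notin\{1,2\}$ or $j\notin\{1,2\}$; $\Psi(b,j)=0$ if $j\notin[0,3-b]$; $X_i=0$ if $i\notin[0,3]$. Monomial order $>_{\mathcal E}$: a monomial of $S$ is $t^k X_1^{\alpha_1}X_2^{\alpha_2}X_3^{\alpha_3}X_0^{\alpha_0}\prod_{i=0}^{3-b}\Psi(b,i)^{\beta_i}\,\Phi(2,2)^{\gamma_1}\Phi(1,2)^{\gamma_2}\Phi(1,1)^{\gamma_3}$, with $\alpha=(\alpha_1,\alpha_2,\alpha_3,\alpha_0)$, $\beta=(\beta_0,\dots,\beta_{3-b})$,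 $\gamma=(\gamma_1,\gamma_2,\gamma_3)$. Define the additive weight $\omega$ on $t$-free monomials by $\omega(X_i)=m_i$, $\omega(\Phi(i,j))=m_i+m_j$, $\omega(\Psi(b,j))=am_3+m_{b+j}$. Then $t^k\mathbb{X}^\alpha\Psi^\beta\Phi^\gamma>_{\mathcal E}t^{k'}\mathbb{X}^{\alpha'}\Psi^{\beta'}\Phi^{\gamma'}$ iff the first applicable condition holds: (i) $k>k'$; (ii) $k=k'$ and $\omega(\mathbb{X}^\alpha\Psi^\beta\Phi^\gamma)>\omega(\mathbb{X}^{\alpha'}\Psi^{\beta'}\Phi^{\gamma'})$; (iii) equal so far and $\sum\beta_i>\sum\beta'_i$; (iv) equal so far, $\sum\beta_i=\sum\beta'_i$, and the rightmost nonzero entry of $\beta-\beta'$ is negative; (v) $\beta=\beta'$ and $\sum\gamma_i>\sum\gamma'_i$; (vi) $\beta=\beta'$, $\sum\gamma_i=\sum\gamma'_i$ and the rightmost nonzero entry of $\gamma-\gamma'$ is negative; (vii) $\beta=\beta'$, $\gamma=\gamma'$ and the rightmost nonzero entry of $\alpha-\alpha'$ is negative (in (v)–(vii) also $k=k'$ and equal weights). Polynomials: $P(i,j)=t\,\phi(i,j)-\Phi(i,j)$ for $i,j\in\{1,2\}$; $P(\Psi(b,l))=tX_{b+l}X_3^a-tX_lX_0^{a+d}-\Psi(b,l)$ for $l\in[0,3-b]$; $D=(X_1^2-X_2X_0)\Phi(1,2)-(X_1X_2-X_3X_0)\Phi(1,1)$; $B(i,j)=\phi(i,j)\Psi(b,3-b)-(X_3^{a+1}-X_{3-b}X_0^{a+d})\Phi(i,j)$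 for $i,j\in\{1,2\}$; $L(i)=X_i\Phi(2,2)-X_{i+1}\Phi(1,2)+X_{i+2}\Phi(1,1)$ for $i\in\{0,1\}$; for $b\ne 3$, $i\in\{1,2,3\}$, $j\in[0,2-b]$ (with $\epsilon(u,v)=u+v$ if $u+v<3$, $=3$ otherwise): $A(i;b,j)=X_i\Psi(b,j)-X_{b+i+j-\epsilon(i,b+j)}\Psi(b,\epsilon(i,b+j)-b)-X_3^a\Phi(i,b+j)+X_0^{a+d}[\Phi(i,j)-\Phi(b+i+j-3,3-b)]$; for $b\ne3$, $i\in[0,2-b]$: $M(b,i)=tX_0^{a+d+1}\Psi(b,i)+\Psi(b,0)\Psi(b,i)-tX_3^{a-1}X_{1+b+i}X_{b-1}\Psi(b,3-b)-tX_3^{2a}\Phi(b,b+i)+(-1)^{i+1}tX_3^{a-1}X_0^{a+d}X_{3b+3i-3}\Phi(3-b-i,3-b-i)$; $Q(1,1)=\Psi(1,0)\Phi(2,2)+\Psi(1,2)\Phi(1,1)-\Psi(1,1)\Phi(1,2)$; $Q(1,2)=\Psi(1,1)^2-\Psi(1,2)\Psi(1,0)-X_3^{a-1}\Psi(1,2)\Phi(2,2)+X_0^{a+d-1}\Psi(1,0)\Phi(1,1)-X_3^{a-1}X_0^{a+d-1}(\Phi(1,2)^2-\Phi(2,2)\Phi(1,1))$; $Q(2,1)=\Psi(2,0)^2\Phi(2,2)-X_3^{a-1}\Psi(2,1)\Phi(2,2)^2-\Psi(2,1)\Psi(2,0)\Phi(1,2)-X_3^{a-1}X_0^{a+d-1}\Phi(1,2)^3+\Psi(2,1)^2\Phi(1,1)+X_3^{a-1}X_0^{a+d-1}\Phi(2,2)\Phi(1,2)\Phi(1,1)+X_0^{a+d-1}\Psi(2,0)\Phi(1,1)^2$.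 *)

theory Defs
  imports Main "HOL-Library.Poly_Mapping"
begin

text \<open>Indeterminates: t, X_0..X_3, Psi(b,j), Phi(2,2), Phi(1,2), Phi(1,1).
  The constructor argument of Psi is the index j of Psi(b,j).\<close>
datatype var = Tv | Xv nat | PsiVar nat | Phi22 | Phi12 | Phi11

type_synonym monom = "var \<Rightarrow>\<^sub>0 nat"
type_synonym 'k mpoly = "monom \<Rightarrow>\<^sub>0 'k"

definition S_vars :: "nat \<Rightarrow> var set" where
  "S_vars b = {Tv, Phi22, Phi12, Phi11} \<union> Xv ` {0..3} \<union> PsiVar ` {0..3 - b}"

definition in_S :: "nat \<Rightarrow> 'k::zero mpoly \<Rightarrow> bool" where
  "in_S b f \<longleftrightarrow> (\<forall>m\<in>Poly_Mapping.keys f. Poly_Mapping.keys m \<subseteq> S_vars b)"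

definition Var :: "var \<Rightarrow> 'k::comm_ring_1 mpoly" where
  "Var v = Poly_Mapping.single (Poly_Mapping.single v 1) 1"

definition tt :: "'k::comm_ring_1 mpoly" where "tt = Var Tv"

definition X :: "int \<Rightarrow> 'k::comm_ring_1 mpoly" where
  "X i = (if 0 \<le> i \<and> i \<le> 3 then Var (Xv (nat i)) else 0)"

definition PhiV :: "int \<Rightarrow> int \<Rightarrow> 'k::comm_ring_1 mpoly" where
  "PhiV i j = (if i = 1 \<and> j = 1 then Var Phi11
     else if (i = 1 \<and> j = 2) \<or> (i = 2 \<and> j = 1) then Var Phi12
     else if i = 2 \<and> j = 2 then Var Phi22 else 0)"

definition PsiV :: "nat \<Rightarrow> int \<Rightarrow> 'k::comm_ring_1 mpoly" where
  "PsiV b j = (if 0 \<le> j \<and> j \<le> 3 - int b then Var (PsiVar (nat j)) else 0)"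

definition eps :: "int \<Rightarrow> int \<Rightarrow> int" where
  "eps i j = (if i + j < 3 then i + j else 3)"

definition phi :: "int \<Rightarrow> int \<Rightarrow> 'k::comm_ring_1 mpoly" where
  "phi i j = X i * X j - X (eps i j) * X (i + j - eps i j)"

definition PP :: "int \<Rightarrow> int \<Rightarrow> 'k::comm_ring_1 mpoly" where
  "PP i j = tt * phi i j - PhiV i j"

definition PPsi :: "nat \<Rightarrow> nat \<Rightarrow> nat \<Rightarrow> int \<Rightarrow> 'k::comm_ring_1 mpoly" where
  "PPsi a d b l = tt * X (int b + l) * X 3 ^ a - tt * X l * X 0 ^ (a + d) - PsiV b l"

definition DD :: "'k::comm_ring_1 mpoly" where
  "DD = (X 1 ^ 2 - X 2 * X 0) * PhiV 1 2 - (X 1 * X 2 - X 3 * X 0) * PhiV 1 1"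

definition BB :: "nat \<Rightarrow> nat \<Rightarrow> nat \<Rightarrow> int \<Rightarrow> int \<Rightarrow> 'k::comm_ring_1 mpoly" where
  "BB a d b i j = phi i j * PsiV b (3 - int b)
     - (X 3 ^ (a + 1) - X (3 - int b) * X 0 ^ (a + d)) * PhiV i j"

definition LL :: "int \<Rightarrow> 'k::comm_ring_1 mpoly" where
  "LL i = X i * PhiV 2 2 - X (i + 1) * PhiV 1 2 + X (i + 2) * PhiV 1 1"

definition AA :: "nat \<Rightarrow> nat \<Rightarrow> int \<Rightarrow> nat \<Rightarrow> int \<Rightarrow> 'k::comm_ring_1 mpoly" where
  "AA a d i b j = X i * PsiV b j
     - X (int b + i + j - eps i (int b + j)) * PsiV b (eps i (int b + j) - int b)
     - X 3 ^ a * PhiV i (int b + j)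
     + X 0 ^ (a + d) * (PhiV i j - PhiV (int b + i + j - 3) (3 - int b))"

definition MM :: "nat \<Rightarrow> nat \<Rightarrow> nat \<Rightarrow> int \<Rightarrow> 'k::comm_ring_1 mpoly" where
  "MM a d b i = tt * X 0 ^ (a + d + 1) * PsiV b i + PsiV b 0 * PsiV b i
     - tt * X 3 ^ (a - 1) * X (1 + int b + i) * X (int b - 1) * PsiV b (3 - int b)
     - tt * X 3 ^ (2 * a) * PhiV (int b) (int b + i)
     + (- 1) ^ nat (i + 1) * tt * X 3 ^ (a - 1) * X 0 ^ (a + d) * X (3 * int b + 3 * i - 3)
         * PhiV (3 - int b - i) (3 - int b - i)"

definition Q11 :: "'k::comm_ring_1 mpoly" where
  "Q11 = PsiV 1 0 * PhiV 2 2 + PsiV 1 2 * PhiV 1 1 - PsiV 1 1 * PhiV 1 2"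

definition Q12 :: "nat \<Rightarrow> nat \<Rightarrow> 'k::comm_ring_1 mpoly" where
  "Q12 a d = PsiV 1 1 ^ 2 - PsiV 1 2 * PsiV 1 0 - X 3 ^ (a - 1) * PsiV 1 2 * PhiV 2 2
     + X 0 ^ (a + d - 1) * PsiV 1 0 * PhiV 1 1
     - X 3 ^ (a - 1) * X 0 ^ (a + d - 1) * (PhiV 1 2 ^ 2 - PhiV 2 2 * PhiV 1 1)"

definition Q21 :: "nat \<Rightarrow> nat \<Rightarrow> 'k::comm_ring_1 mpoly" where
  "Q21 a d = PsiV 2 0 ^ 2 * PhiV 2 2 - X 3 ^ (a - 1) * PsiV 2 1 * PhiV 2 2 ^ 2
     - PsiV 2 1 * PsiV 2 0 * PhiV 1 2 - X 3 ^ (a - 1) * X 0 ^ (a + d - 1) * PhiV 1 2 ^ 3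
     + PsiV 2 1 ^ 2 * PhiV 1 1 + X 3 ^ (a - 1) * X 0 ^ (a + d - 1) * PhiV 2 2 * PhiV 1 2 * PhiV 1 1
     + X 0 ^ (a + d - 1) * PsiV 2 0 * PhiV 1 1 ^ 2"

definition gens_a :: "nat \<Rightarrow> nat \<Rightarrow> nat \<Rightarrow> 'k::comm_ring_1 mpoly set" where
  "gens_a a d b = {PP i j | i j. i \<in> {1,2} \<and> j \<in> {1,2}}
     \<union> {PPsi a d b l | l. 0 \<le> l \<and> l \<le> 3 - int b}"

definition GB_set :: "nat \<Rightarrow> nat \<Rightarrow> nat \<Rightarrow> 'k::comm_ring_1 mpoly set" where
  "GB_set a d b =
     {PP i j | i j. i \<in> {1,2} \<and> j \<in> {1,2}}
     \<union> {PPsi a d b l | l. 0 \<le> l \<and> l \<le> 3 - int b}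
     \<union> (if b \<noteq> 3 then {MM a d b j | j. 0 \<le> j \<and> j \<le> 2 - int b} else {})
     \<union> {LL 0, LL 1}
     \<union> {BB a d b i j | i j. i \<in> {1,2} \<and> j \<in> {1,2}}
     \<union> (if b \<noteq> 3 then {AA a d i b j | i j. i \<in> {1,2,3} \<and> 0 \<le> j \<and> j \<le> 2 - int b} else {})
     \<union> {DD}
     \<union> (if b = 1 then {Q11, Q12 a d} else if b = 2 then {Q21 a d} else {})"

definition ideal_S :: "nat \<Rightarrow> 'k::comm_ring_1 mpoly set \<Rightarrow> 'k mpoly set" where
  "ideal_S b G = {f. \<exists>c. (\<forall>g\<in>G. in_S b (c g)) \<and> f = (\<Sum>g\<in>G. c g * g)}"

definition mm :: "nat \<Rightarrow> nat \<Rightarrow> int \<Rightarrow> nat" where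
  "mm m0 d i = m0 + nat i * d"

definition omega :: "nat \<Rightarrow> nat \<Rightarrow> nat \<Rightarrow> nat \<Rightarrow> monom \<Rightarrow> nat" where
  "omega m0 d a b \<mu> =
     (\<Sum>i\<in>{0..3::nat}. Poly_Mapping.lookup \<mu> (Xv i) * mm m0 d (int i))
     + (\<Sum>j\<in>{0..3 - b}. Poly_Mapping.lookup \<mu> (PsiVar j) * (a * mm m0 d 3 + mm m0 d (int (b + j))))
     + Poly_Mapping.lookup \<mu> Phi22 * (mm m0 d 2 + mm m0 d 2)
     + Poly_Mapping.lookup \<mu> Phi12 * (mm m0 d 1 + mm m0 d 2)
     + Poly_Mapping.lookup \<mu> Phi11 * (mm m0 d 1 + mm m0 d 1)"

definition beta_vec :: "nat \<Rightarrow> monom \<Rightarrow> nat list" where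
  "beta_vec b \<mu> = map (\<lambda>j. Poly_Mapping.lookup \<mu> (PsiVar j)) [0..<4 - b]"

definition gamma_vec :: "monom \<Rightarrow> nat list" where
  "gamma_vec \<mu> = [Poly_Mapping.lookup \<mu> Phi22, Poly_Mapping.lookup \<mu> Phi12, Poly_Mapping.lookup \<mu> Phi11]"

definition alpha_vec :: "monom \<Rightarrow> nat list" where
  "alpha_vec \<mu> = [Poly_Mapping.lookup \<mu> (Xv 1), Poly_Mapping.lookup \<mu> (Xv 2), Poly_Mapping.lookup \<mu> (Xv 3), Poly_Mapping.lookup \<mu> (Xv 0)]"

definition rightmost_neg :: "nat list \<Rightarrow> nat list \<Rightarrow> bool" where
  "rightmost_neg xs ys \<longleftrightarrow> (\<exists>i < length xs. xs ! i < ys ! i \<and>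
      (\<forall>j. i < j \<and> j < length xs \<longrightarrow> xs ! j = ys ! j))"

definition gtE :: "nat \<Rightarrow> nat \<Rightarrow> nat \<Rightarrow> nat \<Rightarrow> monom \<Rightarrow> monom \<Rightarrow> bool" where
  "gtE m0 d a b \<mu> \<nu> \<longleftrightarrow>
     (let k = Poly_Mapping.lookup \<mu> Tv; k' = Poly_Mapping.lookup \<nu> Tv;
          w = omega m0 d a b \<mu>; w' = omega m0 d a b \<nu>;
          be = beta_vec b \<mu>; be' = beta_vec b \<nu>;
          ga = gamma_vec \<mu>; ga' = gamma_vec \<nu>;
          al = alpha_vec \<mu>; al' = alpha_vec \<nu>
      in k > k' \<or> (k = k' \<and> (w > w' \<or> (w = w' \<and>
          (sum_list be > sum_list be' \<or> (sum_list be = sum_list be' \<and>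
          (rightmost_neg be be' \<or> (be = be' \<and>
          (sum_list ga > sum_list ga' \<or> (sum_list ga = sum_list ga' \<and>
          (rightmost_neg ga ga' \<or> (ga = ga' \<and> rightmost_neg al al'))))))))))))"

definition lead_mon :: "(monom \<Rightarrow> monom \<Rightarrow> bool) \<Rightarrow> 'k::zero mpoly \<Rightarrow> monom" where
  "lead_mon gt f = (THE \<mu>. \<mu> \<in> Poly_Mapping.keys f \<and> (\<forall>\<nu>\<in>Poly_Mapping.keys f. \<nu> \<noteq> \<mu> \<longrightarrow> gt \<mu> \<nu>))"

definition mon_dvd :: "monom \<Rightarrow> monom \<Rightarrow> bool" where
  "mon_dvd \<mu> \<nu> \<longleftrightarrow> (\<forall>v. Poly_Mapping.lookup \<mu> v \<le> Poly_Mapping.lookup \<nu> v)"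

definition is_groebner_basis ::
  "(monom \<Rightarrow> monom \<Rightarrow> bool) \<Rightarrow> 'k::zero mpoly set \<Rightarrow> 'k mpoly set \<Rightarrow> bool" where
  "is_groebner_basis gt G I \<longleftrightarrow> finite G \<and> G \<subseteq> I \<and>
     (\<forall>f\<in>I. f \<noteq> 0 \<longrightarrow> (\<exists>g\<in>G. g \<noteq> 0 \<and> mon_dvd (lead_mon gt g) (lead_mon gt f)))"

definition minimally_generating :: "(nat \<Rightarrow> nat) \<Rightarrow> nat \<Rightarrow> bool" where
  "minimally_generating m n \<longleftrightarrow>
     (\<forall>j\<le>n. \<not> (\<exists>c::nat \<Rightarrow> nat. m j = (\<Sum>i\<in>{0..n} - {j}. c i * m i)))"

end

theory Submission
  imports Defs "HOL-Analysis.Infinite_Sum" "HOL-Analysis.Elementary_Metric_Spaces" "HOL-Library.Product_Plus"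
begin

text \<open>
  Substituting \<open>t \<phi>(i,j)\<close> for \<open>\<Phi>(i,j)\<close> and \<open>t \<psi>(b,j)\<close> for \<open>\<Psi>(b,j)\<close> identifies \<open>S/a_b\<close> with \<open>K[t,X]\<close>.
  Hence the images of the standard monomials (those divisible by no leading monomial of the candidate
  basis) span \<open>K[t,X]\<close>, and the candidate is a Groebner basis iff these images are linearly
  independent. Everything is homogeneous for the bigrading by \<open>\<omega>\<close> and by the total degree in
  \<open>t, \<Psi>, \<Phi>\<close>, whose pieces are finite-dimensional, so independence means that no bidegree
  contains more standard monomials than monomials in \<open>t, X\<close>; no S-polynomial has to be reduced.
  Since the reverse inequality holds in each bidegree, it is enough to compare the two Hilbert series
  at one point of convergence: a monomial gets the weight \<open>2^-n\<close>, with \<open>n\<close> the sum of its two degrees.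
  The standard monomials are covered by finitely many boxes of exponents, whose weights
  are products of geometric series and add up to the weight of \<open>K[t,X]\<close>.
\<close>

section \<open>Substitution homomorphisms\<close>

text \<open>Both degrees are needed: \<omega> gives t the weight 0, so its own pieces are
  infinite-dimensional, and the total degree ignores X. The weights fit the substitution because the
  two terms of \<psi>(b,j) agree: a m_3 + m_{b+j} = (a+d) m_0 + m_j, a consequence of m_0 = 3a+b.
  For the same reason the boxes need only cover and may overlap. The count balances because
  \<Psi>(b,j) has the bidegree of t X_{b+j} X_3^a, the leading monomial of P(\<Psi>(b,j)): for j <
  3-b, what is lost by forbidding that monomial is regained in monomials containing such a
  \<Psi>(b,j), and A, M and Q cut these down to exactly the required number.\<close>

abbreviation "lk \<equiv> Poly_Mapping.lookup"
abbreviation "kys \<equiv> Poly_Mapping.keys"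
abbreviation "sgl \<equiv> Poly_Mapping.single"

lemma poly_mapping_eq_sum_single:
  fixes f :: "'a \<Rightarrow>\<^sub>0 'b::comm_monoid_add"
  shows "f = (\<Sum>m\<in>kys f. sgl m (lk f m))"
proof (rule poly_mapping_eqI)
  fix n
  have "lk (\<Sum>m\<in>kys f. sgl m (lk f m)) n = (\<Sum>m\<in>kys f. if n = m then lk f m else 0)"
    by (simp add: lookup_sum lookup_single when_def eq_commute)
  also have "\<dots> = lk f n"
    by (auto simp: in_keys_iff)
  finally show "lk f n = lk (\<Sum>m\<in>kys f. sgl m (lk f m)) n" ..
qed

definition mono_subst :: "(var \<Rightarrow> 'k::comm_ring_1 mpoly) \<Rightarrow> monom \<Rightarrow> 'k mpoly" where
  "mono_subst \<sigma> m = (\<Prod>v\<in>kys m. \<sigma> v ^ lk m v)"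

definition subst :: "(var \<Rightarrow> 'k::comm_ring_1 mpoly) \<Rightarrow> 'k mpoly \<Rightarrow> 'k mpoly" where
  "subst \<sigma> f = (\<Sum>m\<in>kys f. sgl 0 (lk f m) * mono_subst \<sigma> m)"

lemma mono_subst_superset:
  "finite A \<Longrightarrow> kys m \<subseteq> A \<Longrightarrow> mono_subst \<sigma> m = (\<Prod>v\<in>A. \<sigma> v ^ lk m v)"
  unfolding mono_subst_def by (rule prod.mono_neutral_left) (auto simp: in_keys_iff)

lemma mono_subst_0 [simp]: "mono_subst \<sigma> 0 = 1"
  by (simp add: mono_subst_def)

lemma mono_subst_add: "mono_subst \<sigma> (m + n) = mono_subst \<sigma> m * mono_subst \<sigma> n"
proof -
  let ?A = "kys m \<union> kys n"
  have "mono_subst \<sigma> (m + n) = (\<Prod>v\<in>?A. \<sigma> v ^ lk (m + n) v)"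
    by (rule mono_subst_superset) (use keys_add[of m n] in auto)
  also have "\<dots> = (\<Prod>v\<in>?A. \<sigma> v ^ lk m v) * (\<Prod>v\<in>?A. \<sigma> v ^ lk n v)"
    by (simp add: lookup_add power_add prod.distrib)
  also have "\<dots> = mono_subst \<sigma> m * mono_subst \<sigma> n"
    by (simp add: mono_subst_superset[of ?A])
  finally show ?thesis .
qed

lemma subst_superset:
  "finite A \<Longrightarrow> kys f \<subseteq> A \<Longrightarrow> subst \<sigma> f = (\<Sum>m\<in>A. sgl 0 (lk f m) * mono_subst \<sigma> m)"
  unfolding subst_def by (rule sum.mono_neutral_left) (auto simp: in_keys_iff)

lemma subst_single: "subst \<sigma> (sgl m c) = sgl 0 c * mono_subst \<sigma> m"
  by (subst subst_superset[of "{m}"]) (auto simp: in_keys_iff lookup_single)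

lemma subst_0 [simp]: "subst \<sigma> 0 = 0"
  by (simp add: subst_def)

lemma subst_1 [simp]: "subst \<sigma> 1 = 1"
  using subst_single[of \<sigma> 0 1] by simp

lemma subst_add: "subst \<sigma> (f + g) = subst \<sigma> f + subst \<sigma> g"
proof -
  let ?A = "kys f \<union> kys g"
  have "subst \<sigma> (f + g) = (\<Sum>m\<in>?A. sgl 0 (lk (f + g) m) * mono_subst \<sigma> m)"
    by (rule subst_superset) (use keys_add[of f g] in auto)
  also have "\<dots> = (\<Sum>m\<in>?A. sgl 0 (lk f m) * mono_subst \<sigma> m) + (\<Sum>m\<in>?A. sgl 0 (lk g m) * mono_subst \<sigma> m)"
    by (simp add: lookup_add single_add distrib_right sum.distrib)
  also have "\<dots> = subst \<sigma> f + subst \<sigma> g"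
    by (simp add: subst_superset[of ?A])
  finally show ?thesis .
qed

lemma subst_uminus: "subst \<sigma> (- f) = - subst \<sigma> f"
  using subst_add[of \<sigma> f "- f"] by (simp add: add_eq_0_iff)

lemma subst_diff: "subst \<sigma> (f - g) = subst \<sigma> f - subst \<sigma> g"
  using subst_add[of \<sigma> f "- g"] by (simp add: subst_uminus)

lemma subst_sum: "subst \<sigma> (sum f A) = (\<Sum>x\<in>A. subst \<sigma> (f x))"
  by (induction A rule: infinite_finite_induct) (auto simp: subst_add)

lemma subst_mult_single: "subst \<sigma> (sgl m c * sgl n e) = subst \<sigma> (sgl m c) * subst \<sigma> (sgl n e)"
proof -
  have "subst \<sigma> (sgl m c * sgl n e) = sgl 0 (c * e) * (mono_subst \<sigma> m * mono_subst \<sigma> n)"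
    by (simp add: mult_single subst_single mono_subst_add)
  also have "sgl 0 (c * e) = sgl (0 :: monom) c * sgl 0 e"
    by (simp add: mult_single)
  finally show ?thesis
    by (simp only: subst_single mult_ac)
qed

lemma subst_mult: "subst \<sigma> (f * g) = subst \<sigma> f * subst \<sigma> g"
proof -
  have "subst \<sigma> (f * g) = subst \<sigma> ((\<Sum>m\<in>kys f. sgl m (lk f m)) * (\<Sum>n\<in>kys g. sgl n (lk g n)))"
    by (simp flip: poly_mapping_eq_sum_single)
  also have "\<dots> = subst \<sigma> (\<Sum>m\<in>kys f. sgl m (lk f m)) * subst \<sigma> (\<Sum>n\<in>kys g. sgl n (lk g n))"
    by (simp add: sum_product subst_sum subst_mult_single)
  finally show ?thesis
    by (simp flip: poly_mapping_eq_sum_single)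
qed

lemma subst_power: "subst \<sigma> (f ^ n) = subst \<sigma> f ^ n"
  by (induction n) (simp_all add: subst_mult)

lemma subst_Var: "subst \<sigma> (Var v) = \<sigma> v"
  by (simp add: Var_def subst_single mono_subst_def)

lemmas subst_simps = subst_0 subst_1 subst_add subst_uminus subst_diff subst_mult subst_power subst_Var

lemma single_power: "sgl m (c::'k::comm_ring_1) ^ n = (sgl (\<Sum>i<n. m) (c ^ n) :: 'k mpoly)"
  by (induction n) (simp_all add: mult_single add.commute)

lemma sum_const_single: "(\<Sum>i<n. sgl v k) = (sgl v (n * k) :: monom)"
  by (induction n) (simp_all flip: single_add add: algebra_simps)

lemma Var_power: "Var v ^ n = (sgl (sgl v n) 1 :: 'k::comm_ring_1 mpoly)"
  by (simp add: Var_def single_power sum_const_single)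

lemma prod_Var: "finite A \<Longrightarrow> (\<Prod>v\<in>A. (Var v :: 'k::comm_ring_1 mpoly) ^ f v) = sgl (\<Sum>v\<in>A. sgl v (f v)) 1"
  by (induction A rule: finite_induct) (simp_all add: Var_power mult_single)

lemma mono_subst_Var:
  assumes "\<And>v. v \<in> kys m \<Longrightarrow> \<sigma> v = Var v"
  shows "mono_subst \<sigma> m = (sgl m 1 :: 'k::comm_ring_1 mpoly)"
proof -
  have "mono_subst \<sigma> m = (\<Prod>v\<in>kys m. (Var v :: 'k mpoly) ^ lk m v)"
    by (simp add: mono_subst_def assms)
  also have "\<dots> = sgl m 1"
    by (simp add: prod_Var flip: poly_mapping_eq_sum_single)
  finally show ?thesis .
qed

section \<open>Standard monomials for the kernel of a substitution\<close>

text \<open>Scalars act as constant polynomials. This makes the Steinitz bound on independent sets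
  inside a finite span available.\<close>

interpretation mpoly_vs: vector_space "\<lambda>(c::'k::field) (f::'k mpoly). sgl 0 c * f"
  by unfold_locales (simp_all add: algebra_simps single_add mult_single flip: mult.assoc)

text \<open>Reading off the coefficient at \<kappa> isolates the scalar of
  \<open>sgl \<kappa> 1\<close>.\<close>

lemma mpoly_independent_monomials:
  "mpoly_vs.independent ((\<lambda>\<kappa>. sgl \<kappa> (1::'k::field)) ` A)"
proof (unfold mpoly_vs.independent_explicit_module, intro allI impI)
  fix T :: "'k mpoly set" and u v
  assume T: "finite T" "T \<subseteq> (\<lambda>\<kappa>. sgl \<kappa> 1) ` A" "(\<Sum>v\<in>T. sgl 0 (u v) * v) = 0" "v \<in> T"
  from T obtain \<kappa> where \<kappa>: "v = sgl \<kappa> 1" by auto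
  have "lk (sgl 0 (u w) * w) \<kappa> = (if w = v then u v else 0)" if w: "w \<in> T" for w
    using T(2) w \<kappa> by (auto simp: mult_single lookup_single when_def)
  then have "(\<Sum>w\<in>T. if w = v then u v else 0) = lk (\<Sum>w\<in>T. sgl 0 (u w) * w) \<kappa>"
    by (simp add: lookup_sum)
  with T show "u v = 0" by simp
qed

definition Mon :: "var set \<Rightarrow> monom set" where
  "Mon A = {\<mu>. kys \<mu> \<subseteq> A}"

lemma Mon_add: "\<mu> \<in> Mon A \<Longrightarrow> \<nu> \<in> Mon A \<Longrightarrow> \<mu> + \<nu> \<in> Mon A"
  using keys_add[of \<mu> \<nu>] by (auto simp: Mon_def)

lemma keys_power_degree:
  fixes f :: "'k::comm_ring_1 mpoly" and deg :: "monom \<Rightarrow> 'g::comm_monoid_add"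
  assumes add: "\<And>\<mu> \<nu>. deg (\<mu> + \<nu>) = deg \<mu> + deg \<nu>" and "deg 0 = 0"
    and f: "\<And>\<kappa>. \<kappa> \<in> kys f \<Longrightarrow> \<kappa> \<in> Mon B \<and> deg \<kappa> = deg (sgl v 1)"
  shows "\<kappa> \<in> kys (f ^ n) \<Longrightarrow> \<kappa> \<in> Mon B \<and> deg \<kappa> = deg (sgl v n)"
proof (induction n arbitrary: \<kappa>)
  case 0
  then show ?case using assms(2) by (simp add: Mon_def)
next
  case (Suc n)
  then obtain \<mu> \<nu> where "\<kappa> = \<mu> + \<nu>" "\<mu> \<in> kys f" "\<nu> \<in> kys (f ^ n)"
    using keys_mult[of f "f ^ n"] by auto
  moreover have "deg (sgl v (Suc n)) = deg (sgl v 1) + deg (sgl v n)"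
    using add[of "sgl v 1" "sgl v n"] by (simp flip: single_add)
  ultimately show ?case using f Suc.IH by (simp add: add Mon_add)
qed

text \<open>What the counting argument takes from the concrete situation: a homogeneous retraction
  \<sigma> of the ring in V onto the ring in B, and a translation-invariant total order. Descent
  along \<open>gt\<close> terminates because it stays within one degree, which
  \<open>finite_deg\<close> makes finite.\<close>

locale graded_subst =
  fixes V B :: "var set" and gt :: "monom \<Rightarrow> monom \<Rightarrow> bool"
    and deg :: "monom \<Rightarrow> 'g::cancel_comm_monoid_add" and \<sigma> :: "var \<Rightarrow> 'k::field mpoly"
  assumes B_V: "B \<subseteq> V"
    and deg_add: "deg (\<mu> + \<nu>) = deg \<mu> + deg \<nu>"
    and finite_deg: "finite {\<mu> \<in> Mon V. deg \<mu> = \<delta>}"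
    and gt_irrefl: "\<not> gt \<mu> \<mu>"
    and gt_trans: "gt \<mu> \<nu> \<Longrightarrow> gt \<nu> \<kappa> \<Longrightarrow> gt \<mu> \<kappa>"
    and gt_total: "\<mu> \<in> Mon V \<Longrightarrow> \<nu> \<in> Mon V \<Longrightarrow> \<mu> \<noteq> \<nu> \<Longrightarrow> gt \<mu> \<nu> \<or> gt \<nu> \<mu>"
    and gt_add: "gt \<mu> \<nu> \<Longrightarrow> gt (\<kappa> + \<mu>) (\<kappa> + \<nu>)"
    and \<sigma>_B: "v \<in> B \<Longrightarrow> \<sigma> v = Var v"
    and \<sigma>_deg: "v \<in> V \<Longrightarrow> \<kappa> \<in> kys (\<sigma> v) \<Longrightarrow> \<kappa> \<in> Mon B \<and> deg \<kappa> = deg (sgl v 1)"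
begin

lemma deg_0: "deg 0 = 0"
  using deg_add[of 0 0] by (metis add.right_neutral add_left_cancel)

lemma Mon_B_V: "\<mu> \<in> Mon B \<Longrightarrow> \<mu> \<in> Mon V"
  using B_V by (auto simp: Mon_def)

definition below :: "monom \<Rightarrow> monom set" where
  "below \<mu> = {\<nu> \<in> Mon V. gt \<mu> \<nu> \<and> deg \<nu> = deg \<mu>}"

text \<open>Besides naming the leading monomial this includes homogeneity: all other terms lie in
  the degree of \<mu>.\<close>

definition has_lead :: "'k mpoly \<Rightarrow> monom \<Rightarrow> bool" where
  "has_lead g \<mu> \<longleftrightarrow> \<mu> \<in> Mon V \<and> (\<exists>c h. c \<noteq> 0 \<and> g = sgl \<mu> c + h \<and> kys h \<subseteq> below \<mu>)"

lemma finite_below: "finite (below \<mu>)"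
  by (rule finite_subset[OF _ finite_deg[of "deg \<mu>"]]) (auto simp: below_def)

lemma lead_mon_eqI:
  assumes "\<mu> \<in> kys f" "\<And>\<nu>. \<nu> \<in> kys f \<Longrightarrow> \<nu> \<noteq> \<mu> \<Longrightarrow> gt \<mu> \<nu>"
  shows "lead_mon gt f = \<mu>"
  unfolding lead_mon_def
proof (rule the_equality)
  fix \<nu> assume "\<nu> \<in> kys f \<and> (\<forall>\<kappa>\<in>kys f. \<kappa> \<noteq> \<nu> \<longrightarrow> gt \<nu> \<kappa>)"
  then show "\<nu> = \<mu>" using assms gt_irrefl gt_trans[of \<mu> \<nu> \<mu>] by metis
qed (use assms in auto)

lemma has_lead_lead_mon:
  assumes "has_lead g \<mu>"
  shows "g \<noteq> 0" "lead_mon gt g = \<mu>"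
proof -
  obtain c h where g: "c \<noteq> 0" "g = sgl \<mu> c + h" "kys h \<subseteq> below \<mu>"
    using assms by (auto simp: has_lead_def)
  have "\<mu> \<notin> kys h" using g gt_irrefl by (auto simp: below_def)
  then have \<mu>: "\<mu> \<in> kys g" using g by (simp add: in_keys_iff lookup_add)
  then show "g \<noteq> 0" by auto
  have "kys g \<subseteq> insert \<mu> (below \<mu>)"
    using g keys_add[of "sgl \<mu> c" h] by (auto split: if_splits)
  then show "lead_mon gt g = \<mu>"
    by (intro lead_mon_eqI[OF \<mu>]) (auto simp: below_def)
qed

text \<open>Induction over finite subsets A of the support; the monomial truncated to A carries the
  degree along.\<close>

lemma keys_mono_subst:
  assumes "\<mu> \<in> Mon V" "\<kappa> \<in> kys (mono_subst \<sigma> \<mu>)"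
  shows "\<kappa> \<in> Mon B" "deg \<kappa> = deg \<mu>"
proof -
  have *: "\<kappa> \<in> Mon B \<and> deg \<kappa> = deg (\<Sum>v\<in>A. sgl v (lk \<mu> v))"
    if "finite A" "A \<subseteq> V" "\<kappa> \<in> kys (\<Prod>v\<in>A. \<sigma> v ^ lk \<mu> v)" for A \<kappa>
    using that
  proof (induction A arbitrary: \<kappa> rule: finite_induct)
    case empty
    then show ?case by (simp add: Mon_def deg_0)
  next
    case (insert v A)
    from insert.prems insert.hyps obtain \<alpha> \<beta> where \<kappa>: "\<kappa> = \<alpha> + \<beta>" "\<alpha> \<in> kys (\<sigma> v ^ lk \<mu> v)"
        "\<beta> \<in> kys (\<Prod>v\<in>A. \<sigma> v ^ lk \<mu> v)"
      using keys_mult[of "\<sigma> v ^ lk \<mu> v" "\<Prod>v\<in>A. \<sigma> v ^ lk \<mu> v"] by auto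
    have "\<alpha> \<in> Mon B \<and> deg \<alpha> = deg (sgl v (lk \<mu> v))"
      by (rule keys_power_degree[OF deg_add deg_0 _ \<kappa>(2)]) (use \<sigma>_deg insert.prems in auto)
    then show ?case using insert \<kappa> by (simp add: Mon_add deg_add)
  qed
  have "\<kappa> \<in> Mon B \<and> deg \<kappa> = deg \<mu>"
    using *[of "kys \<mu>" \<kappa>] assms by (simp add: mono_subst_def Mon_def flip: poly_mapping_eq_sum_single)
  then show "\<kappa> \<in> Mon B" "deg \<kappa> = deg \<mu>" by auto
qed

lemma mono_subst_B: "\<kappa> \<in> Mon B \<Longrightarrow> mono_subst \<sigma> \<kappa> = sgl \<kappa> 1"
  by (rule mono_subst_Var) (use \<sigma>_B in \<open>auto simp: Mon_def\<close>)

abbreviation "spanned \<equiv> mpoly_vs.span"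

definition standard :: "'k mpoly set \<Rightarrow> monom set" where
  "standard G = {\<mu> \<in> Mon V. \<forall>g\<in>G. \<forall>\<tau>. has_lead g \<tau> \<longrightarrow> \<not> mon_dvd \<tau> \<mu>}"

text \<open>Division by G, seen after substitution. The span is restricted to standard monomials not
  exceeding \<mu>; this restriction later keeps a leading monomial out of the spans of the smaller
  monomials.\<close>

lemma mono_subst_in_span_standard:
  assumes G: "\<And>g. g \<in> G \<Longrightarrow> subst \<sigma> g = 0"
  shows "\<mu> \<in> Mon V \<Longrightarrow> mono_subst \<sigma> \<mu> \<in> spanned (mono_subst \<sigma> ` (standard G \<inter> insert \<mu> (below \<mu>)))"
proof (induction "card (below \<mu>)" arbitrary: \<mu> rule: less_induct)
  case less
  show ?case
  proof (cases "\<mu> \<in> standard G")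
    case True
    then show ?thesis by (intro mpoly_vs.span_base) auto
  next
    case False
    then obtain g \<tau> where g: "g \<in> G" "has_lead g \<tau>" "mon_dvd \<tau> \<mu>"
      using less.prems by (auto simp: standard_def)
    then obtain c h where h: "c \<noteq> 0" "g = sgl \<tau> c + h" "kys h \<subseteq> below \<tau>"
      by (auto simp: has_lead_def)
    define \<rho> where "\<rho> = \<mu> - \<tau>"
    have \<mu>: "\<mu> = \<rho> + \<tau>"
      by (rule poly_mapping_eqI) (use g(3) in \<open>auto simp: \<rho>_def lookup_add lookup_minus mon_dvd_def\<close>)
    have \<rho>: "\<rho> \<in> Mon V"
      using less.prems by (auto simp: Mon_def \<rho>_def in_keys_iff lookup_minus subset_iff)
    have low: "\<rho> + \<nu> \<in> below \<mu>" if "\<nu> \<in> kys h" for \<nu>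
      using h(3) that \<rho> by (auto simp: below_def \<mu> gt_add deg_add Mon_add)
    have IH: "mono_subst \<sigma> \<nu> \<in> spanned (mono_subst \<sigma> ` (standard G \<inter> insert \<mu> (below \<mu>)))" if \<nu>: "\<nu> \<in> below \<mu>" for \<nu>
    proof -
      have "below \<nu> \<subset> below \<mu>"
        using \<nu> gt_trans gt_irrefl unfolding below_def by auto blast+
      then have "card (below \<nu>) < card (below \<mu>)" and *: "below \<nu> \<subseteq> below \<mu>"
        by (auto intro: psubset_card_mono finite_below)
      then have "mono_subst \<sigma> \<nu> \<in> spanned (mono_subst \<sigma> ` (standard G \<inter> insert \<nu> (below \<nu>)))"
        using \<nu> by (intro less.hyps) (auto simp: below_def)
      moreover have "mono_subst \<sigma> ` (standard G \<inter> insert \<nu> (below \<nu>)) \<subseteq> mono_subst \<sigma> ` (standard G \<inter> insert \<mu> (below \<mu>))"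
        using * \<nu> by auto
      ultimately show ?thesis using mpoly_vs.span_mono by blast
    qed
    \<comment> \<open>Multiplying g by the cofactor \<rho> and substituting gives a relation in
      which the image of \<mu> has the invertible coefficient c and all other monomials lie below
      \<mu>.\<close>
    have "0 = mono_subst \<sigma> \<rho> * subst \<sigma> g" using G g by simp
    also have "\<dots> = sgl 0 c * mono_subst \<sigma> \<mu> + mono_subst \<sigma> \<rho> * subst \<sigma> h"
      by (simp add: h(2) \<mu> subst_add subst_single mono_subst_add algebra_simps)
    also have "mono_subst \<sigma> \<rho> * subst \<sigma> h = (\<Sum>\<nu>\<in>kys h. sgl 0 (lk h \<nu>) * mono_subst \<sigma> (\<rho> + \<nu>))"
      by (simp add: subst_def sum_distrib_left mono_subst_add mult_ac)
    finally have "sgl 0 c * mono_subst \<sigma> \<mu> = - (\<Sum>\<nu>\<in>kys h. sgl 0 (lk h \<nu>) * mono_subst \<sigma> (\<rho> + \<nu>))"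
      by (simp add: eq_neg_iff_add_eq_0)
    also have "\<dots> \<in> spanned (mono_subst \<sigma> ` (standard G \<inter> insert \<mu> (below \<mu>)))"
      by (intro mpoly_vs.span_neg mpoly_vs.span_sum mpoly_vs.span_scale IH low)
    finally have "sgl 0 (inverse c) * (sgl 0 c * mono_subst \<sigma> \<mu>) \<in> spanned (mono_subst \<sigma> ` (standard G \<inter> insert \<mu> (below \<mu>)))"
      by (rule mpoly_vs.span_scale)
    then show ?thesis using h(1) by (simp add: mult_single flip: mult.assoc)
  qed
qed

lemma exists_lead:
  assumes "finite A" "A \<noteq> {}" "A \<subseteq> Mon V"
  shows "\<exists>\<mu>\<in>A. \<forall>\<nu>\<in>A. \<nu> \<noteq> \<mu> \<longrightarrow> gt \<mu> \<nu>"
  using assms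
proof (induction A rule: finite_ne_induct)
  case (singleton \<mu>)
  then show ?case by simp
next
  case (insert \<mu> A)
  then obtain \<nu> where \<nu>: "\<nu> \<in> A" "\<And>\<kappa>. \<kappa> \<in> A \<Longrightarrow> \<kappa> \<noteq> \<nu> \<Longrightarrow> gt \<nu> \<kappa>" by auto
  have "gt \<mu> \<nu> \<or> gt \<nu> \<mu>" using insert \<nu> by (intro gt_total) auto
  then show ?case
  proof
    assume "gt \<mu> \<nu>"
    then show ?thesis using \<nu> gt_trans by (intro bexI[of _ \<mu>]) blast+
  next
    assume "gt \<nu> \<mu>"
    then show ?thesis using \<nu> by (intro bexI[of _ \<nu>]) auto
  qed
qed

text \<open>The substitution preserves degrees, so the coefficient at \<kappa> receives
  contributions only from terms of degree \<open>deg \<kappa>\<close>: the kernel is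
  homogeneous.\<close>

lemma subst_component:
  assumes "kys f \<subseteq> Mon V" "subst \<sigma> f = 0"
  shows "(\<Sum>\<mu>\<in>{\<mu> \<in> kys f. deg \<mu> = \<delta>}. sgl 0 (lk f \<mu>) * mono_subst \<sigma> \<mu>) = 0"
proof (rule poly_mapping_eqI)
  fix \<kappa>
  have C: "lk (sgl 0 c * p) \<kappa> = c * lk p \<kappa>" for c and p :: "'k mpoly"
    by (simp flip: mult_map_scale_conv_mult add: Poly_Mapping.map.rep_eq when_def)
  have z: "lk (mono_subst \<sigma> \<mu>) \<kappa> = 0" if "\<mu> \<in> kys f" "deg \<mu> \<noteq> deg \<kappa>" for \<mu>
    using keys_mono_subst(2)[of \<mu> \<kappa>] that assms(1) by (metis in_keys_iff subsetD)
  show "lk (\<Sum>\<mu>\<in>{\<mu> \<in> kys f. deg \<mu> = \<delta>}. sgl 0 (lk f \<mu>) * mono_subst \<sigma> \<mu>) \<kappa> = lk 0 \<kappa>"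
  proof (cases "deg \<kappa> = \<delta>")
    case True
    have "lk (\<Sum>\<mu>\<in>{\<mu> \<in> kys f. deg \<mu> = \<delta>}. sgl 0 (lk f \<mu>) * mono_subst \<sigma> \<mu>) \<kappa>
        = (\<Sum>\<mu>\<in>{\<mu> \<in> kys f. deg \<mu> = \<delta>}. lk f \<mu> * lk (mono_subst \<sigma> \<mu>) \<kappa>)"
      by (simp add: lookup_sum C)
    also have "\<dots> = (\<Sum>\<mu>\<in>kys f. lk f \<mu> * lk (mono_subst \<sigma> \<mu>) \<kappa>)"
      by (rule sum.mono_neutral_left) (use True z in auto)
    also have "\<dots> = lk (subst \<sigma> f) \<kappa>"
      by (simp add: subst_def lookup_sum C)
    finally show ?thesis using assms by simp
  next
    case False
    then show ?thesis using z by (simp add: lookup_sum C)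
  qed
qed

text \<open>If the leading monomial \<open>\<mu>0\<close> of f were standard, the relation given by
  f would express its image through those of other standard monomials. In each degree the monomials
  in B, which \<sigma> fixes and which are independent, would then lie in the span of the images of
  the remaining standard monomials and hence be at most as numerous. \<open>count\<close> forbids
  the degree-preserving injection that results; an injection, unlike a cardinality, compares all
  degrees at once.\<close>

theorem lead_not_standard:
  assumes G: "\<And>g. g \<in> G \<Longrightarrow> subst \<sigma> g = 0"
    and f: "kys f \<subseteq> Mon V" "subst \<sigma> f = 0" "f \<noteq> 0"
    and count: "\<And>\<mu>0 h. \<mu>0 \<in> standard G \<Longrightarrow> inj_on h (Mon B) \<Longrightarrow> h ` Mon B \<subseteq> standard G - {\<mu>0} \<Longrightarrow>
                  (\<And>\<kappa>. \<kappa> \<in> Mon B \<Longrightarrow> deg (h \<kappa>) = deg \<kappa>) \<Longrightarrow> False"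
  shows "lead_mon gt f \<notin> standard G"
proof
  assume std: "lead_mon gt f \<in> standard G"
  define \<mu>0 where "\<mu>0 = lead_mon gt f"
  obtain \<mu> where \<mu>: "\<mu> \<in> kys f" "\<And>\<nu>. \<nu> \<in> kys f \<Longrightarrow> \<nu> \<noteq> \<mu> \<Longrightarrow> gt \<mu> \<nu>"
    using exists_lead[of "kys f"] f by auto
  have "\<mu>0 = \<mu>" unfolding \<mu>0_def by (rule lead_mon_eqI) (use \<mu> in auto)
  with \<mu> have \<mu>0: "\<mu>0 \<in> kys f" "\<And>\<nu>. \<nu> \<in> kys f \<Longrightarrow> \<nu> \<noteq> \<mu>0 \<Longrightarrow> gt \<mu>0 \<nu>" by auto
  define St where "St \<delta> = {\<mu> \<in> standard G. deg \<mu> = \<delta>}" for \<delta>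
  have fin: "finite (St \<delta>)" for \<delta>
    by (rule finite_subset[OF _ finite_deg[of \<delta>]]) (auto simp: St_def standard_def)
  let ?S = "spanned (mono_subst \<sigma> ` (St (deg \<mu>0) - {\<mu>0}))"
  have low: "mono_subst \<sigma> \<nu> \<in> ?S" if \<nu>: "\<nu> \<in> kys f" "deg \<nu> = deg \<mu>0" "\<nu> \<noteq> \<mu>0" for \<nu>
  proof -
    have "gt \<mu>0 \<nu>" using \<mu>0 \<nu> by auto
    then have "\<mu>0 \<notin> insert \<nu> (below \<nu>)" using \<nu> gt_trans gt_irrefl by (auto simp: below_def)
    then have "standard G \<inter> insert \<nu> (below \<nu>) \<subseteq> St (deg \<mu>0) - {\<mu>0}"
      using \<nu> by (auto simp: St_def below_def)
    moreover have "mono_subst \<sigma> \<nu> \<in> spanned (mono_subst \<sigma> ` (standard G \<inter> insert \<nu> (below \<nu>)))"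
      by (rule mono_subst_in_span_standard[OF G]) (use \<nu> f in auto)
    ultimately show ?thesis
      using mpoly_vs.span_mono[OF image_mono] by blast
  qed
  have top: "mono_subst \<sigma> \<mu>0 \<in> ?S"
  proof -
    let ?A = "{\<mu> \<in> kys f. deg \<mu> = deg \<mu>0}"
    have "sgl 0 (lk f \<mu>0) * mono_subst \<sigma> \<mu>0 + (\<Sum>\<mu>\<in>?A - {\<mu>0}. sgl 0 (lk f \<mu>) * mono_subst \<sigma> \<mu>) = 0"
      using subst_component[OF f(1,2), of "deg \<mu>0"] \<mu>0(1)
      by (subst (asm) sum.remove[of _ \<mu>0]) auto
    then have "sgl 0 (lk f \<mu>0) * mono_subst \<sigma> \<mu>0 = - (\<Sum>\<mu>\<in>?A - {\<mu>0}. sgl 0 (lk f \<mu>) * mono_subst \<sigma> \<mu>)"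
      by (simp add: eq_neg_iff_add_eq_0)
    also have "\<dots> \<in> ?S"
      by (intro mpoly_vs.span_neg mpoly_vs.span_sum mpoly_vs.span_scale low) auto
    finally have "sgl 0 (inverse (lk f \<mu>0)) * (sgl 0 (lk f \<mu>0) * mono_subst \<sigma> \<mu>0) \<in> ?S"
      by (rule mpoly_vs.span_scale)
    then show ?thesis using \<mu>0(1) by (simp add: mult_single in_keys_iff flip: mult.assoc)
  qed
  \<comment> \<open>For \<delta> other than \<open>deg \<mu>0\<close> nothing is removed.\<close>
  have sub: "mono_subst \<sigma> ` St \<delta> \<subseteq> spanned (mono_subst \<sigma> ` (St \<delta> - {\<mu>0}))" for \<delta>
  proof
    fix p assume "p \<in> mono_subst \<sigma> ` St \<delta>"
    then obtain \<nu> where \<nu>: "p = mono_subst \<sigma> \<nu>" "\<nu> \<in> St \<delta>" by auto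
    show "p \<in> spanned (mono_subst \<sigma> ` (St \<delta> - {\<mu>0}))"
    proof (cases "\<nu> = \<mu>0")
      case True
      then show ?thesis using \<nu> top by (auto simp: St_def)
    next
      case False
      then show ?thesis using \<nu> by (intro mpoly_vs.span_base) auto
    qed
  qed
  define Ba where "Ba \<delta> = {\<kappa> \<in> Mon B. deg \<kappa> = \<delta>}" for \<delta>
  have finB: "finite (Ba \<delta>)" for \<delta>
    by (rule finite_subset[OF _ finite_deg[of \<delta>]]) (auto simp: Ba_def Mon_B_V)
  have card: "card (Ba \<delta>) \<le> card (St \<delta> - {\<mu>0})" for \<delta>
  proof -
    let ?M = "(\<lambda>\<kappa>. sgl \<kappa> (1::'k)) ` Ba \<delta>"
    have "?M \<subseteq> spanned (mono_subst \<sigma> ` (St \<delta> - {\<mu>0}))"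
    proof
      fix p assume "p \<in> ?M"
      then obtain \<kappa> where \<kappa>: "\<kappa> \<in> Mon B" "deg \<kappa> = \<delta>" "p = mono_subst \<sigma> \<kappa>"
        by (auto simp: Ba_def mono_subst_B)
      have "p \<in> spanned (mono_subst \<sigma> ` (standard G \<inter> insert \<kappa> (below \<kappa>)))"
        unfolding \<kappa>(3) by (rule mono_subst_in_span_standard[OF G]) (auto intro: Mon_B_V \<kappa>)
      also have "\<dots> \<subseteq> spanned (mono_subst \<sigma> ` St \<delta>)"
        by (intro mpoly_vs.span_mono image_mono) (use \<kappa> in \<open>auto simp: St_def below_def\<close>)
      also have "\<dots> \<subseteq> spanned (mono_subst \<sigma> ` (St \<delta> - {\<mu>0}))"
        by (rule mpoly_vs.span_minimal[OF sub mpoly_vs.subspace_span])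
      finally show "p \<in> \<dots>" .
    qed
    moreover have "finite (mono_subst \<sigma> ` (St \<delta> - {\<mu>0}))" using fin by simp
    ultimately have "card ?M \<le> card (mono_subst \<sigma> ` (St \<delta> - {\<mu>0}))"
      using mpoly_vs.independent_span_bound[OF _ mpoly_independent_monomials,
          of "mono_subst \<sigma> ` (St \<delta> - {\<mu>0})" "Ba \<delta>"] by simp
    also have "\<dots> \<le> card (St \<delta> - {\<mu>0})" by (rule card_image_le) (use fin in auto)
    also have "card ?M = card (Ba \<delta>)" by (intro card_image inj_onI) (metis keys_single one_neq_zero singleton_inject)
    finally show ?thesis .
  qed
  have "\<forall>\<delta>. \<exists>h. inj_on h (Ba \<delta>) \<and> h ` Ba \<delta> \<subseteq> St \<delta> - {\<mu>0}"
  proof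
    fix \<delta>
    have "finite (St \<delta> - {\<mu>0})" using fin by simp
    from card_le_inj[OF finB this card]
    show "\<exists>h. inj_on h (Ba \<delta>) \<and> h ` Ba \<delta> \<subseteq> St \<delta> - {\<mu>0}" by blast
  qed
  from choice[OF this] obtain h
    where h: "\<And>\<delta>. inj_on (h \<delta>) (Ba \<delta>)" "\<And>\<delta>. h \<delta> ` Ba \<delta> \<subseteq> St \<delta> - {\<mu>0}"
    by blast
  \<comment> \<open>The injections of different degrees have disjoint domains and disjoint ranges,
    so they glue.\<close>
  define H where "H \<kappa> = h (deg \<kappa>) \<kappa>" for \<kappa>
  have H: "H \<kappa> \<in> St (deg \<kappa>) - {\<mu>0}" if "\<kappa> \<in> Mon B" for \<kappa>
    using h(2)[of "deg \<kappa>"] that by (auto simp: H_def Ba_def)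
  show False
  proof (rule count[of \<mu>0 H])
    show "\<mu>0 \<in> standard G" using std by (simp add: \<mu>0_def)
    show "H ` Mon B \<subseteq> standard G - {\<mu>0}" using H by (auto simp: St_def)
    show "deg (H \<kappa>) = deg \<kappa>" if "\<kappa> \<in> Mon B" for \<kappa> using H[OF that] by (auto simp: St_def)
    then show "inj_on H (Mon B)"
      by (intro inj_onI) (metis (mono_tags, lifting) H_def Ba_def h(1) inj_onD mem_Collect_eq)
  qed
qed

end

section \<open>The monomial order and the bigrading\<close>

fun lexgt :: "int list \<Rightarrow> int list \<Rightarrow> bool" where
  "lexgt (x # xs) (y # ys) \<longleftrightarrow> x > y \<or> x = y \<and> lexgt xs ys"
| "lexgt _ _ \<longleftrightarrow> False"

lemma lexgt_irrefl: "\<not> lexgt xs xs"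
  by (induction xs) auto

lemma lexgt_trans: "lexgt xs ys \<Longrightarrow> lexgt ys zs \<Longrightarrow> lexgt xs zs"
  by (induction xs ys arbitrary: zs rule: lexgt.induct; case_tac zs) auto

lemma lexgt_total: "length xs = length ys \<Longrightarrow> xs \<noteq> ys \<Longrightarrow> lexgt xs ys \<or> lexgt ys xs"
  by (induction xs ys rule: list_induct2) auto

lemma lexgt_add:
  "length zs = length xs \<Longrightarrow> length xs = length ys \<Longrightarrow>
    lexgt (map2 (+) zs xs) (map2 (+) zs ys) \<longleftrightarrow> lexgt xs ys"
  by (induction zs xs ys rule: list_induct3) auto

lemma lexgt_append:
  "length xs = length ys \<Longrightarrow>
    lexgt (xs @ xs') (ys @ ys') \<longleftrightarrow> lexgt xs ys \<or> xs = ys \<and> lexgt xs' ys'"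
  by (induction xs ys rule: list_induct2) auto

text \<open>Reversing and changing signs turns ``the rightmost nonzero entry of the difference is negative''
  into a lexicographic comparison.\<close>

definition rev_neg :: "nat list \<Rightarrow> int list" where
  "rev_neg xs = map (\<lambda>x. - int x) (rev xs)"

lemma length_rev_neg [simp]: "length (rev_neg xs) = length xs"
  by (simp add: rev_neg_def)

lemma rev_neg_eq_iff [simp]: "rev_neg xs = rev_neg ys \<longleftrightarrow> xs = ys"
  by (auto simp: rev_neg_def inj_map_eq_map inj_def)

lemma rightmost_neg_iff_lexgt:
  "length xs = length ys \<Longrightarrow> rightmost_neg xs ys \<longleftrightarrow> lexgt (rev_neg xs) (rev_neg ys)"
proof (induction xs ys rule: list_induct2)
  case Nil
  then show ?case by (simp add: rightmost_neg_def rev_neg_def)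
next
  case (Cons x xs y ys)
  have "rightmost_neg (x # xs) (y # ys) \<longleftrightarrow>
      rightmost_neg xs ys \<or> (x < y \<and> (\<forall>j<length xs. xs ! j = ys ! j))" (is "?l \<longleftrightarrow> ?r")
  proof
    assume ?l
    then obtain i where i: "i < Suc (length xs)" "(x # xs) ! i < (y # ys) ! i"
        "\<And>j. i < j \<Longrightarrow> j < Suc (length xs) \<Longrightarrow> (x # xs) ! j = (y # ys) ! j"
      by (auto simp: rightmost_neg_def)
    show ?r
    proof (cases i)
      case 0
      then show ?thesis using i(2) i(3)[of "Suc _"] by auto
    next
      case (Suc k)
      then have "rightmost_neg xs ys"
        unfolding rightmost_neg_def using i(1,2) i(3)[of "Suc _"] by auto
      then show ?thesis ..
    qed
  next
    assume ?r
    then show ?l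
    proof
      assume "rightmost_neg xs ys"
      then obtain i where i: "i < length xs" "xs ! i < ys ! i" "\<And>j. i < j \<Longrightarrow> j < length xs \<Longrightarrow> xs ! j = ys ! j"
        by (auto simp: rightmost_neg_def)
      show ?l unfolding rightmost_neg_def
        by (rule exI[of _ "Suc i"]) (use i in \<open>auto simp: nth_Cons split: nat.splits\<close>)
    next
      assume *: "x < y \<and> (\<forall>j<length xs. xs ! j = ys ! j)"
      show ?l unfolding rightmost_neg_def
        by (rule exI[of _ 0]) (use * in \<open>auto simp: nth_Cons split: nat.splits\<close>)
    qed
  qed
  also have "\<dots> \<longleftrightarrow> lexgt (rev_neg (x # xs)) (rev_neg (y # ys))"
  proof -
    have "rev_neg (z # zs) = rev_neg zs @ [- int z]" for z zs by (simp add: rev_neg_def)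
    moreover have "(\<forall>j<length xs. xs ! j = ys ! j) \<longleftrightarrow> xs = ys"
      using Cons.hyps by (simp add: list_eq_iff_nth_eq)
    ultimately show ?thesis using Cons by (auto simp: lexgt_append)
  qed
  finally show ?case .
qed

section \<open>The bigrading and an additive key for the order\<close>

definition total_deg :: "nat \<Rightarrow> monom \<Rightarrow> nat" where
  "total_deg b \<mu> = lk \<mu> Tv + (\<Sum>j\<in>{0..3 - b}. lk \<mu> (PsiVar j)) + lk \<mu> Phi22 + lk \<mu> Phi12 + lk \<mu> Phi11"

text \<open>Turns the nested conditions of \<open>gtE\<close> into one lexicographic comparison of
  an additive key: translation invariance follows from additivity, totality from injectivity on the
  monomials of S.\<close>

definition order_key :: "nat \<Rightarrow> nat \<Rightarrow> nat \<Rightarrow> nat \<Rightarrow> monom \<Rightarrow> int list" where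
  "order_key m0 d a b \<mu> =
    [int (lk \<mu> Tv), int (omega m0 d a b \<mu>), int (sum_list (beta_vec b \<mu>))] @ rev_neg (beta_vec b \<mu>)
    @ [int (sum_list (gamma_vec \<mu>))] @ rev_neg (gamma_vec \<mu>) @ rev_neg (alpha_vec \<mu>)"

locale curve =
  fixes m0 d a b :: nat
  assumes m0: "m0 = 3 * a + b" and a: "1 \<le> a" and b: "b = 1 \<or> b = 2 \<or> b = 3"
begin

lemma upt_simps: "b = 1 \<Longrightarrow> [0..<4 - b] = [0, 1, 2]" "b = 2 \<Longrightarrow> [0..<4 - b] = [0, 1]" "b = 3 \<Longrightarrow> [0..<4 - b] = [0]"
  by (simp_all add: upt_rec)

lemma gtE_iff_lexgt: "gtE m0 d a b \<mu> \<nu> \<longleftrightarrow> lexgt (order_key m0 d a b \<mu>) (order_key m0 d a b \<nu>)"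
proof -
  have [simp]: "length (beta_vec b \<mu>) = length (beta_vec b \<nu>)" "length (gamma_vec \<mu>) = length (gamma_vec \<nu>)"
      "length (alpha_vec \<mu>) = length (alpha_vec \<nu>)"
    by (simp_all add: beta_vec_def gamma_vec_def alpha_vec_def)
  show ?thesis
    by (simp add: gtE_def order_key_def rightmost_neg_iff_lexgt lexgt_append Let_def eq_commute)
qed

lemma omega_add: "omega m0 d a b (\<mu> + \<nu>) = omega m0 d a b \<mu> + omega m0 d a b \<nu>"
  by (simp add: omega_def lookup_add sum.distrib algebra_simps)

lemma total_deg_add: "total_deg b (\<mu> + \<nu>) = total_deg b \<mu> + total_deg b \<nu>"
  by (simp add: total_deg_def lookup_add sum.distrib algebra_simps)

lemma vec_simps:
  "b = 1 \<Longrightarrow> beta_vec b \<mu> = [lk \<mu> (PsiVar 0), lk \<mu> (PsiVar 1), lk \<mu> (PsiVar 2)]"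
  "b = 2 \<Longrightarrow> beta_vec b \<mu> = [lk \<mu> (PsiVar 0), lk \<mu> (PsiVar 1)]"
  "b = 3 \<Longrightarrow> beta_vec b \<mu> = [lk \<mu> (PsiVar 0)]"
  by (drule upt_simps(1), simp only: beta_vec_def list.map)
     (drule upt_simps(2), simp only: beta_vec_def list.map, drule upt_simps(3), simp only: beta_vec_def list.map)

lemmas order_key_explicit = order_key_def gamma_vec_def alpha_vec_def rev_neg_def

lemma order_key_add:
  "order_key m0 d a b (\<mu> + \<nu>) = map2 (+) (order_key m0 d a b \<mu>) (order_key m0 d a b \<nu>)"
proof -
  consider "b = 1" | "b = 2" | "b = 3" using b by auto
  then show ?thesis
  proof cases
    case 1
    show ?thesis by (simp add: order_key_explicit vec_simps(1)[OF 1] omega_add lookup_add)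
  next
    case 2
    show ?thesis by (simp add: order_key_explicit vec_simps(2)[OF 2] omega_add lookup_add)
  next
    case 3
    show ?thesis by (simp add: order_key_explicit vec_simps(3)[OF 3] omega_add lookup_add)
  qed
qed

text \<open>Three leading entries, \<open>4 - b\<close> exponents of \<Psi>, one sum, three
  exponents of \<Phi> and four of X.\<close>

lemma length_order_key: "length (order_key m0 d a b \<mu>) = 15 - b"
  using b by (auto simp: order_key_explicit beta_vec_def)

definition deg :: "monom \<Rightarrow> nat \<times> nat" where
  "deg \<mu> = (total_deg b \<mu>, omega m0 d a b \<mu>)"

definition "\<sigma> v = (case v of Phi22 \<Rightarrow> tt * phi 2 2 | Phi12 \<Rightarrow> tt * phi 1 2 | Phi11 \<Rightarrow> tt * phi 1 1
  | PsiVar j \<Rightarrow> tt * X (int (b + j)) * X 3 ^ a - tt * X (int j) * X 0 ^ (a + d)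
  | _ \<Rightarrow> Var v)"

abbreviation "V \<equiv> S_vars b"
definition "B = {Tv} \<union> Xv ` {0..3}"

lemma finite_V: "finite V"
  by (simp add: S_vars_def)

lemma V_explicit: "V = {Tv, Phi22, Phi12, Phi11, Xv 0, Xv 1, Xv 2, Xv 3} \<union>
   (if b = 1 then {PsiVar 0, PsiVar 1, PsiVar 2} else if b = 2 then {PsiVar 0, PsiVar 1} else {PsiVar 0})"
  using b unfolding S_vars_def
  by (elim disjE) (simp_all add: atLeast0AtMost atMost_Suc numeral_eq_Suc, auto)

lemma B_explicit: "B = {Tv, Xv 0, Xv 1, Xv 2, Xv 3}"
  by (auto simp add: B_def atLeast0AtMost atMost_Suc numeral_eq_Suc)

lemma sum_Psi: "(\<Sum>j\<in>{0..3 - b}. f j) =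
   (if b = 1 then f 0 + f 1 + f 2 else if b = 2 then f 0 + f 1 else f (0::nat))" for f :: "nat \<Rightarrow> 'b::comm_monoid_add"
  using b by (elim disjE) (simp_all add: atLeast0AtMost numeral_eq_Suc atMost_Suc add_ac)

lemma omega_explicit: "omega m0 d a b \<mu> = lk \<mu> (Xv 0) * m0 + lk \<mu> (Xv 1) * (m0 + d) + lk \<mu> (Xv 2) * (m0 + 2 * d) + lk \<mu> (Xv 3) * (m0 + 3 * d)
    + (if b = 1 then lk \<mu> (PsiVar 0) * (a * (m0 + 3 * d) + (m0 + d)) + lk \<mu> (PsiVar 1) * (a * (m0 + 3 * d) + (m0 + 2 * d))
          + lk \<mu> (PsiVar 2) * (a * (m0 + 3 * d) + (m0 + 3 * d))
       else if b = 2 then lk \<mu> (PsiVar 0) * (a * (m0 + 3 * d) + (m0 + 2 * d)) + lk \<mu> (PsiVar 1) * (a * (m0 + 3 * d) + (m0 + 3 * d))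
       else lk \<mu> (PsiVar 0) * (a * (m0 + 3 * d) + (m0 + 3 * d)))
    + lk \<mu> Phi22 * (2 * (m0 + 2 * d)) + lk \<mu> Phi12 * (2 * m0 + 3 * d) + lk \<mu> Phi11 * (2 * (m0 + d))"
  using b unfolding omega_def sum_Psi mm_def
  by (elim disjE) (simp_all add: atLeast0AtMost numeral_eq_Suc atMost_Suc algebra_simps)

text \<open>Every variable of S has positive total degree or positive weight. This yields the
  finiteness of the bigraded pieces and, later, values below 1 at the evaluation point.\<close>

lemma lookup_le_deg:
  assumes "\<mu> \<in> Mon V"
  shows "lk \<mu> v \<le> total_deg b \<mu> + omega m0 d a b \<mu>"
proof (cases "v \<in> V")
  case True
  then consider "v \<in> {Tv, Phi22, Phi12, Phi11}" | i where "v = Xv i" "i \<le> 3" | j where "v = PsiVar j" "j \<le> 3 - b"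
    by (auto simp: S_vars_def)
  then show ?thesis
  proof cases
    case 1
    then show ?thesis by (auto simp: total_deg_def)
  next
    case 2
    have "0 < mm m0 d (int i)" using m0 a by (simp add: mm_def)
    then have "lk \<mu> v \<le> lk \<mu> (Xv i) * mm m0 d (int i)" using 2 by simp
    also have "\<dots> \<le> (\<Sum>i\<in>{0..3}. lk \<mu> (Xv i) * mm m0 d (int i))"
      by (rule member_le_sum) (use 2 in auto)
    finally show ?thesis by (simp add: omega_def)
  next
    case 3
    have "lk \<mu> v \<le> (\<Sum>j\<in>{0..3 - b}. lk \<mu> (PsiVar j))"
      unfolding 3(1) by (rule member_le_sum[where f = "\<lambda>j. lk \<mu> (PsiVar j)"]) (use 3 in auto)
    then show ?thesis by (simp add: total_deg_def)
  qed
next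
  case False
  then show ?thesis using assms by (metis Mon_def in_keys_iff le0 mem_Collect_eq subsetD)
qed

lemma finite_degree: "finite {\<mu> \<in> Mon V. deg \<mu> = \<delta>}"
proof -
  let ?C = "fst \<delta> + snd \<delta>"
  have "finite {f. \<forall>v. (v \<in> V \<longrightarrow> f v \<in> {..?C}) \<and> (v \<notin> V \<longrightarrow> f v = (0::nat))}"
    by (rule finite_set_of_finite_funs) (auto simp: finite_V)
  then have "finite (lk ` {\<mu> \<in> Mon V. deg \<mu> = \<delta>})"
  proof (rule finite_subset[rotated], intro subsetI CollectI allI conjI impI)
    fix f v assume "f \<in> lk ` {\<mu> \<in> Mon V. deg \<mu> = \<delta>}"
    then obtain \<mu> where \<mu>: "f = lk \<mu>" "\<mu> \<in> Mon V" "deg \<mu> = \<delta>" by auto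
    show "f v \<in> {..?C}" using lookup_le_deg[OF \<mu>(2), of v] \<mu>(1) \<mu>(3)[symmetric] by (simp add: deg_def)
    show "f v = 0" if "v \<notin> V" using \<mu> that by (metis Mon_def in_keys_iff mem_Collect_eq subsetD)
  qed
  then show ?thesis
    by (rule finite_imageD) (intro inj_onI, erule poly_mapping_eq_iff[THEN iffD2])
qed

lemma deg_add: "deg (\<mu> + \<nu>) = deg \<mu> + deg \<nu>"
  by (simp add: deg_def total_deg_add omega_add)

lemma order_key_inj: "\<mu> \<in> Mon V \<Longrightarrow> \<nu> \<in> Mon V \<Longrightarrow> order_key m0 d a b \<mu> = order_key m0 d a b \<nu> \<Longrightarrow> \<mu> = \<nu>"
proof (rule poly_mapping_eqI)
  fix v assume V: "\<mu> \<in> Mon V" "\<nu> \<in> Mon V" and eq: "order_key m0 d a b \<mu> = order_key m0 d a b \<nu>"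
  show "lk \<mu> v = lk \<nu> v"
  proof (cases "v \<in> V")
    case True
    show ?thesis using b
    proof (elim disjE)
      assume "b = 1"
      with True eq show ?thesis unfolding order_key_explicit V_explicit vec_simps(1)[OF \<open>b = 1\<close>] by auto
    next
      assume "b = 2"
      with True eq show ?thesis unfolding order_key_explicit V_explicit vec_simps(2)[OF \<open>b = 2\<close>] by auto
    next
      assume "b = 3"
      with True eq show ?thesis unfolding order_key_explicit V_explicit vec_simps(3)[OF \<open>b = 3\<close>] by auto
    qed
  next
    case False
    then show ?thesis using V by (metis Mon_def in_keys_iff mem_Collect_eq subsetD)
  qed
qed

end

section \<open>Monomials as tuples of exponents\<close>

definition mon :: "nat \<Rightarrow> nat \<Rightarrow> nat \<Rightarrow> nat \<Rightarrow> nat \<Rightarrow> nat \<Rightarrow> nat \<Rightarrow> nat \<Rightarrow> nat \<Rightarrow> nat \<Rightarrow> nat \<Rightarrow> monom" where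
  "mon k x1 x2 x3 x0 s0 s1 s2 p q r =
    sgl Tv k + sgl (Xv 1) x1 + sgl (Xv 2) x2 + sgl (Xv 3) x3 + sgl (Xv 0) x0
    + sgl (PsiVar 0) s0 + sgl (PsiVar 1) s1 + sgl (PsiVar 2) s2 + sgl Phi22 p + sgl Phi12 q + sgl Phi11 r"

lemma lookup_mon [simp]:
  "lk (mon k x1 x2 x3 x0 s0 s1 s2 p q r) Tv = k"
  "lk (mon k x1 x2 x3 x0 s0 s1 s2 p q r) (Xv 1) = x1"
  "lk (mon k x1 x2 x3 x0 s0 s1 s2 p q r) (Xv (Suc 0)) = x1"
  "lk (mon k x1 x2 x3 x0 s0 s1 s2 p q r) (Xv 2) = x2"
  "lk (mon k x1 x2 x3 x0 s0 s1 s2 p q r) (Xv 3) = x3"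
  "lk (mon k x1 x2 x3 x0 s0 s1 s2 p q r) (Xv 0) = x0"
  "lk (mon k x1 x2 x3 x0 s0 s1 s2 p q r) (PsiVar 0) = s0"
  "lk (mon k x1 x2 x3 x0 s0 s1 s2 p q r) (PsiVar 1) = s1"
  "lk (mon k x1 x2 x3 x0 s0 s1 s2 p q r) (PsiVar (Suc 0)) = s1"
  "lk (mon k x1 x2 x3 x0 s0 s1 s2 p q r) (PsiVar 2) = s2"
  "lk (mon k x1 x2 x3 x0 s0 s1 s2 p q r) Phi22 = p"
  "lk (mon k x1 x2 x3 x0 s0 s1 s2 p q r) Phi12 = q"
  "lk (mon k x1 x2 x3 x0 s0 s1 s2 p q r) Phi11 = r"
  by (simp_all add: mon_def lookup_add lookup_single)

lemma mon_dvd_mon: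
  "mon_dvd (mon k x1 x2 x3 x0 s0 s1 s2 p q r) \<mu> \<longleftrightarrow>
    k \<le> lk \<mu> Tv \<and> x1 \<le> lk \<mu> (Xv 1) \<and> x2 \<le> lk \<mu> (Xv 2) \<and> x3 \<le> lk \<mu> (Xv 3) \<and> x0 \<le> lk \<mu> (Xv 0)
    \<and> s0 \<le> lk \<mu> (PsiVar 0) \<and> s1 \<le> lk \<mu> (PsiVar 1) \<and> s2 \<le> lk \<mu> (PsiVar 2)
    \<and> p \<le> lk \<mu> Phi22 \<and> q \<le> lk \<mu> Phi12 \<and> r \<le> lk \<mu> Phi11" (is "?l \<longleftrightarrow> ?r")
proof
  assume ?l
  then show ?r unfolding mon_dvd_def by (metis lookup_mon)
next
  assume ?r
  then show ?l by (auto simp: mon_dvd_def mon_def lookup_add lookup_single when_def)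
qed

lemma mon_0: "mon 0 0 0 0 0 0 0 0 0 0 0 = 0"
  by (simp add: mon_def)

lemma mon_add: "mon k x1 x2 x3 x0 s0 s1 s2 p q r + mon k' x1' x2' x3' x0' s0' s1' s2' p' q' r' =
   mon (k + k') (x1 + x1') (x2 + x2') (x3 + x3') (x0 + x0') (s0 + s0') (s1 + s1') (s2 + s2') (p + p') (q + q') (r + r')"
  by (simp add: mon_def single_add add_ac)

text \<open>A separate name for monic terms lets the simplifier collect every product of variables
  into a single exponent tuple, after which equal terms cancel.\<close>

definition term_of :: "monom \<Rightarrow> 'k::comm_ring_1 mpoly" where "term_of \<mu> = sgl \<mu> 1"

lemma term_of_mult: "term_of (mon k x1 x2 x3 x0 s0 s1 s2 p q r) * term_of (mon k' x1' x2' x3' x0' s0' s1' s2' p' q' r') =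
   term_of (mon (k + k') (x1 + x1') (x2 + x2') (x3 + x3') (x0 + x0') (s0 + s0') (s1 + s1') (s2 + s2') (p + p') (q + q') (r + r'))"
  by (simp add: term_of_def mult_single mon_add)

lemma term_of_mult2: "term_of (mon k x1 x2 x3 x0 s0 s1 s2 p q r) * (term_of (mon k' x1' x2' x3' x0' s0' s1' s2' p' q' r') * f) =
   term_of (mon (k + k') (x1 + x1') (x2 + x2') (x3 + x3') (x0 + x0') (s0 + s0') (s1 + s1') (s2 + s2') (p + p') (q + q') (r + r')) * f"
  by (simp flip: term_of_mult mult.assoc)

lemma term_of_power: "term_of (mon k x1 x2 x3 x0 s0 s1 s2 p q r) ^ n =
   term_of (mon (n * k) (n * x1) (n * x2) (n * x3) (n * x0) (n * s0) (n * s1) (n * s2) (n * p) (n * q) (n * r))"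
  by (induction n) (simp_all add: term_of_mult, simp add: term_of_def mon_0)

lemma Var_term_of:
  "tt = term_of (mon 1 0 0 0 0 0 0 0 0 0 0)"
  "X 1 = term_of (mon 0 1 0 0 0 0 0 0 0 0 0)"
  "X 2 = term_of (mon 0 0 1 0 0 0 0 0 0 0 0)"
  "X 3 = term_of (mon 0 0 0 1 0 0 0 0 0 0 0)"
  "X 0 = term_of (mon 0 0 0 0 1 0 0 0 0 0 0)"
  "Var (PsiVar 0) = term_of (mon 0 0 0 0 0 1 0 0 0 0 0)"
  "Var (PsiVar 1) = term_of (mon 0 0 0 0 0 0 1 0 0 0 0)"
  "Var (PsiVar (Suc 0)) = term_of (mon 0 0 0 0 0 0 1 0 0 0 0)"
  "Var (PsiVar 2) = term_of (mon 0 0 0 0 0 0 0 1 0 0 0)"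
  "Var Phi22 = term_of (mon 0 0 0 0 0 0 0 0 1 0 0)"
  "Var Phi12 = term_of (mon 0 0 0 0 0 0 0 0 0 1 0)"
  "Var Phi11 = term_of (mon 0 0 0 0 0 0 0 0 0 0 1)"
  by (simp_all add: tt_def X_def Var_def term_of_def mon_def)

lemma Var_eq_term_of:
  "Var (Xv 1) = X 1" "Var (Xv (Suc 0)) = X 1" "Var (Xv 2) = X 2" "Var (Xv 3) = X 3" "Var (Xv 0) = X 0" "Var Tv = tt"
  by (simp_all add: X_def tt_def)

lemma X_out: "X 4 = 0" "X 5 = 0" "X 6 = 0" "X (-1) = 0"
  by (simp_all add: X_def)

lemma PhiV_cases: "PhiV 1 1 = Var Phi11" "PhiV 1 2 = Var Phi12" "PhiV 2 1 = Var Phi12" "PhiV 2 2 = Var Phi22"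
  "PhiV 0 i = 0" "PhiV i 0 = 0" "PhiV 3 i = 0" "PhiV i 3 = 0" "PhiV (-1) i = 0"
  by (simp_all add: PhiV_def)

lemma PsiV_cases: "PsiV 1 0 = Var (PsiVar 0)" "PsiV 1 1 = Var (PsiVar 1)" "PsiV 1 2 = Var (PsiVar 2)"
   "PsiV (Suc 0) 0 = Var (PsiVar 0)" "PsiV (Suc 0) 1 = Var (PsiVar 1)" "PsiV (Suc 0) 2 = Var (PsiVar 2)"
  "PsiV 2 0 = Var (PsiVar 0)" "PsiV 2 1 = Var (PsiVar 1)" "PsiV 3 0 = Var (PsiVar 0)"
  by (simp_all add: PsiV_def)

lemma phi_cases: "phi 1 1 = X 1 * X 1 - X 2 * X 0" "phi 1 2 = X 1 * X 2 - X 3 * X 0"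
   "phi 2 1 = X 1 * X 2 - X 3 * X 0" "phi 2 2 = X 2 * X 2 - X 3 * X 1"
  by (simp_all add: phi_def eps_def)

context curve begin

text \<open>\<open>PsiVar 2\<close> belongs to S only for b = 1 and \<open>PsiVar 1\<close> only for
  b \<noteq> 3; the same two side conditions guard the computations that follow.\<close>

lemma mon_in_Mon: "(b = 1 \<or> s2 = 0) \<Longrightarrow> (b \<noteq> 3 \<or> s1 = 0) \<Longrightarrow> mon k x1 x2 x3 x0 s0 s1 s2 p q r \<in> Mon V"
  using b by (auto simp: Mon_def V_explicit in_keys_iff mon_def lookup_add lookup_single when_def split: if_splits)

lemma mon_in_Mon_B: "mon k x1 x2 x3 x0 0 0 0 0 0 0 \<in> Mon B"
  by (auto simp: Mon_def B_explicit in_keys_iff mon_def lookup_add lookup_single when_def split: if_splits)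

lemma omega_mon: "(b = 1 \<or> s2 = 0) \<Longrightarrow> (b \<noteq> 3 \<or> s1 = 0) \<Longrightarrow>
   omega m0 d a b (mon k x1 x2 x3 x0 s0 s1 s2 p q r) =
     x0 * m0 + x1 * (m0 + d) + x2 * (m0 + 2 * d) + x3 * (m0 + 3 * d)
     + s0 * (a * (m0 + 3 * d) + (m0 + b * d)) + s1 * (a * (m0 + 3 * d) + (m0 + (b + 1) * d))
     + s2 * (a * (m0 + 3 * d) + (m0 + (b + 2) * d))
     + p * (2 * (m0 + 2 * d)) + q * (2 * m0 + 3 * d) + r * (2 * (m0 + d))"
  using b unfolding omega_explicit by (auto simp: algebra_simps)

lemma total_deg_mon: "(b = 1 \<or> s2 = 0) \<Longrightarrow> (b \<noteq> 3 \<or> s1 = 0) \<Longrightarrow>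
   total_deg b (mon k x1 x2 x3 x0 s0 s1 s2 p q r) = k + s0 + s1 + s2 + p + q + r"
  using b unfolding total_deg_def sum_Psi by auto

text \<open>At equal weight the entry \<omega> of the key drops out, and padding \<beta> with zeros
  to length 3 makes the comparison uniform in b.\<close>

lemma gtE_mon:
  assumes "b = 1 \<or> s2 = 0 \<and> s2' = 0" "b \<noteq> 3 \<or> s1 = 0 \<and> s1' = 0"
    and "omega m0 d a b (mon k x1 x2 x3 x0 s0 s1 s2 p q r) = omega m0 d a b (mon k' x1' x2' x3' x0' s0' s1' s2' p' q' r')"
  shows "gtE m0 d a b (mon k x1 x2 x3 x0 s0 s1 s2 p q r) (mon k' x1' x2' x3' x0' s0' s1' s2' p' q' r') \<longleftrightarrow>
    lexgt ([int k, int (s0 + s1 + s2)] @ rev_neg [s0, s1, s2] @ [int (p + q + r)] @ rev_neg [p, q, r] @ rev_neg [x1, x2, x3, x0])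
          ([int k', int (s0' + s1' + s2')] @ rev_neg [s0', s1', s2'] @ [int (p' + q' + r')] @ rev_neg [p', q', r'] @ rev_neg [x1', x2', x3', x0'])"
proof -
  consider "b = 1" | "b = 2" | "b = 3" using b by auto
  then show ?thesis
  proof cases
    case 1
    show ?thesis using assms by (simp add: gtE_iff_lexgt order_key_explicit vec_simps(1)[OF 1] add.assoc)
  next
    case 2
    then have "s2 = 0" "s2' = 0" using assms by auto
    then show ?thesis using assms by (simp add: gtE_iff_lexgt order_key_explicit vec_simps(2)[OF 2] add.assoc)
  next
    case 3
    then have "s2 = 0" "s2' = 0" "s1 = 0" "s1' = 0" using assms by auto
    then show ?thesis using assms by (simp add: gtE_iff_lexgt order_key_explicit vec_simps(3)[OF 3] add.assoc)
  qed
qed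

lemma \<sigma>_simps: 
  "\<sigma> Tv = tt" "\<sigma> (Xv i) = Var (Xv i)" "\<sigma> Phi22 = tt * phi 2 2" "\<sigma> Phi12 = tt * phi 1 2" "\<sigma> Phi11 = tt * phi 1 1"
  "\<sigma> (PsiVar j) = tt * X (int (b + j)) * X 3 ^ a - tt * X (int j) * X 0 ^ (a + d)"
  by (simp_all add: \<sigma>_def tt_def)

end

lemmas term_simps = Var_eq_term_of phi_cases Var_term_of term_of_power term_of_mult term_of_mult2 left_diff_distrib right_diff_distrib
  distrib_left distrib_right

lemma keys_term_of: "kys (term_of \<mu> :: 'k::comm_ring_1 mpoly) \<subseteq> {\<mu>}"
  by (simp add: term_of_def)

lemma keys_term_of_subset:
  "\<mu> \<in> S \<Longrightarrow> kys (term_of \<mu> :: 'k::comm_ring_1 mpoly) \<subseteq> S"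
  using keys_term_of[of \<mu>, where 'k = 'k] by auto

lemma keys_diff_subset: "kys f \<subseteq> S \<Longrightarrow> kys g \<subseteq> S \<Longrightarrow> kys (f - g :: 'k::comm_ring_1 mpoly) \<subseteq> S"
  using keys_diff[of f g] by auto

lemma keys_add_subset: "kys f \<subseteq> S \<Longrightarrow> kys g \<subseteq> S \<Longrightarrow> kys (f + g :: 'k::comm_ring_1 mpoly) \<subseteq> S"
  using keys_add[of f g] by auto

lemma keys_uminus_subset: "kys f \<subseteq> S \<Longrightarrow> kys (- f :: 'k::comm_ring_1 mpoly) \<subseteq> S"
  by simp

lemma keys_zero_subset: "kys (0 :: 'k::comm_ring_1 mpoly) \<subseteq> S"
  by simp

lemmas keys_subset_intros = keys_term_of_subset keys_diff_subset keys_add_subset keys_uminus_subset keys_zero_subset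

lemma single_eq_mon:
    "sgl Tv (Suc 0) = mon 1 0 0 0 0 0 0 0 0 0 0"
    "sgl (Xv (Suc 0)) (Suc 0) = mon 0 1 0 0 0 0 0 0 0 0 0"
    "sgl (Xv 2) (Suc 0) = mon 0 0 1 0 0 0 0 0 0 0 0"
    "sgl (Xv 3) (Suc 0) = mon 0 0 0 1 0 0 0 0 0 0 0"
    "sgl (Xv 0) (Suc 0) = mon 0 0 0 0 1 0 0 0 0 0 0"
    "sgl (PsiVar 0) (Suc 0) = mon 0 0 0 0 0 1 0 0 0 0 0"
    "sgl (PsiVar (Suc 0)) (Suc 0) = mon 0 0 0 0 0 0 1 0 0 0 0"
    "sgl (PsiVar 2) (Suc 0) = mon 0 0 0 0 0 0 0 1 0 0 0"
    "sgl Phi22 (Suc 0) = mon 0 0 0 0 0 0 0 0 1 0 0"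
    "sgl Phi12 (Suc 0) = mon 0 0 0 0 0 0 0 0 0 1 0"
    "sgl Phi11 (Suc 0) = mon 0 0 0 0 0 0 0 0 0 0 1"
  by (simp_all add: mon_def)

text \<open>Homogeneity of the substitution. For the \<Psi> it rests on a m_3 + m_{b+j} = (a+d) m_0
  + m_j, where m_0 = 3a+b enters.\<close>

lemma sigma_deg_1:
  assumes "curve m0 a (Suc 0)" "v \<in> S_vars (Suc 0)"
  shows "kys (curve.\<sigma> d a (Suc 0) v :: 'k::comm_ring_1 mpoly) \<subseteq> {\<kappa> \<in> Mon curve.B. curve.deg m0 d a (Suc 0) \<kappa> = curve.deg m0 d a (Suc 0) (sgl v (Suc 0))}"
proof -
  interpret curve m0 d a "Suc 0" by fact
  have "v \<in> {Tv, Phi22, Phi12, Phi11, Xv 0, Xv (Suc 0), Xv 2, Xv 3} \<union> {PsiVar 0, PsiVar (Suc 0), PsiVar 2}"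
    using assms(2) V_explicit by simp
  then show ?thesis
    apply (simp only: Un_insert_left Un_empty_left)
    apply (elim insertE emptyE; simp add: \<sigma>_simps single_eq_mon term_simps)
    apply (intro keys_subset_intros; simp add: mon_in_Mon_B deg_def total_deg_mon omega_mon; (simp add: m0 algebra_simps; fail)?)+
    done
qed

lemma sigma_deg_2:
  assumes "curve m0 a (2)" "v \<in> S_vars (2)"
  shows "kys (curve.\<sigma> d a (2) v :: 'k::comm_ring_1 mpoly) \<subseteq> {\<kappa> \<in> Mon curve.B. curve.deg m0 d a (2) \<kappa> = curve.deg m0 d a (2) (sgl v (Suc 0))}"
proof -
  interpret curve m0 d a "2" by fact
  have "v \<in> {Tv, Phi22, Phi12, Phi11, Xv 0, Xv (Suc 0), Xv 2, Xv 3} \<union> {PsiVar 0, PsiVar (Suc 0)}"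
    using assms(2) V_explicit by simp
  then show ?thesis
    apply (simp only: Un_insert_left Un_empty_left)
    apply (elim insertE emptyE; simp add: \<sigma>_simps single_eq_mon term_simps)
    apply (intro keys_subset_intros; simp add: mon_in_Mon_B deg_def total_deg_mon omega_mon; (simp add: m0 algebra_simps; fail)?)+
    done
qed

lemma sigma_deg_3:
  assumes "curve m0 a (3)" "v \<in> S_vars (3)"
  shows "kys (curve.\<sigma> d a (3) v :: 'k::comm_ring_1 mpoly) \<subseteq> {\<kappa> \<in> Mon curve.B. curve.deg m0 d a (3) \<kappa> = curve.deg m0 d a (3) (sgl v (Suc 0))}"
proof -
  interpret curve m0 d a "3" by fact
  have "v \<in> {Tv, Phi22, Phi12, Phi11, Xv 0, Xv (Suc 0), Xv 2, Xv 3} \<union> {PsiVar 0}"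
    using assms(2) V_explicit by simp
  then show ?thesis
    apply (simp only: Un_insert_left Un_empty_left)
    apply (elim insertE emptyE; simp add: \<sigma>_simps single_eq_mon term_simps)
    apply (intro keys_subset_intros; simp add: mon_in_Mon_B deg_def total_deg_mon omega_mon; (simp add: m0 algebra_simps; fail)?)+
    done
qed

section \<open>Leading monomials\<close>

context curve begin

lemma graded: "graded_subst V B (gtE m0 d a b) deg (\<sigma> :: var \<Rightarrow> 'k::field mpoly)"
proof
  show "B \<subseteq> V" unfolding B_explicit V_explicit by auto
  show "gtE m0 d a b (\<kappa> + \<mu>) (\<kappa> + \<nu>)" if "gtE m0 d a b \<mu> \<nu>" for \<mu> \<nu> \<kappa>
    using that by (simp add: gtE_iff_lexgt order_key_add lexgt_add length_order_key)
  show "gtE m0 d a b \<mu> \<kappa>" if "gtE m0 d a b \<mu> \<nu>" "gtE m0 d a b \<nu> \<kappa>" for \<mu> \<nu> \<kappa>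
    using that lexgt_trans unfolding gtE_iff_lexgt by blast
  show "gtE m0 d a b \<mu> \<nu> \<or> gtE m0 d a b \<nu> \<mu>" if "\<mu> \<in> Mon V" "\<nu> \<in> Mon V" "\<mu> \<noteq> \<nu>" for \<mu> \<nu>
    unfolding gtE_iff_lexgt by (rule lexgt_total) (use that order_key_inj in \<open>auto simp: length_order_key\<close>)
  show "\<kappa> \<in> Mon B \<and> deg \<kappa> = deg (sgl v 1)" if "v \<in> V" "\<kappa> \<in> kys (\<sigma> v :: 'k mpoly)" for v \<kappa>
  proof -
    have c: "curve m0 a b" by unfold_locales
    have "kys (\<sigma> v :: 'k mpoly) \<subseteq> {\<kappa> \<in> Mon B. deg \<kappa> = deg (sgl v (Suc 0))}"
      using b
    proof (elim disjE)
      assume "b = 1"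
      then show ?thesis using sigma_deg_1[of m0 a v d] c that by simp
    next
      assume "b = 2"
      then show ?thesis using sigma_deg_2[of m0 a v d] c that by simp
    next
      assume "b = 3"
      then show ?thesis using sigma_deg_3[of m0 a v d] c that by simp
    qed
    then show ?thesis using that by auto
  qed
qed (auto simp: deg_add finite_degree gtE_iff_lexgt lexgt_irrefl B_explicit \<sigma>_def)

abbreviation lead :: "'k::field mpoly \<Rightarrow> monom \<Rightarrow> bool" where
  "lead \<equiv> graded_subst.has_lead V (gtE m0 d a b) deg"

abbreviation "lower \<equiv> graded_subst.below V (gtE m0 d a b) deg"

text \<open>All candidate elements have leading coefficient 1, so it suffices to subtract the
  leading monomial and inspect what remains.\<close>

lemma leadI:
  assumes "\<mu> \<in> Mon V" "kys (g - term_of \<mu>) \<subseteq> lower \<mu>"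
  shows "lead (g :: 'k::field mpoly) \<mu>"
proof -
  interpret gs: graded_subst V B "gtE m0 d a b" deg "\<sigma> :: var \<Rightarrow> 'k mpoly" by (rule graded)
  show ?thesis unfolding gs.has_lead_def
    using assms by (intro conjI exI[of _ 1] exI[of _ "g - term_of \<mu>"]) (auto simp: term_of_def)
qed

lemma mon_in_lower:
  assumes "b = 1 \<or> s2 = 0 \<and> s2' = 0" "b \<noteq> 3 \<or> s1 = 0 \<and> s1' = 0"
    and "k' + s0' + s1' + s2' + p' + q' + r' = k + s0 + s1 + s2 + p + q + r"
    and "omega m0 d a b (mon k' x1' x2' x3' x0' s0' s1' s2' p' q' r') = omega m0 d a b (mon k x1 x2 x3 x0 s0 s1 s2 p q r)"
    and "lexgt ([int k, int (s0 + s1 + s2)] @ rev_neg [s0, s1, s2] @ [int (p + q + r)] @ rev_neg [p, q, r] @ rev_neg [x1, x2, x3, x0])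
          ([int k', int (s0' + s1' + s2')] @ rev_neg [s0', s1', s2'] @ [int (p' + q' + r')] @ rev_neg [p', q', r'] @ rev_neg [x1', x2', x3', x0'])"
  shows "mon k' x1' x2' x3' x0' s0' s1' s2' p' q' r' \<in> lower (mon k x1 x2 x3 x0 s0 s1 s2 p q r)"
proof -
  \<comment> \<open>The set \<open>lower\<close> does not depend on the coefficients, so any field
    serves for the instance.\<close>
  interpret gs: graded_subst V B "gtE m0 d a b" deg "\<sigma> :: var \<Rightarrow> rat mpoly" by (rule graded)
  show ?thesis unfolding gs.below_def
  proof (intro CollectI conjI)
    show "mon k' x1' x2' x3' x0' s0' s1' s2' p' q' r' \<in> Mon V"
      using assms by (intro mon_in_Mon) auto
    show "deg (mon k' x1' x2' x3' x0' s0' s1' s2' p' q' r') = deg (mon k x1 x2 x3 x0 s0 s1 s2 p q r)"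
      unfolding deg_def using assms(1-4) by (subst (1 2) total_deg_mon) auto
    show "gtE m0 d a b (mon k x1 x2 x3 x0 s0 s1 s2 p q r) (mon k' x1' x2' x3' x0' s0' s1' s2' p' q' r')"
      using assms by (subst gtE_mon) auto
  qed
qed

end

text \<open>Exponents of products of variables arise as \<open>Suc (Suc 0)\<close>, those of squares as \<open>2\<close>;
  terms cancel only after both have been brought to the same form.\<close>

lemma mon_2:
  "mon 2 e1 e2 e3 e4 e5 e6 e7 e8 e9 e10 = mon (Suc (Suc 0)) e1 e2 e3 e4 e5 e6 e7 e8 e9 e10"
  "mon e0 2 e2 e3 e4 e5 e6 e7 e8 e9 e10 = mon e0 (Suc (Suc 0)) e2 e3 e4 e5 e6 e7 e8 e9 e10"
  "mon e0 e1 2 e3 e4 e5 e6 e7 e8 e9 e10 = mon e0 e1 (Suc (Suc 0)) e3 e4 e5 e6 e7 e8 e9 e10"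
  "mon e0 e1 e2 2 e4 e5 e6 e7 e8 e9 e10 = mon e0 e1 e2 (Suc (Suc 0)) e4 e5 e6 e7 e8 e9 e10"
  "mon e0 e1 e2 e3 2 e5 e6 e7 e8 e9 e10 = mon e0 e1 e2 e3 (Suc (Suc 0)) e5 e6 e7 e8 e9 e10"
  "mon e0 e1 e2 e3 e4 2 e6 e7 e8 e9 e10 = mon e0 e1 e2 e3 e4 (Suc (Suc 0)) e6 e7 e8 e9 e10"
  "mon e0 e1 e2 e3 e4 e5 2 e7 e8 e9 e10 = mon e0 e1 e2 e3 e4 e5 (Suc (Suc 0)) e7 e8 e9 e10"
  "mon e0 e1 e2 e3 e4 e5 e6 2 e8 e9 e10 = mon e0 e1 e2 e3 e4 e5 e6 (Suc (Suc 0)) e8 e9 e10"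
  "mon e0 e1 e2 e3 e4 e5 e6 e7 2 e9 e10 = mon e0 e1 e2 e3 e4 e5 e6 e7 (Suc (Suc 0)) e9 e10"
  "mon e0 e1 e2 e3 e4 e5 e6 e7 e8 2 e10 = mon e0 e1 e2 e3 e4 e5 e6 e7 e8 (Suc (Suc 0)) e10"
  "mon e0 e1 e2 e3 e4 e5 e6 e7 e8 e9 2 = mon e0 e1 e2 e3 e4 e5 e6 e7 e8 e9 (Suc (Suc 0))"
  by (simp_all add: numeral_2_eq_2)

abbreviation lead_at :: "nat \<Rightarrow> nat \<Rightarrow> nat \<Rightarrow> nat \<Rightarrow> 'k::field mpoly \<Rightarrow> monom \<Rightarrow> bool" where
  "lead_at m0 d a b \<equiv> graded_subst.has_lead (S_vars b) (gtE m0 d a b) (curve.deg m0 d a b)"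

lemmas index_simps = X_out PhiV_cases PsiV_cases eps_def Let_def
lemmas gen_defs = PP_def PPsi_def LL_def DD_def BB_def AA_def MM_def Q11_def Q12_def Q21_def

text \<open>The terms of each element share their bidegree, so the comparison is decided by the
  exponent of t, then the number of factors \<Psi>, then the smaller index of \<Psi>, and only then
  by \<Phi> and X. Writing a as \<open>Suc c\<close> turns the exponents a-1 and a+d-1 into
  \<open>c\<close> and \<open>c + d\<close>.\<close>

lemma leads_1:
  assumes c: "curve m0 (Suc c) (Suc 0)"
  shows
    "lead_at m0 d (Suc c) (Suc 0) (PP 1 1 :: 'k::field mpoly) (mon 1 2 0 0 0 0 0 0 0 0 0)"
    "lead_at m0 d (Suc c) (Suc 0) (PP 1 2 :: 'k::field mpoly) (mon 1 1 1 0 0 0 0 0 0 0 0)"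
    "lead_at m0 d (Suc c) (Suc 0) (PP 2 2 :: 'k::field mpoly) (mon 1 0 2 0 0 0 0 0 0 0 0)"
    "lead_at m0 d (Suc c) (Suc 0) (PPsi (Suc c) d (Suc 0) 0 :: 'k::field mpoly) (mon 1 1 0 (c + 1) 0 0 0 0 0 0 0)"
    "lead_at m0 d (Suc c) (Suc 0) (PPsi (Suc c) d (Suc 0) 1 :: 'k::field mpoly) (mon 1 0 1 (c + 1) 0 0 0 0 0 0 0)"
    "lead_at m0 d (Suc c) (Suc 0) (PPsi (Suc c) d (Suc 0) 2 :: 'k::field mpoly) (mon 1 0 0 (c + 2) 0 0 0 0 0 0 0)"
    "lead_at m0 d (Suc c) (Suc 0) (LL 0 :: 'k::field mpoly) (mon 0 0 0 0 1 0 0 0 1 0 0)"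
    "lead_at m0 d (Suc c) (Suc 0) (LL 1 :: 'k::field mpoly) (mon 0 1 0 0 0 0 0 0 1 0 0)"
    "lead_at m0 d (Suc c) (Suc 0) (DD :: 'k::field mpoly) (mon 0 2 0 0 0 0 0 0 0 1 0)"
    "lead_at m0 d (Suc c) (Suc 0) (BB (Suc c) d (Suc 0) 1 1 :: 'k::field mpoly) (mon 0 2 0 0 0 0 0 1 0 0 0)"
    "lead_at m0 d (Suc c) (Suc 0) (BB (Suc c) d (Suc 0) 1 2 :: 'k::field mpoly) (mon 0 1 1 0 0 0 0 1 0 0 0)"
    "lead_at m0 d (Suc c) (Suc 0) (BB (Suc c) d (Suc 0) 2 2 :: 'k::field mpoly) (mon 0 0 2 0 0 0 0 1 0 0 0)"
    "lead_at m0 d (Suc c) (Suc 0) (AA (Suc c) d 1 (Suc 0) 0 :: 'k::field mpoly) (mon 0 1 0 0 0 1 0 0 0 0 0)"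
    "lead_at m0 d (Suc c) (Suc 0) (AA (Suc c) d 2 (Suc 0) 0 :: 'k::field mpoly) (mon 0 0 1 0 0 1 0 0 0 0 0)"
    "lead_at m0 d (Suc c) (Suc 0) (AA (Suc c) d 3 (Suc 0) 0 :: 'k::field mpoly) (mon 0 0 0 1 0 1 0 0 0 0 0)"
    "lead_at m0 d (Suc c) (Suc 0) (MM (Suc c) d (Suc 0) 0 :: 'k::field mpoly) (mon 1 0 0 0 (c + d + 2) 1 0 0 0 0 0)"
    "lead_at m0 d (Suc c) (Suc 0) (AA (Suc c) d 1 (Suc 0) 1 :: 'k::field mpoly) (mon 0 1 0 0 0 0 1 0 0 0 0)"
    "lead_at m0 d (Suc c) (Suc 0) (AA (Suc c) d 2 (Suc 0) 1 :: 'k::field mpoly) (mon 0 0 1 0 0 0 1 0 0 0 0)"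
    "lead_at m0 d (Suc c) (Suc 0) (AA (Suc c) d 3 (Suc 0) 1 :: 'k::field mpoly) (mon 0 0 0 1 0 0 1 0 0 0 0)"
    "lead_at m0 d (Suc c) (Suc 0) (MM (Suc c) d (Suc 0) 1 :: 'k::field mpoly) (mon 1 0 0 0 (c + d + 2) 0 1 0 0 0 0)"
    "lead_at m0 d (Suc c) (Suc 0) (Q11 :: 'k::field mpoly) (mon 0 0 0 0 0 1 0 0 1 0 0)"
    "lead_at m0 d (Suc c) (Suc 0) (Q12 (Suc c) d :: 'k::field mpoly) (mon 0 0 0 0 0 0 2 0 0 0 0)"
  by (rule curve.leadI[OF c],
      (simp add: curve.mon_in_Mon[OF c])[1],
      (simp add: gen_defs index_simps term_simps mon_2)[1],
      (intro keys_subset_intros; (rule curve.mon_in_lower[OF c];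
        simp add: rev_neg_def curve.omega_mon[OF c]; (simp add: curve.m0[OF c] algebra_simps; fail)?))[1])+

lemma leads_2:
  assumes c: "curve m0 (Suc c) 2"
  shows
    "lead_at m0 d (Suc c) 2 (PP 1 1 :: 'k::field mpoly) (mon 1 2 0 0 0 0 0 0 0 0 0)"
    "lead_at m0 d (Suc c) 2 (PP 1 2 :: 'k::field mpoly) (mon 1 1 1 0 0 0 0 0 0 0 0)"
    "lead_at m0 d (Suc c) 2 (PP 2 2 :: 'k::field mpoly) (mon 1 0 2 0 0 0 0 0 0 0 0)"
    "lead_at m0 d (Suc c) 2 (PPsi (Suc c) d 2 0 :: 'k::field mpoly) (mon 1 0 1 (c + 1) 0 0 0 0 0 0 0)"
    "lead_at m0 d (Suc c) 2 (PPsi (Suc c) d 2 1 :: 'k::field mpoly) (mon 1 0 0 (c + 2) 0 0 0 0 0 0 0)"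
    "lead_at m0 d (Suc c) 2 (LL 0 :: 'k::field mpoly) (mon 0 0 0 0 1 0 0 0 1 0 0)"
    "lead_at m0 d (Suc c) 2 (LL 1 :: 'k::field mpoly) (mon 0 1 0 0 0 0 0 0 1 0 0)"
    "lead_at m0 d (Suc c) 2 (DD :: 'k::field mpoly) (mon 0 2 0 0 0 0 0 0 0 1 0)"
    "lead_at m0 d (Suc c) 2 (BB (Suc c) d 2 1 1 :: 'k::field mpoly) (mon 0 2 0 0 0 0 1 0 0 0 0)"
    "lead_at m0 d (Suc c) 2 (BB (Suc c) d 2 1 2 :: 'k::field mpoly) (mon 0 1 1 0 0 0 1 0 0 0 0)"
    "lead_at m0 d (Suc c) 2 (BB (Suc c) d 2 2 2 :: 'k::field mpoly) (mon 0 0 2 0 0 0 1 0 0 0 0)"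
    "lead_at m0 d (Suc c) 2 (AA (Suc c) d 1 2 0 :: 'k::field mpoly) (mon 0 1 0 0 0 1 0 0 0 0 0)"
    "lead_at m0 d (Suc c) 2 (AA (Suc c) d 2 2 0 :: 'k::field mpoly) (mon 0 0 1 0 0 1 0 0 0 0 0)"
    "lead_at m0 d (Suc c) 2 (AA (Suc c) d 3 2 0 :: 'k::field mpoly) (mon 0 0 0 1 0 1 0 0 0 0 0)"
    "lead_at m0 d (Suc c) 2 (MM (Suc c) d 2 0 :: 'k::field mpoly) (mon 1 0 0 0 (c + d + 2) 1 0 0 0 0 0)"
    "lead_at m0 d (Suc c) 2 (Q21 (Suc c) d :: 'k::field mpoly) (mon 0 0 0 0 0 2 0 0 1 0 0)"
  by (rule curve.leadI[OF c],
      (simp add: curve.mon_in_Mon[OF c])[1],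
      (simp add: gen_defs index_simps term_simps mon_2)[1],
      (intro keys_subset_intros; (rule curve.mon_in_lower[OF c];
        simp add: rev_neg_def curve.omega_mon[OF c]; (simp add: curve.m0[OF c] algebra_simps; fail)?))[1])+

lemma leads_3:
  assumes c: "curve m0 (Suc c) 3"
  shows
    "lead_at m0 d (Suc c) 3 (PP 1 1 :: 'k::field mpoly) (mon 1 2 0 0 0 0 0 0 0 0 0)"
    "lead_at m0 d (Suc c) 3 (PP 1 2 :: 'k::field mpoly) (mon 1 1 1 0 0 0 0 0 0 0 0)"
    "lead_at m0 d (Suc c) 3 (PP 2 2 :: 'k::field mpoly) (mon 1 0 2 0 0 0 0 0 0 0 0)"
    "lead_at m0 d (Suc c) 3 (PPsi (Suc c) d 3 0 :: 'k::field mpoly) (mon 1 0 0 (c + 2) 0 0 0 0 0 0 0)"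
    "lead_at m0 d (Suc c) 3 (LL 0 :: 'k::field mpoly) (mon 0 0 0 0 1 0 0 0 1 0 0)"
    "lead_at m0 d (Suc c) 3 (LL 1 :: 'k::field mpoly) (mon 0 1 0 0 0 0 0 0 1 0 0)"
    "lead_at m0 d (Suc c) 3 (DD :: 'k::field mpoly) (mon 0 2 0 0 0 0 0 0 0 1 0)"
    "lead_at m0 d (Suc c) 3 (BB (Suc c) d 3 1 1 :: 'k::field mpoly) (mon 0 2 0 0 0 1 0 0 0 0 0)"
    "lead_at m0 d (Suc c) 3 (BB (Suc c) d 3 1 2 :: 'k::field mpoly) (mon 0 1 1 0 0 1 0 0 0 0 0)"
    "lead_at m0 d (Suc c) 3 (BB (Suc c) d 3 2 2 :: 'k::field mpoly) (mon 0 0 2 0 0 1 0 0 0 0 0)"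
  by (rule curve.leadI[OF c],
      (simp add: curve.mon_in_Mon[OF c])[1],
      (simp add: gen_defs index_simps term_simps mon_2)[1],
      (intro keys_subset_intros; (rule curve.mon_in_lower[OF c];
        simp add: rev_neg_def curve.omega_mon[OF c]; (simp add: curve.m0[OF c] algebra_simps; fail)?))[1])+

section \<open>The ideal as a kernel\<close>

lemma in_S_iff_Mon: "in_S b f \<longleftrightarrow> kys f \<subseteq> Mon (S_vars b)"
  by (auto simp: in_S_def Mon_def)

lemma in_S_add: "in_S b f \<Longrightarrow> in_S b g \<Longrightarrow> in_S b (f + g :: 'k::comm_ring_1 mpoly)"
  unfolding in_S_iff_Mon by (rule keys_add_subset)

lemma in_S_mult: "in_S b f \<Longrightarrow> in_S b g \<Longrightarrow> in_S b (f * g :: 'k::comm_ring_1 mpoly)"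
  unfolding in_S_iff_Mon using keys_mult[of f g] Mon_add by fastforce

lemma in_S_sum: "(\<And>x. x \<in> A \<Longrightarrow> in_S b (f x)) \<Longrightarrow> in_S b (\<Sum>x\<in>A. f x :: 'k::comm_ring_1 mpoly)"
  by (induction A rule: infinite_finite_induct) (simp_all add: in_S_add, simp_all add: in_S_def)

lemma ideal_S_add:
  assumes "f \<in> ideal_S b G" "g \<in> ideal_S b G"
  shows "f + g \<in> ideal_S b (G :: 'k::comm_ring_1 mpoly set)"
proof -
  obtain c c' where "\<forall>g\<in>G. in_S b (c g)" "f = (\<Sum>g\<in>G. c g * g)" "\<forall>g\<in>G. in_S b (c' g)" "g = (\<Sum>g\<in>G. c' g * g)"
    using assms by (auto simp: ideal_S_def)
  then show ?thesis unfolding ideal_S_def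
    by (intro CollectI exI[of _ "\<lambda>g. c g + c' g"]) (auto simp: in_S_add distrib_right sum.distrib)
qed

lemma ideal_S_mult:
  assumes "in_S b h" "f \<in> ideal_S b G"
  shows "h * f \<in> ideal_S b (G :: 'k::comm_ring_1 mpoly set)"
proof -
  obtain c where "\<forall>g\<in>G. in_S b (c g)" "f = (\<Sum>g\<in>G. c g * g)"
    using assms by (auto simp: ideal_S_def)
  then show ?thesis unfolding ideal_S_def
    by (intro CollectI exI[of _ "\<lambda>g. h * c g"]) (auto simp: in_S_mult assms sum_distrib_left mult.assoc)
qed

lemma ideal_S_0: "0 \<in> ideal_S b (G :: 'k::comm_ring_1 mpoly set)"
  unfolding ideal_S_def by (intro CollectI exI[of _ "\<lambda>_. 0"]) (auto simp: in_S_def)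

lemma ideal_S_sum: "(\<And>x. x \<in> A \<Longrightarrow> f x \<in> ideal_S b G) \<Longrightarrow> (\<Sum>x\<in>A. f x) \<in> ideal_S b (G :: 'k::comm_ring_1 mpoly set)"
  by (induction A rule: infinite_finite_induct) (auto simp: ideal_S_0 ideal_S_add)

lemma ideal_S_uminus: "f \<in> ideal_S b G \<Longrightarrow> - f \<in> ideal_S b (G :: 'k::comm_ring_1 mpoly set)"
  using ideal_S_mult[of b "-1" f G] by (simp add: in_S_def)

text \<open>Finiteness matters here, since a sum over an infinite set is 0 by convention.\<close>

lemma ideal_S_generator:
  assumes "finite G" "g \<in> G"
  shows "g \<in> ideal_S b (G :: 'k::comm_ring_1 mpoly set)"
proof -
  have "(\<Sum>h\<in>G. (if h = g then 1 else 0) * h) = g"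
    using assms by (simp add: if_distrib[of "\<lambda>x. x * _"] cong: if_cong)
  then show ?thesis unfolding ideal_S_def
    by (intro CollectI exI[of _ "\<lambda>h. if h = g then 1 else 0"]) (auto simp: in_S_def)
qed

lemma ideal_S_in_S:
  assumes "\<And>g. g \<in> G \<Longrightarrow> in_S b g" "f \<in> ideal_S b G"
  shows "in_S b (f :: 'k::comm_ring_1 mpoly)"
  using assms by (auto simp: ideal_S_def intro!: in_S_sum in_S_mult)

lemma int_atLeastAtMost_cases:
  "{f l | l. 0 \<le> l \<and> l \<le> (0::int)} = {f 0}"
  "{f l | l. 0 \<le> l \<and> l \<le> (1::int)} = {f 0, f 1}"
  "{f l | l. 0 \<le> l \<and> l \<le> (2::int)} = {f 0, f 1, f 2}"
  "{g i j | i j. i \<in> {1, 2} \<and> j \<in> {1, 2}} = {g 1 1, g 1 2, g 2 1, g 2 (2::int)}"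
  "{g i l | i l. i \<in> {1, 2, 3} \<and> 0 \<le> l \<and> l \<le> (0::int)} = {g 1 0, g 2 0, g (3::int) 0}"
  "{g i l | i l. i \<in> {1, 2, 3} \<and> 0 \<le> l \<and> l \<le> (1::int)} = {g 1 0, g 2 0, g (3::int) 0, g 1 1, g 2 1, g 3 1}"
proof -
  have *: "0 \<le> l \<and> l \<le> 0 \<longleftrightarrow> l = 0" "0 \<le> l \<and> l \<le> 1 \<longleftrightarrow> l = 0 \<or> l = 1"
     "0 \<le> l \<and> l \<le> 2 \<longleftrightarrow> l = 0 \<or> l = 1 \<or> l = 2" for l :: int by auto
  show 
  "{f l | l. 0 \<le> l \<and> l \<le> (0::int)} = {f 0}"
  "{f l | l. 0 \<le> l \<and> l \<le> (1::int)} = {f 0, f 1}"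
  "{f l | l. 0 \<le> l \<and> l \<le> (2::int)} = {f 0, f 1, f 2}"
  "{g i j | i j. i \<in> {1, 2} \<and> j \<in> {1, 2}} = {g 1 1, g 1 2, g 2 1, g 2 (2::int)}"
  "{g i l | i l. i \<in> {1, 2, 3} \<and> 0 \<le> l \<and> l \<le> (0::int)} = {g 1 0, g 2 0, g (3::int) 0}"
  "{g i l | i l. i \<in> {1, 2, 3} \<and> 0 \<le> l \<and> l \<le> (1::int)} = {g 1 0, g 2 0, g (3::int) 0, g 1 1, g 2 1, g 3 1}"
    unfolding * by auto
qed

lemma gens_a_explicit:
  "gens_a a d (Suc 0) = {PP 1 1, PP 1 2, PP 2 1, PP 2 2, PPsi a d (Suc 0) 0, PPsi a d (Suc 0) 1, PPsi a d (Suc 0) 2}"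
  "gens_a a d 2 = {PP 1 1, PP 1 2, PP 2 1, PP 2 2, PPsi a d 2 0, PPsi a d 2 1}"
  "gens_a a d 3 = {PP 1 1, PP 1 2, PP 2 1, PP 2 2, PPsi a d 3 0}"
  unfolding gens_a_def int_atLeastAtMost_cases(4) by (simp_all add: int_atLeastAtMost_cases insert_commute)

lemma GB_set_explicit:
  "GB_set a d (Suc 0) = {PP 1 1, PP 1 2, PP 2 1, PP 2 2, PPsi a d (Suc 0) 0, PPsi a d (Suc 0) 1, PPsi a d (Suc 0) 2}
     \<union> {MM a d (Suc 0) 0, MM a d (Suc 0) 1} \<union> {LL 0, LL 1}
     \<union> {BB a d (Suc 0) 1 1, BB a d (Suc 0) 1 2, BB a d (Suc 0) 2 1, BB a d (Suc 0) 2 2}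
     \<union> {AA a d 1 (Suc 0) 0, AA a d 2 (Suc 0) 0, AA a d 3 (Suc 0) 0, AA a d 1 (Suc 0) 1, AA a d 2 (Suc 0) 1, AA a d 3 (Suc 0) 1}
     \<union> {DD, Q11, Q12 a d}" (is "_ = ?A")
  "GB_set a d 2 = {PP 1 1, PP 1 2, PP 2 1, PP 2 2, PPsi a d 2 0, PPsi a d 2 1}
     \<union> {MM a d 2 0} \<union> {LL 0, LL 1}
     \<union> {BB a d 2 1 1, BB a d 2 1 2, BB a d 2 2 1, BB a d 2 2 2}
     \<union> {AA a d 1 2 0, AA a d 2 2 0, AA a d 3 2 0}
     \<union> {DD, Q21 a d}" (is "_ = ?B")
  "GB_set a d 3 = {PP 1 1, PP 1 2, PP 2 1, PP 2 2, PPsi a d 3 0} \<union> {LL 0, LL 1}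
     \<union> {BB a d 3 1 1, BB a d 3 1 2, BB a d 3 2 1, BB a d 3 2 2}
     \<union> {DD}" (is "_ = ?C")
proof -
  have e: "3 - int (Suc 0) = 2" "2 - int (Suc 0) = 1" "3 - int 2 = 1" "2 - int 2 = 0" "3 - int 3 = 0"
    by simp_all
  show "GB_set a d (Suc 0) = ?A" unfolding GB_set_def e int_atLeastAtMost_cases by (simp add: insert_commute)
  show "GB_set a d 2 = ?B" unfolding GB_set_def e int_atLeastAtMost_cases by (simp add: insert_commute)
  show "GB_set a d 3 = ?C" unfolding GB_set_def e int_atLeastAtMost_cases by (simp add: insert_commute)
qed

lemma finite_gens_a: "b = 1 \<or> b = 2 \<or> b = 3 \<Longrightarrow> finite (gens_a a d b)"
  by (auto simp: gens_a_explicit)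

lemma finite_GB_set: "b = 1 \<or> b = 2 \<or> b = 3 \<Longrightarrow> finite (GB_set a d b)"
  by (auto simp: GB_set_explicit)

lemma PP_symmetric: "PP 2 1 = PP 1 2" "BB a d b 2 1 = BB a d b 1 2"
  by (simp_all add: PP_def BB_def phi_cases PhiV_cases)

context curve begin

lemma subst_atoms:
  "subst \<sigma> tt = tt" "subst \<sigma> (X i) = X i"
  "subst \<sigma> (Var Phi22) = tt * (X 2 * X 2 - X 3 * X 1)"
  "subst \<sigma> (Var Phi12) = tt * (X 1 * X 2 - X 3 * X 0)"
  "subst \<sigma> (Var Phi11) = tt * (X 1 * X 1 - X 2 * X 0)"
  "subst \<sigma> (Var (PsiVar j)) = tt * X (int (b + j)) * X 3 ^ a - tt * X (int j) * X 0 ^ (a + d)"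
  by (simp_all add: tt_def X_def subst_Var \<sigma>_simps phi_cases)

end

section \<open>The candidate elements lie in the kernel\<close>

lemma subst_GB_1:
  assumes "curve m0 (Suc c) (Suc 0)" "g \<in> GB_set (Suc c) d (Suc 0)"
  shows "subst (curve.\<sigma> d (Suc c) (Suc 0)) g = (0 :: 'k::comm_ring_1 mpoly)"
proof -
  interpret curve m0 d "Suc c" "Suc 0" by fact
  show ?thesis using assms(2) unfolding GB_set_explicit
    by (elim UnE insertE emptyE; simp add: gen_defs phi_cases index_simps subst_simps subst_atoms \<sigma>_simps power2_eq_square power3_eq_cube power_even_eq;
        (simp add: term_simps; fail)?; (simp add: algebra_simps; fail)?)
qed

lemma subst_GB_2:
  assumes "curve m0 (Suc c) 2" "g \<in> GB_set (Suc c) d 2"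
  shows "subst (curve.\<sigma> d (Suc c) 2) g = (0 :: 'k::comm_ring_1 mpoly)"
proof -
  interpret curve m0 d "Suc c" 2 by fact
  show ?thesis using assms(2) unfolding GB_set_explicit
    by (elim UnE insertE emptyE; simp add: gen_defs phi_cases index_simps subst_simps subst_atoms \<sigma>_simps power2_eq_square power3_eq_cube power_even_eq;
        (simp add: term_simps; fail)?; (simp add: algebra_simps; fail)?)
qed

lemma subst_GB_3:
  assumes "curve m0 (Suc c) 3" "g \<in> GB_set (Suc c) d 3"
  shows "subst (curve.\<sigma> d (Suc c) 3) g = (0 :: 'k::comm_ring_1 mpoly)"
proof -
  interpret curve m0 d "Suc c" 3 by fact
  show ?thesis using assms(2) unfolding GB_set_explicit
    by (elim UnE insertE emptyE; simp add: gen_defs phi_cases index_simps subst_simps subst_atoms \<sigma>_simps power2_eq_square power3_eq_cube power_even_eq;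
        (simp add: term_simps; fail)?; (simp add: algebra_simps; fail)?)
qed

lemma GB_has_lead_1:
  assumes "curve m0 (Suc c) (Suc 0)" "g \<in> GB_set (Suc c) d (Suc 0)"
  shows "\<exists>\<mu>. lead_at m0 d (Suc c) (Suc 0) (g :: 'k::field mpoly) \<mu>"
  using assms(2) unfolding GB_set_explicit PP_symmetric
  by - (elim UnE insertE emptyE, (erule ssubst, intro exI, rule leads_1[OF assms(1)])+)

lemma GB_has_lead_2:
  assumes "curve m0 (Suc c) 2" "g \<in> GB_set (Suc c) d 2"
  shows "\<exists>\<mu>. lead_at m0 d (Suc c) 2 (g :: 'k::field mpoly) \<mu>"
  using assms(2) unfolding GB_set_explicit PP_symmetric
  by - (elim UnE insertE emptyE, (erule ssubst, intro exI, rule leads_2[OF assms(1)])+)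

lemma GB_has_lead_3:
  assumes "curve m0 (Suc c) 3" "g \<in> GB_set (Suc c) d 3"
  shows "\<exists>\<mu>. lead_at m0 d (Suc c) 3 (g :: 'k::field mpoly) \<mu>"
  using assms(2) unfolding GB_set_explicit PP_symmetric
  by - (elim UnE insertE emptyE, (erule ssubst, intro exI, rule leads_3[OF assms(1)])+)

context curve begin

lemma curve_cases:
  obtains c where "a = Suc c" "b = Suc 0" "curve m0 (Suc c) (Suc 0)"
  | c where "a = Suc c" "b = 2" "curve m0 (Suc c) 2"
  | c where "a = Suc c" "b = 3" "curve m0 (Suc c) 3"
proof -
  obtain c where c: "a = Suc c" using a by (cases a) auto
  have "curve m0 a b" by unfold_locales
  with b c that show ?thesis by auto
qed

lemma GB_has_lead: "g \<in> GB_set a d b \<Longrightarrow> \<exists>\<mu>. lead (g :: 'k::field mpoly) \<mu>"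
  by (rule curve_cases; simp add: GB_has_lead_1 GB_has_lead_2 GB_has_lead_3)

lemma subst_GB: "g \<in> GB_set a d b \<Longrightarrow> subst \<sigma> g = (0 :: 'k::comm_ring_1 mpoly)"
  by (rule curve_cases; simp add: subst_GB_1 subst_GB_2 subst_GB_3)

text \<open>Membership in S is read off from the leading-monomial data, which places every term in
  \<open>Mon V\<close>.\<close>

lemma GB_in_Mon:
  assumes "(g :: 'k::field mpoly) \<in> GB_set a d b"
  shows "kys g \<subseteq> Mon V"
proof -
  interpret gs: graded_subst V B "gtE m0 d a b" deg "\<sigma> :: var \<Rightarrow> 'k mpoly" by (rule graded)
  obtain \<mu> c h where g: "\<mu> \<in> Mon V" "g = sgl \<mu> c + h" "kys h \<subseteq> gs.below \<mu>"
    using GB_has_lead[OF assms] by (auto simp: gs.has_lead_def)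
  then have "kys h \<subseteq> Mon V" by (auto simp: gs.below_def)
  moreover have "kys (sgl \<mu> c) \<subseteq> Mon V" using g by simp
  ultimately show ?thesis unfolding g(2) by (intro keys_add_subset)
qed

lemma gens_subset_GB: "gens_a a d b \<subseteq> GB_set a d b"
  by (auto simp: gens_a_def GB_set_def)

lemma subst_ideal:
  assumes "f \<in> ideal_S b (gens_a a d b :: 'k::field mpoly set)"
  shows "subst \<sigma> f = 0" "kys f \<subseteq> Mon V"
proof -
  have g: "subst \<sigma> g = 0" "in_S b g" if "g \<in> gens_a a d b" for g :: "'k mpoly"
    using that gens_subset_GB subst_GB[of g] GB_in_Mon[of g] by (auto simp: in_S_iff_Mon)
  show "kys f \<subseteq> Mon V" using ideal_S_in_S[OF g(2) assms] by (simp add: in_S_iff_Mon)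
  show "subst \<sigma> f = 0" using assms g by (auto simp: ideal_S_def subst_sum subst_mult)
qed

text \<open>The polynomials congruent to their image are closed under products and contain the
  constants and the variables, hence all monomials; sums then follow directly.\<close>

lemma subst_congruent:
  assumes "kys f \<subseteq> Mon V"
  shows "f - subst \<sigma> f \<in> ideal_S b (gens_a a d b :: 'k::field mpoly set)"
proof -
  interpret gs: graded_subst V B "gtE m0 d a b" deg "\<sigma> :: var \<Rightarrow> 'k mpoly" by (rule graded)
  let ?I = "ideal_S b (gens_a a d b :: 'k mpoly set)"
  \<comment> \<open>Membership in S is carried along because multipliers of the ideal must lie in
    S.\<close>
  let ?C = "{f :: 'k mpoly. in_S b f \<and> in_S b (subst \<sigma> f) \<and> f - subst \<sigma> f \<in> ?I}"
  have fin: "finite (gens_a a d b)" by (rule finite_gens_a[OF b])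
  have mult: "f * g \<in> ?C" if "f \<in> ?C" "g \<in> ?C" for f g
  proof -
    \<comment> \<open>The usual splitting: each summand contains one difference that already lies in
      the ideal.\<close>
    have "f * g - subst \<sigma> (f * g) = f * (g - subst \<sigma> g) + subst \<sigma> g * (f - subst \<sigma> f)"
      by (simp add: subst_mult algebra_simps)
    then show ?thesis using that by (simp add: in_S_mult ideal_S_add ideal_S_mult subst_mult)
  qed
  have const: "sgl 0 c \<in> ?C" for c
    by (simp add: subst_single in_S_def ideal_S_0)
  have one: "1 \<in> ?C" using const[of 1] by simp
  have var: "Var v \<in> ?C" if v: "v \<in> V" for v
  proof -
    have "kys (\<sigma> v :: 'k mpoly) \<subseteq> Mon V" using gs.\<sigma>_deg[OF that] gs.Mon_B_V by auto
    moreover have "in_S b (Var v :: 'k mpoly)" using that by (simp add: in_S_def Var_def)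
    moreover have "Var v - \<sigma> v \<in> ?I"
    proof (cases "\<sigma> v = (Var v :: 'k mpoly)")
      case True
      then show ?thesis by (simp add: ideal_S_0)
    next
      case False
      have gen: "- g \<in> ?I" if "g \<in> gens_a a d b" for g
        by (intro ideal_S_uminus ideal_S_generator fin that)
      consider "v = Phi22" | "v = Phi12" | "v = Phi11" | j where "v = PsiVar j" "j \<le> 3 - b"
        using False v unfolding S_vars_def by (cases v) (auto simp: \<sigma>_def)
      then show ?thesis
      proof cases
        case 1
        have "PP 2 2 \<in> (gens_a a d b :: 'k mpoly set)" by (auto simp: gens_a_def)
        from gen[OF this] show ?thesis by (simp add: 1 PP_def PhiV_cases \<sigma>_simps)
      next
        case 2
        have "PP 1 2 \<in> (gens_a a d b :: 'k mpoly set)" by (auto simp: gens_a_def)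
        from gen[OF this] show ?thesis by (simp add: 2 PP_def PhiV_cases \<sigma>_simps)
      next
        case 3
        have "PP 1 1 \<in> (gens_a a d b :: 'k mpoly set)" by (auto simp: gens_a_def)
        from gen[OF this] show ?thesis by (simp add: 3 PP_def PhiV_cases \<sigma>_simps)
      next
        case 4
        then have "PPsi a d b (int j) \<in> (gens_a a d b :: 'k mpoly set)" using b by (auto simp: gens_a_def)
        from gen[OF this] 4 b show ?thesis by (auto simp: PPsi_def PsiV_def \<sigma>_simps)
      qed
    qed
    ultimately show ?thesis by (simp add: subst_Var in_S_iff_Mon)
  qed
  have pow: "f ^ n \<in> ?C" if "f \<in> ?C" for f n
  proof (induction n)
    case 0
    then show ?case using one by simp
  next
    case (Suc n)
    then show ?case unfolding power_Suc using mult that by blast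
  qed
  have prod: "(\<Prod>v\<in>A. Var v ^ k v) \<in> ?C" if "finite A" "A \<subseteq> V" for A and k :: "var \<Rightarrow> nat"
    using that
  proof (induction A rule: finite_induct)
    case empty
    then show ?case using one by simp
  next
    case (insert v A)
    then show ?case using mult[OF pow[OF var]] by simp
  qed
  have mono: "sgl m c \<in> ?C" if m: "m \<in> Mon V" for m c
  proof -
    have "sgl m c = sgl 0 c * (\<Prod>v\<in>kys m. Var v ^ lk m v)"
      by (simp add: prod_Var mult_single flip: poly_mapping_eq_sum_single)
    also have "\<dots> \<in> ?C"
      by (rule mult[OF const prod]) (use m in \<open>auto simp: Mon_def\<close>)
    finally show ?thesis .
  qed
  have "f - subst \<sigma> f = (\<Sum>m\<in>kys f. sgl m (lk f m) - subst \<sigma> (sgl m (lk f m)))"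
    by (simp add: sum_subtractf flip: subst_sum poly_mapping_eq_sum_single)
  also have "\<dots> \<in> ?I"
    using mono assms by (intro ideal_S_sum) auto
  finally show ?thesis .
qed

text \<open>When the image of f is 0, the congruence places f itself in the ideal. Membership of M,
  A, B, D, L and Q thereby becomes an evaluation; no cofactors have to be found.\<close>

lemma mem_ideal_iff:
  "f \<in> ideal_S b (gens_a a d b) \<longleftrightarrow> kys (f :: 'k::field mpoly) \<subseteq> Mon V \<and> subst \<sigma> f = 0"
  using subst_ideal[of f] subst_congruent[of f] by auto

lemma GB_subset_ideal: "GB_set a d b \<subseteq> ideal_S b (gens_a a d b :: 'k::field mpoly set)"
proof
  fix g :: "'k mpoly" assume "g \<in> GB_set a d b"
  then show "g \<in> ideal_S b (gens_a a d b)" by (simp add: mem_ideal_iff GB_in_Mon subst_GB)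
qed

text \<open>The type token records the field, which cannot be recovered from a set of
  monomials.\<close>

abbreviation std :: "'k::field itself \<Rightarrow> monom set" where
  "std K \<equiv> graded_subst.standard V (gtE m0 d a b) deg (GB_set a d b :: 'k mpoly set)"

lemma std_not_dvd:
  assumes "\<mu> \<in> std TYPE('k)" "lead (g :: 'k::field mpoly) \<nu>" "g \<in> GB_set a d b"
  shows "\<not> mon_dvd \<nu> \<mu>"
proof -
  interpret gs: graded_subst V B "gtE m0 d a b" deg "\<sigma> :: var \<Rightarrow> 'k mpoly" by (rule graded)
  show ?thesis using assms by (auto simp: gs.standard_def)
qed

end

section \<open>Weights of boxes of exponents\<close>

definition weight :: "(var \<Rightarrow> real) \<Rightarrow> monom \<Rightarrow> real" where
  "weight x \<mu> = (\<Prod>v\<in>kys \<mu>. x v ^ lk \<mu> v)"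

text \<open>The exponents vary independently of each other, which is what makes the weight of a box
  a product.\<close>

definition box :: "var set \<Rightarrow> (var \<Rightarrow> nat set) \<Rightarrow> monom set" where
  "box A S = {\<mu> \<in> Mon A. \<forall>v\<in>A. lk \<mu> v \<in> S v}"

definition pow_sum :: "real \<Rightarrow> nat set \<Rightarrow> real" where
  "pow_sum x S = infsum (\<lambda>n. x ^ n) S"

lemma weight_superset: "finite A \<Longrightarrow> kys \<mu> \<subseteq> A \<Longrightarrow> weight x \<mu> = (\<Prod>v\<in>A. x v ^ lk \<mu> v)"
  unfolding weight_def by (rule prod.mono_neutral_left) (auto simp: in_keys_iff)

lemma weight_nonneg: "(\<And>v. 0 \<le> x v) \<Longrightarrow> 0 \<le> weight x \<mu>"
  unfolding weight_def by (intro prod_nonneg) auto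

lemma summable_on_powers:
  assumes "0 \<le> x" "x < (1 :: real)"
  shows "(\<lambda>n. x ^ n) summable_on S"
proof -
  have "(\<lambda>n. x ^ n) summable_on {0} \<union> {1..}"
  proof (rule summable_on_union)
    show "(\<lambda>n. x ^ n) summable_on {1..}"
      unfolding summable_on_def using has_sum_geometric_from_1[of x] assms by auto
  qed simp
  then show ?thesis by (rule summable_on_subset) auto
qed

text \<open>The factor \<open>1 / (1 - x)\<close> is kept apart so that it can be folded into the
  abbreviation \<open>c v\<close> for the geometric series of a variable.\<close>

lemma pow_sum_simps:
  assumes "0 \<le> x" "x < 1"
  shows "pow_sum x {0} = 1" "pow_sum x {1} = x" "pow_sum x {0, 1} = 1 + x"
    "pow_sum x {1..} = x * (1 / (1 - x))" "pow_sum x UNIV = 1 / (1 - x)"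
    "pow_sum x {..<n} = (1 - x ^ n) * (1 / (1 - x))" "pow_sum x {..n} = (1 - x ^ n * x) * (1 / (1 - x))"
proof -
  show "pow_sum x {0} = 1" "pow_sum x {1} = x" "pow_sum x {0, 1} = 1 + x"
    by (simp_all add: pow_sum_def)
  have h: "((\<lambda>n. x ^ n) has_sum (x / (1 - x))) {1..}"
    using assms by (intro has_sum_geometric_from_1) auto
  then show 1: "pow_sum x {1..} = x * (1 / (1 - x))"
    by (simp add: pow_sum_def infsumI)
  have "((\<lambda>n. x ^ n) has_sum (1 + x / (1 - x))) ({0} \<union> {1..})"
    by (rule has_sum_Un_disjoint[OF _ h]) (auto intro: has_sum_finiteI)
  moreover have "{0} \<union> {1..} = (UNIV :: nat set)" by auto
  ultimately show "pow_sum x UNIV = 1 / (1 - x)"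
    using assms by (simp add: pow_sum_def infsumI field_simps)
  show "pow_sum x {..<n} = (1 - x ^ n) * (1 / (1 - x))"
    using assms by (simp add: pow_sum_def sum_gp_strict)
  show "pow_sum x {..n} = (1 - x ^ n * x) * (1 / (1 - x))"
    using assms by (simp add: pow_sum_def sum_gp0 mult.commute)
qed

lemma box_insert:
  assumes "v \<notin> A"
  shows "box (insert v A) S = (\<lambda>(n, \<mu>). sgl v n + \<mu>) ` (S v \<times> box A S)"
    and "inj_on (\<lambda>(n, \<mu>). sgl v n + \<mu>) (S v \<times> box A S)"
proof -
  have z: "lk \<mu> v = 0" if "\<mu> \<in> box A S" for \<mu>
    using that assms by (auto simp: box_def Mon_def in_keys_iff)
  show "inj_on (\<lambda>(n, \<mu>). sgl v n + \<mu>) (S v \<times> box A S)"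
  proof (rule inj_onI, clarify)
    fix n \<mu> n' \<mu>' assume *: "\<mu> \<in> box A S" "\<mu>' \<in> box A S" "sgl v n + \<mu> = sgl v n' + \<mu>'"
    from arg_cong[OF *(3), of "\<lambda>\<mu>. lk \<mu> v"] have "n = n'"
      using z[OF *(1)] z[OF *(2)] by (simp add: lookup_add)
    with * show "n = n' \<and> \<mu> = \<mu>'" by simp
  qed
  show "box (insert v A) S = (\<lambda>(n, \<mu>). sgl v n + \<mu>) ` (S v \<times> box A S)" (is "?l = ?r")
  proof (intro equalityI subsetI)
    fix \<mu> assume \<mu>: "\<mu> \<in> ?l"
    let ?\<mu> = "\<mu> - sgl v (lk \<mu> v)"
    have "?\<mu> \<in> box A S"
      using \<mu> assms
      by (auto simp: box_def Mon_def in_keys_iff subset_iff lookup_minus lookup_single when_def split: if_splits)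
    moreover have "lk \<mu> v \<in> S v" using \<mu> by (simp add: box_def)
    moreover have "\<mu> = (\<lambda>(n, \<mu>). sgl v n + \<mu>) (lk \<mu> v, ?\<mu>)"
      by (rule poly_mapping_eqI) (simp add: lookup_add lookup_minus lookup_single when_def)
    ultimately show "\<mu> \<in> ?r" by (intro image_eqI[where x = "(lk \<mu> v, ?\<mu>)"]) simp_all
  next
    fix \<mu> assume "\<mu> \<in> ?r"
    then obtain n \<nu> where \<nu>: "\<mu> = sgl v n + \<nu>" "n \<in> S v" "\<nu> \<in> box A S" by auto
    then show "\<mu> \<in> ?l" using z[OF \<nu>(3)] assms
      by (auto simp: box_def Mon_def in_keys_iff subset_iff lookup_add lookup_single when_def split: if_splits)
  qed
qed

text \<open>A box splits off one variable as a direct product. The terms are nonnegative, so the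
  iterated sums give joint summability.\<close>

lemma box_has_sum:
  assumes "finite A" "\<And>v. v \<in> A \<Longrightarrow> 0 \<le> x v \<and> x v < 1"
  shows "(weight x has_sum (\<Prod>v\<in>A. pow_sum (x v) (S v))) (box A S)"
  using assms
proof (induction A rule: finite_induct)
  case empty
  have "box {} S = {0}" by (auto simp: box_def Mon_def)
  then show ?case by (simp add: weight_def has_sum_finiteI)
next
  case (insert v A)
  let ?P = "\<Prod>v\<in>A. pow_sum (x v) (S v)"
  have x: "0 \<le> x v" "x v < 1" using insert.prems by auto
  have w: "weight x (sgl v n + \<mu>) = x v ^ n * weight x \<mu>" if "\<mu> \<in> box A S" for n \<mu>
  proof -
    have k: "kys \<mu> \<subseteq> A" using that by (auto simp: box_def Mon_def)
    then have "lk \<mu> v = 0" using insert.hyps by (auto simp: in_keys_iff)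
    moreover have "weight x (sgl v n + \<mu>) = (\<Prod>u\<in>insert v A. x u ^ lk (sgl v n + \<mu>) u)"
      using k keys_add[of "sgl v n" \<mu>] insert.hyps by (intro weight_superset) (auto split: if_splits)
    moreover have "(\<Prod>u\<in>A. x u ^ lk (sgl v n + \<mu>) u) = (\<Prod>u\<in>A. x u ^ lk \<mu> u)"
      using insert.hyps by (intro prod.cong) (auto simp: lookup_add lookup_single when_def)
    ultimately show ?thesis
      using insert.hyps k by (simp add: lookup_add weight_superset[of A \<mu>])
  qed
  have IH: "(weight x has_sum ?P) (box A S)" using insert by auto
  have inner: "((\<lambda>\<mu>. weight x (sgl v n + \<mu>)) has_sum x v ^ n * ?P) (box A S)" for n
    using has_sum_cmult_right[OF IH, of "x v ^ n"] by (simp add: w cong: has_sum_cong)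
  have pw: "((\<lambda>n. x v ^ n) has_sum pow_sum (x v) (S v)) (S v)"
    unfolding pow_sum_def by (rule has_sum_infsum, rule summable_on_powers) (use x in auto)
  have outer: "((\<lambda>n. x v ^ n * ?P) has_sum pow_sum (x v) (S v) * ?P) (S v)"
    by (rule has_sum_cmult_left[OF pw])
  have nn: "0 \<le> weight x (sgl v n + \<mu>)" if "\<mu> \<in> box A S" for n \<mu>
  proof -
    have "kys \<mu> \<subseteq> A" using that by (auto simp: box_def Mon_def)
    then have "0 \<le> weight x \<mu>" unfolding weight_def using insert.prems by (intro prod_nonneg) auto
    then show ?thesis using w[OF that] x by simp
  qed
  have "((\<lambda>(n, \<mu>). weight x (sgl v n + \<mu>)) has_sum pow_sum (x v) (S v) * ?P) (S v \<times> box A S)"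
  proof (rule has_sum_SigmaI)
    show "(\<lambda>(n, \<mu>). weight x (sgl v n + \<mu>)) summable_on S v \<times> box A S"
      by (rule summable_on_SigmaI[where g = "\<lambda>n. x v ^ n * ?P"]) (use inner outer nn in \<open>auto simp: summable_on_def\<close>)
  qed (use inner outer in auto)
  then have "(weight x has_sum pow_sum (x v) (S v) * ?P) ((\<lambda>(n, \<mu>). sgl v n + \<mu>) ` (S v \<times> box A S))"
    by (subst has_sum_reindex[OF box_insert(2)[OF insert.hyps(2)]]) (simp add: comp_def case_prod_unfold)
  then show ?case using insert.hyps by (simp add: box_insert(1))
qed

text \<open>Boxes are peeled off one at a time; an overlap only makes the right-hand side
  larger.\<close>

lemma sum_weight_le_boxes:
  assumes x: "\<And>v. 0 \<le> x v \<and> x v < 1" and ps: "\<And>A S. (A, S) \<in> set ps \<Longrightarrow> finite A"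
  shows "finite F \<Longrightarrow> F \<subseteq> (\<Union>(A, S)\<in>set ps. box A S) \<Longrightarrow>
    sum (weight x) F \<le> (\<Sum>(A, S)\<leftarrow>ps. \<Prod>v\<in>A. pow_sum (x v) (S v))"
  using ps
proof (induction ps arbitrary: F)
  case Nil
  then show ?case by simp
next
  case (Cons p ps)
  obtain A S where p: "p = (A, S)" by force
  have "sum (weight x) F = sum (weight x) (F \<inter> box A S) + sum (weight x) (F - box A S)"
    using Cons.prems(1) by (simp add: sum.Int_Diff)
  moreover have "sum (weight x) (F \<inter> box A S) \<le> (\<Prod>v\<in>A. pow_sum (x v) (S v))"
    by (rule finite_sum_le_has_sum[OF box_has_sum]) (use Cons.prems p x weight_nonneg in auto)
  moreover have "sum (weight x) (F - box A S) \<le> (\<Sum>(A, S)\<leftarrow>ps. \<Prod>v\<in>A. pow_sum (x v) (S v))"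
    by (rule Cons.IH) (use Cons.prems p in auto)
  ultimately show ?case by (simp add: p)
qed

section \<open>Evaluation at powers of one half\<close>

context curve begin

definition expo :: "var \<Rightarrow> nat" where
  "expo v = total_deg b (sgl v 1) + omega m0 d a b (sgl v 1)"

text \<open>Outside V both degrees vanish and the power would be 1; the value 0 keeps every value
  below 1.\<close>

definition x :: "var \<Rightarrow> real" where
  "x v = (if v \<in> V then (1 / 2) ^ expo v else 0)"

lemma x_bounds: "0 \<le> x v \<and> x v < 1"
proof (cases "v \<in> V")
  case True
  then have "lk (sgl v 1) v \<le> expo v" unfolding expo_def by (intro lookup_le_deg) (auto simp: Mon_def)
  then show ?thesis using True power_strict_decreasing[of 0 "expo v" "1 / 2 :: real"] by (simp add: x_def)
qed (simp add: x_def)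

text \<open>The weight depends on the bidegree alone, so a map that preserves bidegrees preserves
  weights.\<close>

lemma weight_x:
  assumes "\<mu> \<in> Mon V"
  shows "weight x \<mu> = (1 / 2) ^ (total_deg b \<mu> + omega m0 d a b \<mu>)"
proof -
  define D where "D \<mu> = total_deg b \<mu> + omega m0 d a b \<mu>" for \<mu>
  have D_add: "D (\<mu> + \<nu>) = D \<mu> + D \<nu>" for \<mu> \<nu> by (simp add: D_def total_deg_add omega_add)
  have D_0: "D 0 = 0" using D_add[of 0 0] by simp
  have D_single: "D (sgl v n) = n * expo v" for v n
  proof (induction n)
    case (Suc n)
    have "D (sgl v (Suc n)) = D (sgl v 1) + D (sgl v n)" by (simp flip: D_add single_add)
    then show ?case using Suc by (simp add: D_def expo_def)
  qed (simp add: D_0)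
  have D_sum: "D (\<Sum>v\<in>A. sgl v (k v)) = (\<Sum>v\<in>A. k v * expo v)" if "finite A" for A k
    using that by (induction A rule: finite_induct) (simp_all add: D_0 D_add D_single)
  have "weight x \<mu> = (\<Prod>v\<in>kys \<mu>. (1 / 2) ^ (lk \<mu> v * expo v))"
    unfolding weight_def using assms
    by (intro prod.cong) (auto simp: x_def Mon_def mult.commute simp flip: power_mult)
  also have "\<dots> = (1 / 2) ^ (\<Sum>v\<in>kys \<mu>. lk \<mu> v * expo v)" by (simp add: power_sum)
  also have "(\<Sum>v\<in>kys \<mu>. lk \<mu> v * expo v) = D \<mu>"
    using D_sum[of "kys \<mu>" "lk \<mu>"] by (simp flip: poly_mapping_eq_sum_single)
  finally show ?thesis by (simp add: D_def)
qed

text \<open>A finite part of \<open>Mon B\<close> comes closer to the total weight than the weight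
  of \<open>\<mu>0\<close>. Its image under h together with \<open>\<mu>0\<close> would then weigh
  more than all boxes that cover it.\<close>

lemma no_injection:
  assumes St: "St \<subseteq> Mon V" "St \<subseteq> (\<Union>(A, S)\<in>set ps. box A S)"
    and ps: "\<And>A S. (A, S) \<in> set ps \<Longrightarrow> finite A"
    and le: "(\<Sum>(A, S)\<leftarrow>ps. \<Prod>v\<in>A. pow_sum (x v) (S v)) \<le> (\<Prod>v\<in>B. pow_sum (x v) UNIV)"
    and h: "\<mu>0 \<in> St" "inj_on h (Mon B)" "h ` Mon B \<subseteq> St - {\<mu>0}" "\<And>\<kappa>. \<kappa> \<in> Mon B \<Longrightarrow> deg (h \<kappa>) = deg \<kappa>"
  shows False
proof -
  let ?Z = "\<Prod>v\<in>B. pow_sum (x v) UNIV"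
  have B: "box B (\<lambda>_. UNIV) = Mon B" by (simp add: box_def)
  have BV: "Mon B \<subseteq> Mon V" unfolding Mon_def B_explicit V_explicit by auto
  have hs: "(weight x has_sum ?Z) (Mon B)"
    using box_has_sum[of B x "\<lambda>_. UNIV"] x_bounds unfolding B by (simp add: B_explicit)
  have "0 < weight x \<mu>0" using weight_x h(1) St by (auto simp: subset_iff)
  \<comment> \<open>The weight of \<open>\<mu>0\<close> is the gap to be beaten; half of it gives
    the strict inequality.\<close>
  then obtain E where E: "finite E" "E \<subseteq> Mon B" "dist (sum (weight x) E) ?Z < weight x \<mu>0"
    using has_sum_finite_approximation[OF hs, of "weight x \<mu>0 / 2"] by force
  have inj: "inj_on h E" using h(2) E(2) by (rule inj_on_subset)
  have hE: "h ` E \<subseteq> St - {\<mu>0}" using h(3) E(2) by blast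
  have "weight x (h \<kappa>) = weight x \<kappa>" if "\<kappa> \<in> E" for \<kappa>
  proof -
    have "h \<kappa> \<in> Mon V" "\<kappa> \<in> Mon V" using that hE St(1) E(2) BV by blast+
    then show ?thesis using h(4)[of \<kappa>] that E(2) by (auto simp: weight_x deg_def)
  qed
  then have "sum (weight x) (h ` E) = sum (weight x) E"
    by (simp add: sum.reindex[OF inj])
  moreover have "sum (weight x) (insert \<mu>0 (h ` E)) = weight x \<mu>0 + sum (weight x) (h ` E)"
    using E hE by (subst sum.insert) auto
  moreover have "sum (weight x) (insert \<mu>0 (h ` E)) \<le> (\<Sum>(A, S)\<leftarrow>ps. \<Prod>v\<in>A. pow_sum (x v) (S v))"
  proof (rule sum_weight_le_boxes[OF x_bounds ps])
    show "insert \<mu>0 (h ` E) \<subseteq> (\<Union>(A, S)\<in>set ps. box A S)" using St(2) h(1) hE by blast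
  qed (use E in auto)
  ultimately show False using le E(3) by (auto simp: dist_real_def)
qed

end

section \<open>Comparing the Hilbert series\<close>

text \<open>Here \<open>T\<close>, \<open>y0, y1, y2\<close>, \<open>F1, F2, F3\<close> and \<open>R\<close> are the weights of \<open>t\<close>, of \<open>X\<^sub>0, X\<^sub>1, X\<^sub>2\<close>, of
  \<open>\<Phi>(2,2), \<Phi>(1,2), \<Phi>(1,1)\<close> and of \<open>\<Psi>(b,3-b)\<close>, and \<open>c3\<close> is the geometric series of \<open>X\<^sub>3\<close>. The standard monomials
  divisible by \<open>t\<close> or by some \<open>\<Psi>(b,j)\<close> with \<open>j < 3 - b\<close> contribute \<open>E e2 S\<close>; this is the only place where
  the three values of \<open>b\<close> differ, and \<open>S\<close> turns out to be given by the same formula for each.\<close>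

lemma hilbert_series_identity:
  fixes T y0 y1 y2 c0 c1 c2 c3 \<tau> r E e1 e2 F1 F2 F3 R S :: real
  assumes inv: "\<tau> * (1 - T) = 1" "c0 * (1 - y0) = 1" "c1 * (1 - y1) = 1" "c2 * (1 - y2) = 1"
      "r * (1 - R) = 1" "e1 * (1 - F1) = 1" "e2 * (1 - F2) = 1" "E * (1 - F3) = 1"
    and F: "F1 = T * y2^2" "F2 = T * y1 * y2" "F3 = T * y1^2" and y: "y1^2 = y0 * y2"
    and S: "S = \<tau> * r * c3 * (T - R) * (F1 * e1 * (1 + y2) + c0 * (1 + y1 + y2))"
  shows "E * (e2 * (c2 * c3 * F1 * e1 + (1 + y1) * F2 * c2 * c3 * c0
      + R * r * c3 * (F1 * e1 * (1 + y2) + c0 * (1 + y1 + y2)) + S) + c0 * c1 * c2 * c3) = \<tau> * c0 * c1 * c2 * c3"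
proof -
  let ?Y = "F1 * e1 * (1 + y2) + c0 * (1 + y1 + y2)"
  \<comment> \<open>Q is the series of K[t,X]. Each summand is written as a multiple of Q by
    restoring its missing denominators.\<close>
  define Q where "Q = \<tau> * c0 * c1 * c2 * c3"
  \<comment> \<open>Powers of \<Psi>(b,3-b) and S together amount to the positive powers of t: r (R
    + \<tau> (T - R)) = \<tau> T.\<close>
  have "R * r * c3 * ?Y + S = c3 * ?Y * r * (R * (\<tau> * (1 - T)) + \<tau> * (T - R))"
    unfolding S inv(1) by (simp add: algebra_simps)
  also have "\<dots> = c3 * ?Y * \<tau> * T * (r * (1 - R))"
    by (simp add: algebra_simps)
  finally have 1: "R * r * c3 * ?Y + S = c3 * \<tau> * T * ?Y"
    by (simp add: inv mult_ac)
  have a: "c2 * c3 * F1 * e1 = Q * F1 * e1 * (1 - T) * (1 - y0) * (1 - y1)"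
  proof -
    have "Q * F1 * e1 * (1 - T) * (1 - y0) * (1 - y1) = c2 * c3 * F1 * e1 * (\<tau> * (1 - T)) * (c0 * (1 - y0)) * (c1 * (1 - y1))"
      by (simp only: Q_def mult_ac)
    then show ?thesis by (simp only: inv mult_1_right)
  qed
  have b: "(1 + y1) * F2 * c2 * c3 * c0 = Q * F2 * (1 - T) * (1 - y1) * (1 + y1)"
  proof -
    have "Q * F2 * (1 - T) * (1 - y1) * (1 + y1) = (1 + y1) * F2 * c2 * c3 * c0 * (\<tau> * (1 - T)) * (c1 * (1 - y1))"
      by (simp only: Q_def mult_ac)
    then show ?thesis by (simp only: inv mult_1_right)
  qed
  have c: "c3 * \<tau> * T * (F1 * e1 * (1 + y2)) = Q * F1 * e1 * T * (1 - y2) * (1 + y2) * (1 - y0) * (1 - y1)"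
  proof -
    have "Q * F1 * e1 * T * (1 - y2) * (1 + y2) * (1 - y0) * (1 - y1)
        = c3 * \<tau> * T * (F1 * e1 * (1 + y2)) * (c0 * (1 - y0)) * (c1 * (1 - y1)) * (c2 * (1 - y2))"
      by (simp only: Q_def mult_ac)
    then show ?thesis by (simp only: inv mult_1_right)
  qed
  have d: "c3 * \<tau> * T * (c0 * (1 + y1 + y2)) = Q * T * (1 - y1) * (1 - y2) * (1 + y1 + y2)"
  proof -
    have "Q * T * (1 - y1) * (1 - y2) * (1 + y1 + y2)
        = c3 * \<tau> * T * (c0 * (1 + y1 + y2)) * (c1 * (1 - y1)) * (c2 * (1 - y2))"
      by (simp only: Q_def mult_ac)
    then show ?thesis by (simp only: inv mult_1_right)
  qed
  have e: "c0 * c1 * c2 * c3 = e2 * (Q * (1 - T) * (1 - F2))"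
  proof -
    have "e2 * (Q * (1 - T) * (1 - F2)) = c0 * c1 * c2 * c3 * (e2 * (1 - F2)) * (\<tau> * (1 - T))"
      by (simp only: Q_def mult_ac)
    then show ?thesis by (simp only: inv mult_1_right)
  qed
  have f: "Q * F1 * e1 * (1 - T) * (1 - y0) * (1 - y1) + Q * F1 * e1 * T * (1 - y2) * (1 + y2) * (1 - y0) * (1 - y1)
      = Q * F1 * (1 - y0) * (1 - y1)"
  proof -
    have "Q * F1 * e1 * (1 - T) * (1 - y0) * (1 - y1) + Q * F1 * e1 * T * (1 - y2) * (1 + y2) * (1 - y0) * (1 - y1)
        = Q * F1 * (1 - y0) * (1 - y1) * (e1 * ((1 - T) + T * (1 - y2) * (1 + y2)))"
      by (simp add: algebra_simps)
    also have "(1 - T) + T * (1 - y2) * (1 + y2) = 1 - F1"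
      by (simp add: F algebra_simps power2_eq_square)
    finally show ?thesis by (simp add: inv)
  qed
  have g: "F1 * (1 - y0) * (1 - y1) + F2 * (1 - T) * (1 - y1) * (1 + y1) + T * (1 - y1) * (1 - y2) * (1 + y1 + y2)
      + (1 - T) * (1 - F2) = (1 - F2) * (1 - F3)"
  proof -
    \<comment> \<open>Here the equality of the weights of X_1^2 and X_0 X_2 enters.\<close>
    have "F1 * (1 - y0) * (1 - y1) = T * y2 * (y2 - y0 * y2) * (1 - y1)"
      by (simp add: F algebra_simps power2_eq_square)
    also have "\<dots> = T * y2 * (y2 - y1^2) * (1 - y1)" by (simp add: y)
    finally show ?thesis by (simp add: F algebra_simps power2_eq_square)
  qed
  have "E * (e2 * (c2 * c3 * F1 * e1 + (1 + y1) * F2 * c2 * c3 * c0 + R * r * c3 * ?Y + S) + c0 * c1 * c2 * c3)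
     = E * (e2 * (c2 * c3 * F1 * e1 + (1 + y1) * F2 * c2 * c3 * c0 + (R * r * c3 * ?Y + S)) + c0 * c1 * c2 * c3)"
    by (simp only: add.assoc)
  also have "\<dots> = E * (e2 * (c2 * c3 * F1 * e1 + (1 + y1) * F2 * c2 * c3 * c0
      + (c3 * \<tau> * T * (F1 * e1 * (1 + y2)) + c3 * \<tau> * T * (c0 * (1 + y1 + y2)))) + c0 * c1 * c2 * c3)"
    unfolding 1 by (simp only: distrib_left)
  also have "\<dots> = E * (e2 * ((Q * F1 * e1 * (1 - T) * (1 - y0) * (1 - y1) + Q * F1 * e1 * T * (1 - y2) * (1 + y2) * (1 - y0) * (1 - y1))
      + Q * F2 * (1 - T) * (1 - y1) * (1 + y1) + Q * T * (1 - y1) * (1 - y2) * (1 + y1 + y2) + Q * (1 - T) * (1 - F2)))"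
    unfolding a b c d e by (simp only: distrib_left add_ac)
  also have "\<dots> = E * e2 * Q * (F1 * (1 - y0) * (1 - y1) + F2 * (1 - T) * (1 - y1) * (1 + y1)
      + T * (1 - y1) * (1 - y2) * (1 + y1 + y2) + (1 - T) * (1 - F2))"
    unfolding f by (simp only: distrib_left mult_ac)
  also have "\<dots> = (E * (1 - F3)) * (e2 * (1 - F2)) * Q"
    unfolding g by (simp only: mult_ac)
  finally show ?thesis by (simp add: inv Q_def)
qed

text \<open>These boxes contain the standard monomials without \<open>\<Psi>(b,j)\<close>, \<open>j < l = 3 - b\<close>. The sets \<open>N1\<close> and \<open>N2\<close>
  are the exponents that \<open>X\<^sub>3\<close> may have next to \<open>t X\<^sub>1\<close> and \<open>t X\<^sub>2\<close>, respectively.\<close>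

definition common_boxes :: "nat \<Rightarrow> nat \<Rightarrow> nat set \<Rightarrow> nat set \<Rightarrow> (var set \<times> (var \<Rightarrow> nat set)) list" where
  "common_boxes l a N1 N2 = (let A = {Tv, Phi22, Phi12, Phi11, Xv 0, Xv 1, Xv 2, Xv 3, PsiVar l};
       S = (\<lambda>_. {0})(Phi12 := UNIV, Phi11 := UNIV) in map (Pair A)
    [S(Phi22 := {1..}, Xv 2 := UNIV, Xv 3 := UNIV),
     S(Phi12 := {1..}, Xv 1 := {0, 1}, Xv 2 := UNIV, Xv 3 := UNIV, Xv 0 := UNIV),
     S(Phi12 := {0}, Xv 1 := UNIV, Xv 2 := UNIV, Xv 3 := UNIV, Xv 0 := UNIV),
     S(Phi22 := {1..}, PsiVar l := {1..}, Xv 2 := {0, 1}, Xv 3 := UNIV),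
     S(PsiVar l := {1..}, Xv 2 := {0, 1}, Xv 3 := UNIV, Xv 0 := UNIV),
     S(PsiVar l := {1..}, Xv 1 := {1}, Xv 3 := UNIV, Xv 0 := UNIV),
     S(Phi22 := {1..}, Tv := {1..}, PsiVar l := UNIV, Xv 3 := {..a}),
     S(Phi22 := {1..}, Tv := {1..}, PsiVar l := UNIV, Xv 2 := {1}, Xv 3 := N2),
     S(Tv := {1..}, PsiVar l := UNIV, Xv 0 := UNIV, Xv 3 := {..a}),
     S(Tv := {1..}, PsiVar l := UNIV, Xv 0 := UNIV, Xv 2 := {1}, Xv 3 := N2),
     S(Tv := {1..}, PsiVar l := UNIV, Xv 0 := UNIV, Xv 1 := {1}, Xv 3 := N1)])"

text \<open>The assumptions on exponents express, in this order, non-divisibility by the leading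
  monomials of P, of the P(\<Psi>) (three conditions), of L, of D and of B.\<close>

lemma common_boxes_cover:
  assumes \<mu>: "kys \<mu> \<subseteq> {Tv, Phi22, Phi12, Phi11, Xv 0, Xv 1, Xv 2, Xv 3, PsiVar l}"
    and "lk \<mu> Tv \<ge> 1 \<Longrightarrow> lk \<mu> (Xv 1) + lk \<mu> (Xv 2) \<le> 1"
    and "lk \<mu> Tv \<ge> 1 \<Longrightarrow> lk \<mu> (Xv 3) \<le> a"
    and "lk \<mu> Tv \<ge> 1 \<Longrightarrow> lk \<mu> (Xv 1) \<ge> 1 \<Longrightarrow> lk \<mu> (Xv 3) \<in> N1"
    and "lk \<mu> Tv \<ge> 1 \<Longrightarrow> lk \<mu> (Xv 2) \<ge> 1 \<Longrightarrow> lk \<mu> (Xv 3) \<in> N2"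
    and "lk \<mu> Phi22 \<ge> 1 \<Longrightarrow> lk \<mu> (Xv 0) = 0 \<and> lk \<mu> (Xv 1) = 0"
    and "lk \<mu> Phi12 \<ge> 1 \<Longrightarrow> lk \<mu> (Xv 1) \<le> 1"
    and "lk \<mu> (PsiVar l) \<ge> 1 \<Longrightarrow> lk \<mu> (Xv 1) + lk \<mu> (Xv 2) \<le> 1"
  shows "\<mu> \<in> (\<Union>(A, S)\<in>set (common_boxes l a N1 N2). box A S)"
proof -
  have le1: "i + j \<le> 1 \<longleftrightarrow> i = 0 \<and> j = 0 \<or> i = 1 \<and> j = 0 \<or> i = 0 \<and> j = 1" for i j :: nat by auto
  note * = assms(2-)[unfolded le1]
  have **: "n \<in> {1..} \<longleftrightarrow> n \<noteq> 0" for n :: nat by auto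
  show ?thesis
    unfolding common_boxes_def Let_def box_def using \<mu>
    apply (simp add: Mon_def ** del: atLeast_iff)
    \<comment> \<open>Which of these four exponents vanish determines the candidate boxes; the
      bounds on X_1 and X_2 then select one.\<close>
    apply (cases "lk \<mu> Tv = 0"; cases "lk \<mu> (PsiVar l) = 0"; cases "lk \<mu> Phi22 = 0"; cases "lk \<mu> Phi12 = 0")
    using * apply auto
    done
qed

text \<open>For b = 1, next to \<Psi>(1,0) or \<Psi>(1,1) the A exclude X_1, X_2 and X_3. Q(1,2)
  bounds \<Psi>(1,1) by 1, Q(1,1) separates \<Psi>(1,0) from \<Phi>(2,2), L(0) separates X_0 from
  \<Phi>(2,2), and the M bound X_0 by n = a+d as soon as t occurs.\<close>

definition extra_boxes_1 :: "nat \<Rightarrow> (var set \<times> (var \<Rightarrow> nat set)) list" where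
  "extra_boxes_1 n = (let A = {Tv, Phi22, Phi12, Phi11, Xv 0, PsiVar 0, PsiVar 1, PsiVar 2};
       S = (\<lambda>_. {0})(Phi12 := UNIV, Phi11 := UNIV, PsiVar 2 := UNIV) in map (Pair A)
    [S(PsiVar 0 := {1..}, PsiVar 1 := {0, 1}, Xv 0 := UNIV),
     S(PsiVar 0 := {1..}, PsiVar 1 := {0, 1}, Tv := {1..}, Xv 0 := {..n}),
     S(PsiVar 1 := {1}, Phi22 := {1..}, Tv := UNIV),
     S(PsiVar 1 := {1}, Xv 0 := UNIV),
     S(PsiVar 1 := {1}, Tv := {1..}, Xv 0 := {..n})])"

text \<open>For b = 2 only \<Psi>(2,0) is concerned; Q(2,1) limits its exponent to 1 next to
  \<Phi>(2,2).\<close>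

definition extra_boxes_2 :: "nat \<Rightarrow> (var set \<times> (var \<Rightarrow> nat set)) list" where
  "extra_boxes_2 n = (let A = {Tv, Phi22, Phi12, Phi11, Xv 0, PsiVar 0, PsiVar 1};
       S = (\<lambda>_. {0})(Phi12 := UNIV, Phi11 := UNIV, PsiVar 1 := UNIV) in map (Pair A)
    [S(PsiVar 0 := {1..}, Xv 0 := UNIV),
     S(PsiVar 0 := {1..}, Tv := {1..}, Xv 0 := {..n}),
     S(PsiVar 0 := {1}, Phi22 := {1..}, Tv := UNIV)])"

text \<open>Grouped to match the left-hand side of \<open>hilbert_series_identity\<close>; the sums
  over \<open>N1\<close> and \<open>N2\<close> stay open because they vary with b.\<close>

lemma common_boxes_sum:
  fixes x :: "var \<Rightarrow> real"
  assumes x: "\<And>v. 0 \<le> x v \<and> x v < 1"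
  defines "c v \<equiv> 1 / (1 - x v)"
  shows "(\<Sum>(A, S)\<leftarrow>common_boxes l a N1 N2. \<Prod>v\<in>A. pow_sum (x v) (S v)) =
    c Phi11 * (c Phi12 * (c (Xv 2) * c (Xv 3) * x Phi22 * c Phi22 + (1 + x (Xv 1)) * x Phi12 * c (Xv 2) * c (Xv 3) * c (Xv 0)
      + x (PsiVar l) * c (PsiVar l) * c (Xv 3) * (x Phi22 * c Phi22 * (1 + x (Xv 2)) + c (Xv 0) * (1 + x (Xv 1) + x (Xv 2)))
      + x Tv * c Tv * c (PsiVar l) * (x Phi22 * c Phi22 * (pow_sum (x (Xv 3)) {..a} + x (Xv 2) * pow_sum (x (Xv 3)) N2)
          + c (Xv 0) * (pow_sum (x (Xv 3)) {..a} + x (Xv 2) * pow_sum (x (Xv 3)) N2 + x (Xv 1) * pow_sum (x (Xv 3)) N1)))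
     + c (Xv 0) * c (Xv 1) * c (Xv 2) * c (Xv 3))"
proof -
  have p: "pow_sum (x v) {0} = 1" "pow_sum (x v) {1} = x v" "pow_sum (x v) {0, 1} = 1 + x v"
    "pow_sum (x v) {1..} = x v * c v" "pow_sum (x v) UNIV = c v" for v
    using pow_sum_simps[of "x v"] x[of v] by (simp_all add: c_def)
  show ?thesis
    by (simp add: common_boxes_def Let_def p[simplified]) (simp add: algebra_simps)
qed

text \<open>The quantity \<open>k\<close> is the series of the pairs of exponents of t and X_0 in
  which X_0 is bounded by n unless t is absent.\<close>

lemma extra_boxes_sum:
  fixes x :: "var \<Rightarrow> real" and n :: nat
  assumes x: "\<And>v. 0 \<le> x v \<and> x v < 1"
  defines "c v \<equiv> 1 / (1 - x v)"
  defines "k \<equiv> c (Xv 0) + x Tv * c Tv * pow_sum (x (Xv 0)) {..n}"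
  shows "(\<Sum>(A, S)\<leftarrow>extra_boxes_1 n. \<Prod>v\<in>A. pow_sum (x v) (S v)) =
      c Phi11 * c Phi12 * c (PsiVar 2) * (x (PsiVar 0) * c (PsiVar 0) * (1 + x (PsiVar 1)) * k
         + x (PsiVar 1) * (x Phi22 * c Phi22 * c Tv + k))"
    and "(\<Sum>(A, S)\<leftarrow>extra_boxes_2 n. \<Prod>v\<in>A. pow_sum (x v) (S v)) =
      c Phi11 * c Phi12 * c (PsiVar 1) * (x (PsiVar 0) * c (PsiVar 0) * k + x (PsiVar 0) * x Phi22 * c Phi22 * c Tv)"
proof -
  have p: "pow_sum (x v) {0} = 1" "pow_sum (x v) {1} = x v" "pow_sum (x v) {0, 1} = 1 + x v"
    "pow_sum (x v) {1..} = x v * c v" "pow_sum (x v) UNIV = c v" for v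
    using pow_sum_simps[of "x v"] x[of v] by (simp_all add: c_def)
  show "(\<Sum>(A, S)\<leftarrow>extra_boxes_1 n. \<Prod>v\<in>A. pow_sum (x v) (S v)) =
      c Phi11 * c Phi12 * c (PsiVar 2) * (x (PsiVar 0) * c (PsiVar 0) * (1 + x (PsiVar 1)) * k
         + x (PsiVar 1) * (x Phi22 * c Phi22 * c Tv + k))"
    by (simp add: extra_boxes_1_def Let_def p[simplified] k_def) (simp add: algebra_simps)
  show "(\<Sum>(A, S)\<leftarrow>extra_boxes_2 n. \<Prod>v\<in>A. pow_sum (x v) (S v)) =
      c Phi11 * c Phi12 * c (PsiVar 1) * (x (PsiVar 0) * c (PsiVar 0) * k + x (PsiVar 0) * x Phi22 * c Phi22 * c Tv)"
    by (simp add: extra_boxes_2_def Let_def p[simplified] k_def) (simp add: algebra_simps)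
qed

section \<open>The weights at the chosen point\<close>

context curve begin

lemma expo_simps:
  "expo Tv = 1" "i \<le> 3 \<Longrightarrow> expo (Xv i) = m0 + i * d"
  "expo Phi22 = 1 + 2 * (m0 + 2 * d)" "expo Phi12 = 1 + (2 * m0 + 3 * d)" "expo Phi11 = 1 + 2 * (m0 + d)"
  "l \<le> 3 - b \<Longrightarrow> expo (PsiVar l) = 1 + (a * (m0 + 3 * d) + (m0 + (b + l) * d))"
  by (simp_all add: expo_def total_deg_def omega_def lookup_single when_def if_distrib[of "\<lambda>z. z * _"] cong: if_cong)
     (simp_all add: mm_def nat_int_add algebra_simps)

lemma in_V: "Tv \<in> V" "i \<le> 3 \<Longrightarrow> Xv i \<in> V" "Phi22 \<in> V" "Phi12 \<in> V" "Phi11 \<in> V" "l \<le> 3 - b \<Longrightarrow> PsiVar l \<in> V"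
  by (auto simp: S_vars_def)

text \<open>Numerical form of homogeneity. The fourth relation says 2 m_1 = m_0 + m_2; the last two
  compare \<Psi> with the two terms of t \<psi>, and the last one uses m_0 = 3a+b.\<close>

lemma x_relations:
  "x Phi22 = x Tv * x (Xv 2) ^ 2" "x Phi12 = x Tv * x (Xv 1) * x (Xv 2)" "x Phi11 = x Tv * x (Xv 1) ^ 2"
  "x (Xv 1) ^ 2 = x (Xv 0) * x (Xv 2)"
  "l \<le> 3 - b \<Longrightarrow> x (PsiVar l) = x Tv * x (Xv 3) ^ a * x (Xv (b + l))"
  "x (PsiVar 0) = x Tv * (x (Xv 0) ^ (a + d) * x (Xv 0))"
proof -
  have X: "x (Xv 0) = (1 / 2) ^ m0" "x (Xv 1) = (1 / 2) ^ (m0 + d)" "x (Xv 2) = (1 / 2) ^ (m0 + 2 * d)" "x (Xv 3) = (1 / 2) ^ (m0 + 3 * d)"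
    "x Tv = (1 / 2) ^ 1" using expo_simps(2)[of 0] expo_simps(2)[of 1] expo_simps(2)[of 2] expo_simps(2)[of 3] in_V
    by (simp_all add: x_def expo_simps)
  show "x Phi22 = x Tv * x (Xv 2) ^ 2" "x Phi12 = x Tv * x (Xv 1) * x (Xv 2)" "x Phi11 = x Tv * x (Xv 1) ^ 2"
    "x (Xv 1) ^ 2 = x (Xv 0) * x (Xv 2)"
    unfolding X power_mult[symmetric] power_add[symmetric] using in_V by (simp_all add: x_def expo_simps algebra_simps)
  show P: "x (PsiVar l) = x Tv * x (Xv 3) ^ a * x (Xv (b + l))" if "l \<le> 3 - b" for l
  proof -
    have "b + l \<le> 3" using that b by auto
    then have 1: "x (Xv (b + l)) = (1 / 2) ^ (m0 + (b + l) * d)" using in_V expo_simps(2) by (simp add: x_def)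
    have 2: "x (PsiVar l) = (1 / 2) ^ (1 + (a * (m0 + 3 * d) + (m0 + (b + l) * d)))"
      using that in_V expo_simps(6) by (simp add: x_def)
    show ?thesis
      unfolding 1 2 X power_mult[symmetric] power_add[symmetric]
      by (rule arg_cong[where f = "power _"]) (simp add: algebra_simps)
  qed
  have "x (PsiVar 0) = (1 / 2) ^ (1 + (a * (m0 + 3 * d) + (m0 + b * d)))"
    using in_V(6)[of 0] expo_simps(6)[of 0] by (simp add: x_def)
  also have "1 + (a * (m0 + 3 * d) + (m0 + b * d)) = 1 + (m0 * (a + d) + m0)"
    by (simp add: m0 algebra_simps)
  finally show "x (PsiVar 0) = x Tv * (x (Xv 0) ^ (a + d) * x (Xv 0))"
    unfolding X power_mult[symmetric] power_add[symmetric] by (simp only: mult_1_right)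
qed

definition c :: "var \<Rightarrow> real" where "c v = 1 / (1 - x v)"

lemma c_inverse: "c v * (1 - x v) = 1"
  using x_bounds[of v] by (simp add: c_def)

text \<open>Isolates what depends on b. The right-hand side of the second assumption is the value of
  the t-part for \<open>N1\<close> = \<open>N2\<close> = \<open>{..a}\<close>, so E has to make up
  for the exponents missing from these sets.\<close>

lemma boxes_total:
  assumes ex: "(\<Sum>(A, S)\<leftarrow>ex. \<Prod>v\<in>A. pow_sum (x v) (S v)) = c Phi11 * c Phi12 * E"
    and E: "x Tv * c Tv * c (PsiVar (3 - b)) * (x Phi22 * c Phi22 * (pow_sum (x (Xv 3)) {..a} + x (Xv 2) * pow_sum (x (Xv 3)) N2)
          + c (Xv 0) * (pow_sum (x (Xv 3)) {..a} + x (Xv 2) * pow_sum (x (Xv 3)) N2 + x (Xv 1) * pow_sum (x (Xv 3)) N1)) + E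
      = c Tv * c (PsiVar (3 - b)) * c (Xv 3) * (x Tv - x (PsiVar (3 - b)))
          * (x Phi22 * c Phi22 * (1 + x (Xv 2)) + c (Xv 0) * (1 + x (Xv 1) + x (Xv 2)))"
  shows "(\<Sum>(A, S)\<leftarrow>common_boxes (3 - b) a N1 N2 @ ex. \<Prod>v\<in>A. pow_sum (x v) (S v)) = (\<Prod>v\<in>B. pow_sum (x v) UNIV)"
proof -
  have "(\<Sum>(A, S)\<leftarrow>common_boxes (3 - b) a N1 N2 @ ex. \<Prod>v\<in>A. pow_sum (x v) (S v))
      = c Tv * c (Xv 0) * c (Xv 1) * c (Xv 2) * c (Xv 3)"
    unfolding hilbert_series_identity[OF c_inverse c_inverse c_inverse c_inverse c_inverse c_inverse c_inverse c_inverse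
      x_relations(1-4) E, symmetric]
    by (simp only: map_append sum_list_append common_boxes_sum[OF x_bounds, folded c_def] ex) (simp only: distrib_left mult.assoc add_ac)
  also have "\<dots> = (\<Prod>v\<in>B. pow_sum (x v) UNIV)"
    using pow_sum_simps(5) x_bounds by (simp add: B_explicit c_def)
  finally show ?thesis .
qed

lemma pow_sum_X3:
  "pow_sum (x (Xv 3)) {..<a} = (1 - x (Xv 3) ^ a) * c (Xv 3)"
  "pow_sum (x (Xv 3)) {..a} = (1 - x (Xv 3) ^ a * x (Xv 3)) * c (Xv 3)"
  using pow_sum_simps(6,7)[of "x (Xv 3)" a] x_bounds by (auto simp: c_def)

lemma x_Psi_last: "x (PsiVar (3 - b)) = x Tv * x (Xv 3) ^ a * x (Xv 3)"
proof -
  have "b + (3 - b) = 3" using b by auto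
  then show ?thesis using x_relations(5)[of "3 - b"] by simp
qed

text \<open>These are the monomials in t and X_0 not divisible by t X_0^(a+d+1). That monomial has
  the weight of \<Psi>(b,0), and the resulting factor \<open>1 - x (PsiVar 0)\<close> cancels the
  geometric series of \<Psi>(b,0).\<close>

lemma pow_sum_X0:
  "c (Xv 0) + x Tv * c Tv * pow_sum (x (Xv 0)) {..a + d} = c (Xv 0) * c Tv * (1 - x (PsiVar 0))"
proof -
  have "pow_sum (x (Xv 0)) {..a + d} = (1 - x (Xv 0) ^ (a + d) * x (Xv 0)) * c (Xv 0)"
    using pow_sum_simps(7)[of "x (Xv 0)"] x_bounds by (simp add: c_def)
  then have "c (Xv 0) + x Tv * c Tv * pow_sum (x (Xv 0)) {..a + d}
      = c (Xv 0) * (c Tv * (1 - x Tv)) + x Tv * c Tv * ((1 - x (Xv 0) ^ (a + d) * x (Xv 0)) * c (Xv 0))"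
    by (simp only: c_inverse mult_1_right)
  also have "\<dots> = c (Xv 0) * c Tv * (1 - x Tv * (x (Xv 0) ^ (a + d) * x (Xv 0)))"
    by (simp only: algebra_simps)
  finally show ?thesis by (simp only: x_relations(6))
qed

text \<open>Neither X_1 nor X_2 may carry X_3^a next to t. The deficit consists of multiples of the
  weights of t X_1 X_3^a and t X_2 X_3^a, which are those of \<Psi>(1,0) and \<Psi>(1,1), and equals
  the contribution of the extra boxes.\<close>

lemma total_1:
  assumes "b = Suc 0"
  shows "(\<Sum>(A, S)\<leftarrow>common_boxes (3 - b) a {..<a} {..<a} @ extra_boxes_1 (a + d). \<Prod>v\<in>A. pow_sum (x v) (S v))
    = (\<Prod>v\<in>B. pow_sum (x v) UNIV)"
proof (rule boxes_total)
  have l: "3 - b = 2" using assms by simp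
  \<comment> \<open>What remains of the extra boxes, without the factor
    \<open>c Phi11 * c Phi12\<close>, after \<open>c (PsiVar 0)\<close> has cancelled.\<close>
  define E where "E = c Tv * c (PsiVar 2) * (c (Xv 0) * (x (PsiVar 0) + x (PsiVar 1)) + x (PsiVar 1) * x Phi22 * c Phi22)"
  have "x (PsiVar 0) * c (PsiVar 0) * (1 + x (PsiVar 1)) * (c (Xv 0) * c Tv * (1 - x (PsiVar 0)))
      = (1 + x (PsiVar 1)) * x (PsiVar 0) * (c (Xv 0) * c Tv * (c (PsiVar 0) * (1 - x (PsiVar 0))))"
    by (simp only: mult_ac)
  also have "\<dots> = (1 + x (PsiVar 1)) * x (PsiVar 0) * (c (Xv 0) * c Tv)"
    by (simp only: c_inverse mult_1_right)
  finally have k: "x (PsiVar 0) * c (PsiVar 0) * (1 + x (PsiVar 1)) * (c (Xv 0) * c Tv * (1 - x (PsiVar 0)))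
      = (1 + x (PsiVar 1)) * x (PsiVar 0) * (c (Xv 0) * c Tv)" .
  show "(\<Sum>(A, S)\<leftarrow>extra_boxes_1 (a + d). \<Prod>v\<in>A. pow_sum (x v) (S v)) = c Phi11 * c Phi12 * E"
    unfolding extra_boxes_sum(1)[OF x_bounds, folded c_def] pow_sum_X0 k E_def by (simp only: algebra_simps)
  have R: "x (PsiVar 0) = x Tv * x (Xv 3) ^ a * x (Xv 1)" "x (PsiVar 1) = x Tv * x (Xv 3) ^ a * x (Xv 2)"
    using x_relations(5)[of 0] x_relations(5)[of 1] assms by (simp_all add: numeral_2_eq_2)
  let ?G = "x Tv * c Tv * c (PsiVar (3 - b)) * (x Phi22 * c Phi22 * (pow_sum (x (Xv 3)) {..a} + x (Xv 2) * pow_sum (x (Xv 3)) {..<a})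
          + c (Xv 0) * (pow_sum (x (Xv 3)) {..a} + x (Xv 2) * pow_sum (x (Xv 3)) {..<a} + x (Xv 1) * pow_sum (x (Xv 3)) {..<a}))"
  \<comment> \<open>The inserted factor is 1; it gives E the same denominator in X_3 as the other
    terms, so that expansion alone proves the identity.\<close>
  have "?G + E * (c (Xv 3) * (1 - x (Xv 3))) = c Tv * c (PsiVar (3 - b)) * c (Xv 3) * (x Tv - x (PsiVar (3 - b)))
          * (x Phi22 * c Phi22 * (1 + x (Xv 2)) + c (Xv 0) * (1 + x (Xv 1) + x (Xv 2)))"
    unfolding E_def R pow_sum_X3 l x_Psi_last[unfolded l] by (simp add: algebra_simps)
  then show "?G + E = c Tv * c (PsiVar (3 - b)) * c (Xv 3) * (x Tv - x (PsiVar (3 - b)))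
          * (x Phi22 * c Phi22 * (1 + x (Xv 2)) + c (Xv 0) * (1 + x (Xv 1) + x (Xv 2)))"
    by (simp only: c_inverse mult_1_right)
qed

lemma total_2:
  assumes "b = 2"
  shows "(\<Sum>(A, S)\<leftarrow>common_boxes (3 - b) a {..a} {..<a} @ extra_boxes_2 (a + d). \<Prod>v\<in>A. pow_sum (x v) (S v))
    = (\<Prod>v\<in>B. pow_sum (x v) UNIV)"
proof (rule boxes_total)
  have l: "3 - b = 1" using assms by simp
  define E where "E = c Tv * c (PsiVar 1) * x (PsiVar 0) * (c (Xv 0) + x Phi22 * c Phi22)"
  have "x (PsiVar 0) * c (PsiVar 0) * (c (Xv 0) * c Tv * (1 - x (PsiVar 0)))
      = x (PsiVar 0) * (c (Xv 0) * c Tv * (c (PsiVar 0) * (1 - x (PsiVar 0))))"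
    by (simp only: mult_ac)
  also have "\<dots> = x (PsiVar 0) * (c (Xv 0) * c Tv)"
    by (simp only: c_inverse mult_1_right)
  finally have k: "x (PsiVar 0) * c (PsiVar 0) * (c (Xv 0) * c Tv * (1 - x (PsiVar 0)))
      = x (PsiVar 0) * (c (Xv 0) * c Tv)" .
  show "(\<Sum>(A, S)\<leftarrow>extra_boxes_2 (a + d). \<Prod>v\<in>A. pow_sum (x v) (S v)) = c Phi11 * c Phi12 * E"
    unfolding extra_boxes_sum(2)[OF x_bounds, folded c_def] pow_sum_X0 k E_def by (simp only: algebra_simps)
  have R: "x (PsiVar 0) = x Tv * x (Xv 3) ^ a * x (Xv 2)"
    using x_relations(5)[of 0] assms by simp
  let ?G = "x Tv * c Tv * c (PsiVar (3 - b)) * (x Phi22 * c Phi22 * (pow_sum (x (Xv 3)) {..a} + x (Xv 2) * pow_sum (x (Xv 3)) {..<a})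
          + c (Xv 0) * (pow_sum (x (Xv 3)) {..a} + x (Xv 2) * pow_sum (x (Xv 3)) {..<a} + x (Xv 1) * pow_sum (x (Xv 3)) {..a}))"
  have "?G + E * (c (Xv 3) * (1 - x (Xv 3))) = c Tv * c (PsiVar (3 - b)) * c (Xv 3) * (x Tv - x (PsiVar (3 - b)))
          * (x Phi22 * c Phi22 * (1 + x (Xv 2)) + c (Xv 0) * (1 + x (Xv 1) + x (Xv 2)))"
    unfolding E_def R pow_sum_X3 l x_Psi_last[unfolded l] by (simp add: algebra_simps)
  then show "?G + E = c Tv * c (PsiVar (3 - b)) * c (Xv 3) * (x Tv - x (PsiVar (3 - b)))
          * (x Phi22 * c Phi22 * (1 + x (Xv 2)) + c (Xv 0) * (1 + x (Xv 1) + x (Xv 2)))"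
    by (simp only: c_inverse mult_1_right)
qed

text \<open>For b = 3 the P(\<Psi>) excludes only t X_3^(a+1), both sets are \<open>{..a}\<close>,
  and there is no deficit to make up.\<close>

lemma total_3:
  shows "(\<Sum>(A, S)\<leftarrow>common_boxes (3 - b) a {..a} {..a} @ []. \<Prod>v\<in>A. pow_sum (x v) (S v)) = (\<Prod>v\<in>B. pow_sum (x v) UNIV)"
  by (rule boxes_total[where E = 0]) (simp_all add: pow_sum_X3 x_Psi_last algebra_simps)

end

section \<open>Standard monomials lie in the boxes\<close>

lemma std_cover_1:
  assumes cu: "curve m0 (Suc c) (Suc 0)" and \<mu>: "\<mu> \<in> curve.std m0 d (Suc c) (Suc 0) TYPE('k::field)"
  shows "\<mu> \<in> (\<Union>(A, S)\<in>set (common_boxes 2 (Suc c) {..<Suc c} {..<Suc c} @ extra_boxes_1 (Suc c + d)). box A S)"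
proof -
  interpret curve m0 d "Suc c" "Suc 0" by (rule cu)
  interpret gs: graded_subst V B "gtE m0 d (Suc c) (Suc 0)" deg "\<sigma> :: var \<Rightarrow> 'k mpoly" by (rule graded)
  \<comment> \<open>Non-divisibility conditions in the order of \<open>leads_1\<close>: 1-3 P, 4-6
    P(\<Psi>), 7-8 L, 9 D, 10-12 B, 13-15 A(i;1,0), 16 M(1,0), 17-19 A(i;1,1), 20 M(1,1), 21-22
    Q.\<close>
  note D = leads_1[OF cu, THEN std_not_dvd[OF \<mu>], simplified GB_set_explicit, simplified, unfolded mon_dvd_mon, simplified]
  have V: "kys \<mu> \<subseteq> {Tv, Phi22, Phi12, Phi11, Xv 0, Xv 1, Xv 2, Xv 3, PsiVar 0, PsiVar 1, PsiVar 2}"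
  proof -
    have "kys \<mu> \<subseteq> V" using \<mu> by (auto simp: gs.standard_def Mon_def)
    then show ?thesis using V_explicit by auto
  qed
  show ?thesis
  proof (cases "lk \<mu> (PsiVar 0) = 0 \<and> lk \<mu> (PsiVar 1) = 0")
    case True
    have "v \<in> {Tv, Phi22, Phi12, Phi11, Xv 0, Xv 1, Xv 2, Xv 3, PsiVar 2}" if "v \<in> kys \<mu>" for v
      using subsetD[OF V that] True that by (auto simp: in_keys_iff)
    then have "kys \<mu> \<subseteq> {Tv, Phi22, Phi12, Phi11, Xv 0, Xv 1, Xv 2, Xv 3, PsiVar 2}" by blast
    then have "\<mu> \<in> (\<Union>(A, S)\<in>set (common_boxes 2 (Suc c) {..<Suc c} {..<Suc c}). box A S)"
      by (rule common_boxes_cover) 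
        ((use D(1-3) in auto)[1], (use D(6) in auto)[1], (use D(4) in auto)[1], (use D(5) in auto)[1], (use D(7,8) in auto)[1], (use D(9) in auto)[1], (use D(10-12) in auto)[1])
    then show ?thesis by auto
  next
    case False
    have ge: "n \<in> {1..} \<longleftrightarrow> n \<noteq> 0" for n :: nat by auto
    \<comment> \<open>Some \<Psi>(1,0) or \<Psi>(1,1) occurs, so the A exclude these three
      variables.\<close>
    have z: "lk \<mu> (Xv 1) = 0" "lk \<mu> (Xv 2) = 0" "lk \<mu> (Xv 3) = 0" using False D(13-15,17-19) by auto
    have "v \<in> {Tv, Phi22, Phi12, Phi11, Xv 0, PsiVar 0, PsiVar 1, PsiVar 2}" if "v \<in> kys \<mu>" for v
      using subsetD[OF V that] z that by (auto simp: in_keys_iff)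
    then have "kys \<mu> \<subseteq> {Tv, Phi22, Phi12, Phi11, Xv 0, PsiVar 0, PsiVar 1, PsiVar 2}" by blast
    then have "\<mu> \<in> (\<Union>(A, S)\<in>set (extra_boxes_1 (Suc c + d)). box A S)"
      unfolding extra_boxes_1_def Let_def box_def using False
      apply (simp add: Mon_def ge del: atLeast_iff)
      apply (cases "lk \<mu> Tv = 0"; cases "lk \<mu> (PsiVar 0) = 0"; cases "lk \<mu> Phi22 = 0"; cases "lk \<mu> (PsiVar 1) = 0")
      using D(7,16,20-22) by auto
    then show ?thesis by auto
  qed
qed

lemma std_cover_2:
  assumes cu: "curve m0 (Suc c) 2" and \<mu>: "\<mu> \<in> curve.std m0 d (Suc c) 2 TYPE('k::field)"
  shows "\<mu> \<in> (\<Union>(A, S)\<in>set (common_boxes 1 (Suc c) {..Suc c} {..<Suc c} @ extra_boxes_2 (Suc c + d)). box A S)"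
proof -
  interpret curve m0 d "Suc c" 2 by (rule cu)
  interpret gs: graded_subst V B "gtE m0 d (Suc c) 2" deg "\<sigma> :: var \<Rightarrow> 'k mpoly" by (rule graded)
  \<comment> \<open>Here 1-3 are P, 4-5 P(\<Psi>), 6-7 L, 8 D, 9-11 B, 12-14 A, 15 M and 16
    Q.\<close>
  note D = leads_2[OF cu, THEN std_not_dvd[OF \<mu>], simplified GB_set_explicit, simplified, unfolded mon_dvd_mon, simplified]
  have V: "kys \<mu> \<subseteq> {Tv, Phi22, Phi12, Phi11, Xv 0, Xv 1, Xv 2, Xv 3, PsiVar 0, PsiVar 1}"
  proof -
    have "kys \<mu> \<subseteq> V" using \<mu> by (auto simp: gs.standard_def Mon_def)
    then show ?thesis using V_explicit by auto
  qed
  show ?thesis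
  proof (cases "lk \<mu> (PsiVar 0) = 0")
    case True
    then have "PsiVar 0 \<notin> kys \<mu>" by (simp add: in_keys_iff)
    with V have "kys \<mu> \<subseteq> {Tv, Phi22, Phi12, Phi11, Xv 0, Xv 1, Xv 2, Xv 3, PsiVar 1}" by blast
    then have "\<mu> \<in> (\<Union>(A, S)\<in>set (common_boxes 1 (Suc c) {..Suc c} {..<Suc c}). box A S)"
      by (rule common_boxes_cover) 
        \<comment> \<open>Condition 5 bounds X_3 by a and thus also serves for X_1; the strict bound
          next to X_2 is condition 4, from P(\<Psi>(2,0)).\<close>
        ((use D(1-3) in auto)[1], (use D(5) in auto)[1], (use D(5) in auto)[1], (use D(4) in auto)[1], (use D(6,7) in auto)[1], (use D(8) in auto)[1], (use D(9-11) in auto)[1])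
    then show ?thesis by auto
  next
    case False
    have ge: "n \<in> {1..} \<longleftrightarrow> n \<noteq> 0" for n :: nat by auto
    have z: "lk \<mu> (Xv 1) = 0" "lk \<mu> (Xv 2) = 0" "lk \<mu> (Xv 3) = 0" using False D(12-14) by auto
    have "v \<in> {Tv, Phi22, Phi12, Phi11, Xv 0, PsiVar 0, PsiVar 1}" if "v \<in> kys \<mu>" for v
      using subsetD[OF V that] z that by (auto simp: in_keys_iff)
    then have "kys \<mu> \<subseteq> {Tv, Phi22, Phi12, Phi11, Xv 0, PsiVar 0, PsiVar 1}" by blast
    then have "\<mu> \<in> (\<Union>(A, S)\<in>set (extra_boxes_2 (Suc c + d)). box A S)"
      unfolding extra_boxes_2_def Let_def box_def using False
      apply (simp add: Mon_def ge del: atLeast_iff)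
      apply (cases "lk \<mu> Tv = 0"; cases "lk \<mu> Phi22 = 0")
      using D(6,15,16) by auto
    then show ?thesis by auto
  qed
qed

lemma std_cover_3:
  assumes cu: "curve m0 (Suc c) 3" and \<mu>: "\<mu> \<in> curve.std m0 d (Suc c) 3 TYPE('k::field)"
  shows "\<mu> \<in> (\<Union>(A, S)\<in>set (common_boxes 0 (Suc c) {..Suc c} {..Suc c}). box A S)"
proof -
  interpret curve m0 d "Suc c" 3 by (rule cu)
  interpret gs: graded_subst V B "gtE m0 d (Suc c) 3" deg "\<sigma> :: var \<Rightarrow> 'k mpoly" by (rule graded)
  note D = leads_3[OF cu, THEN std_not_dvd[OF \<mu>], simplified GB_set_explicit, simplified, unfolded mon_dvd_mon, simplified]
  have V: "kys \<mu> \<subseteq> {Tv, Phi22, Phi12, Phi11, Xv 0, Xv 1, Xv 2, Xv 3, PsiVar 0}"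
  proof -
    have "kys \<mu> \<subseteq> V" using \<mu> by (auto simp: gs.standard_def Mon_def)
    then show ?thesis using V_explicit by auto
  qed
  show ?thesis
    by (rule common_boxes_cover[OF V]) 
        ((use D(1-3) in auto)[1], (use D(4) in auto)[1], (use D(4) in auto)[1], (use D(4) in auto)[1], (use D(5,6) in auto)[1], (use D(7) in auto)[1], (use D(8-10) in auto)[1])
qed

section \<open>Weight balance and the Groebner property\<close>

context curve begin

lemma std_boxes:
  obtains ps where "std TYPE('k::field) \<subseteq> (\<Union>(A, S)\<in>set ps. box A S)" "\<forall>(A, S)\<in>set ps. finite A"
    "(\<Sum>(A, S)\<leftarrow>ps. \<Prod>v\<in>A. pow_sum (x v) (S v)) = (\<Prod>v\<in>B. pow_sum (x v) UNIV)"
proof -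
  have fin: "(A, S) \<in> set (common_boxes l a N1 N2) \<Longrightarrow> finite A" "(A, S) \<in> set (extra_boxes_1 n) \<Longrightarrow> finite A"
    "(A, S) \<in> set (extra_boxes_2 n) \<Longrightarrow> finite A" for A S l N1 N2 n
    by (auto simp: common_boxes_def extra_boxes_1_def extra_boxes_2_def Let_def)
  show ?thesis
  proof (rule curve_cases)
    fix c assume *: "a = Suc c" "b = Suc 0" "curve m0 (Suc c) (Suc 0)"
    show ?thesis
    proof (rule that[of "common_boxes (3 - b) a {..<a} {..<a} @ extra_boxes_1 (a + d)"])
      show "std TYPE('k) \<subseteq> (\<Union>(A, S)\<in>set (common_boxes (3 - b) a {..<a} {..<a} @ extra_boxes_1 (a + d)). box A S)"
        using std_cover_1[OF *(3), of _ d, where 'k = 'k] * by auto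
    qed (use fin total_1 * in auto)
  next
    fix c assume *: "a = Suc c" "b = 2" "curve m0 (Suc c) 2"
    show ?thesis
    proof (rule that[of "common_boxes (3 - b) a {..a} {..<a} @ extra_boxes_2 (a + d)"])
      show "std TYPE('k) \<subseteq> (\<Union>(A, S)\<in>set (common_boxes (3 - b) a {..a} {..<a} @ extra_boxes_2 (a + d)). box A S)"
        using std_cover_2[OF *(3), of _ d, where 'k = 'k] * by auto
    qed (use fin total_2 * in auto)
  next
    fix c assume *: "a = Suc c" "b = 3" "curve m0 (Suc c) 3"
    show ?thesis
    proof (rule that[of "common_boxes (3 - b) a {..a} {..a} @ []"])
      show "std TYPE('k) \<subseteq> (\<Union>(A, S)\<in>set (common_boxes (3 - b) a {..a} {..a} @ []). box A S)"
        using std_cover_3[OF *(3), of _ d, where 'k = 'k] * by auto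
    qed (use fin total_3 * in auto)
  qed
qed

theorem groebner: "is_groebner_basis (gtE m0 d a b) (GB_set a d b :: 'k::field mpoly set) (ideal_S b (gens_a a d b))"
proof -
  interpret gs: graded_subst V B "gtE m0 d a b" deg "\<sigma> :: var \<Rightarrow> 'k mpoly" by (rule graded)
  obtain ps where ps: "std TYPE('k) \<subseteq> (\<Union>(A, S)\<in>set ps. box A S)" "\<forall>(A, S)\<in>set ps. finite A"
    "(\<Sum>(A, S)\<leftarrow>ps. \<Prod>v\<in>A. pow_sum (x v) (S v)) = (\<Prod>v\<in>B. pow_sum (x v) UNIV)"
    by (rule std_boxes[where 'k = 'k])
  have fin_ps: "finite A" if "(A, S) \<in> set ps" for A S using ps(2) that by auto
  have std_V: "std TYPE('k) \<subseteq> Mon V" by (auto simp: gs.standard_def)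
  have "\<exists>g\<in>GB_set a d b :: 'k mpoly set. g \<noteq> 0 \<and> mon_dvd (lead_mon (gtE m0 d a b) g) (lead_mon (gtE m0 d a b) f)"
    if f: "f \<in> ideal_S b (gens_a a d b)" "f \<noteq> 0" for f :: "'k mpoly"
  proof -
    have kf: "kys f \<subseteq> Mon V" "subst \<sigma> f = 0" using f mem_ideal_iff by auto
    have "lead_mon (gtE m0 d a b) f \<notin> gs.standard (GB_set a d b)"
      \<comment> \<open>The premise on injections is \<open>no_injection\<close> for the covering
        boxes; the equality of total weights is used as an upper bound.\<close>
      by (rule gs.lead_not_standard[OF subst_GB kf f(2)])
         (assumption | rule no_injection[OF std_V ps(1) fin_ps eq_refl[OF ps(3)]])+
    moreover have "lead_mon (gtE m0 d a b) f \<in> Mon V"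
    proof -
      obtain \<mu> where "\<mu> \<in> kys f" "\<And>\<nu>. \<nu> \<in> kys f \<Longrightarrow> \<nu> \<noteq> \<mu> \<Longrightarrow> gtE m0 d a b \<mu> \<nu>"
        using gs.exists_lead[of "kys f"] kf f by auto
      then have "lead_mon (gtE m0 d a b) f = \<mu>" by (rule gs.lead_mon_eqI)
      with \<open>\<mu> \<in> kys f\<close> kf show ?thesis by auto
    qed
    ultimately obtain g \<mu> where g: "g \<in> GB_set a d b" "gs.has_lead g \<mu>" "mon_dvd \<mu> (lead_mon (gtE m0 d a b) f)"
      by (auto simp: gs.standard_def)
    show ?thesis
      by (rule bexI[OF _ g(1)]) (use g gs.has_lead_lead_mon[OF g(2)] in simp)
  qed
  then show ?thesis
    by (simp add: is_groebner_basis_def finite_GB_set[OF b] GB_subset_ideal)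
qed

end

theorem theorem5p1:
  fixes m0 d a b :: nat
  assumes "0 < m0" and "0 < d"
    and "Gcd {mm m0 d 0, mm m0 d 1, mm m0 d 2, mm m0 d 3} = 1"
    and "minimally_generating (\<lambda>i. mm m0 d (int i)) 3"
    and "m0 = 3 * a + b" and "1 \<le> a" and "b \<in> {1, 2, 3}"
  shows "is_groebner_basis (gtE m0 d a b) (GB_set a d b :: 'k::field mpoly set)
           (ideal_S b (gens_a a d b))"
proof -
  interpret curve m0 d a b by unfold_locales (use assms in auto)
  show ?thesis by (rule groebner)
qed

end
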